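(* Let $A$ be any configuration such that $X_A$ is a self-dual projective toric variety. Then the toric ideal $I_A$ is weakly robust.
   Context: A configuration is a finite list $\mathbf a_1,\ldots,\mathbf a_n$ of vectors in some $\mathbb Z^m$ (repetitions allowed), identified with the integer matrix $A$ having these columns. Toric varieties: $K$ is an algebraically closed field of characteristic zero. $I_A\subset K[x_1,\ldots,x_n]$ is the toric ideal generated by all binomials $x^{\mathbf u^+}-x^{\mathbf u^-}$, $\mathbf u\in\ker_{\mathbb Z}(A)$, where $\mathbf u=\mathbf u^+-\mathbf u^-$ with $\mathbf u^+,\mathbf u^-\in\mathbb N^n$ of disjoint support. Standing assumption: $(1,\ldots,1)$ lies in the (rational) row span of $A$; then $I_A$ is homogeneous and $X_A=V(I_A)\subset\mathbb P_K^{n-1}$ is a projective toric variety. The dual variety $X_A^*$ is the closure, in the dual projective space, of the set of hyperplanes that intersect the regular points of $X_A$ non-transversally. $X_A$ is self-dual if it is isomorphic to $X_A^*$ as embedded projective varieties, i.e. some linear isomorphism of the ambient projective spaces carries $X_A$ onto $X_A^*$. Toric bases: the Graver basis $\mathrm{Gr}(A)$ consists of all nonzero $\mathbf u\in\ker_{\mathbb Z}(A)$ that cannot be written as $\mathbf u=\mathbf v+\mathbf w$ with $\mathbf v,\mathbf w\in\ker_{\mathbb Z}(A)$ nonzero, $\mathbf u^+=\mathbf v^++\mathbf w^+$ and $\mathbf u^-=\mathbf v^-+\mathbf w^-$. A minimal Markov basis of $A$ is a finite set $M\subset\ker_{\mathbb Z}(A)$ such that $\{x^{\mathbf u^+}-x^{\mathbf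 u^-}:\mathbf u\in M\}$ is a minimal system of binomial generators of $I_A$. The universal Markov basis $\mathcal M(A)$ is the union of all minimal Markov bases of $A$, up to identification of opposite vectors. The ideal $I_A$ is weakly robust if its Graver basis equals its universal Markov basis (opposite vectors $\mathbf u$ and $-\mathbf u$ being identified). *)

theory Defs
  imports
    "HOL-Analysis.Analysis"
    "HOL-Library.Poly_Mapping"
    "HOL-Computational_Algebra.Polynomial"
begin

section \<open>Polynomials in variables indexed by a finite type\<close>

text \<open>
  The polynomial ring \<open>K[x\<^sub>1,\<dots>,x\<^sub>n]\<close>, with variables indexed by a finite type \<open>'n\<close>, is the
  monoid algebra of \<open>'n \<Rightarrow>\<^sub>0 nat\<close>; its ring structure is that of the library type of finitely
  supported maps (multiplication is convolution).
\<close>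

type_synonym ('n, 'k) mpolynomial = "('n \<Rightarrow>\<^sub>0 nat) \<Rightarrow>\<^sub>0 'k"

definition eval_at :: "('n::finite, 'k::comm_ring_1) mpolynomial \<Rightarrow> 'k ^ 'n \<Rightarrow> 'k" where
  "eval_at f v = (\<Sum>m\<in>Poly_Mapping.keys f. Poly_Mapping.lookup f m * (\<Prod>i\<in>UNIV. (v $ i) ^ Poly_Mapping.lookup m i))"

text \<open>
  In the next definition the truncated subtraction of exponents is harmless: where it truncates,
  the coefficient is zero.
\<close>

definition partial_deriv :: "'n::finite \<Rightarrow> ('n, 'k::comm_ring_1) mpolynomial \<Rightarrow> ('n, 'k) mpolynomial" where
  "partial_deriv i f =
     (\<Sum>m\<in>Poly_Mapping.keys f.
        Poly_Mapping.single (m - Poly_Mapping.single i 1)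
          (of_nat (Poly_Mapping.lookup m i) * Poly_Mapping.lookup f m))"

definition homogeneous :: "('n::finite, 'k::comm_ring_1) mpolynomial \<Rightarrow> bool" where
  "homogeneous f \<longleftrightarrow> (\<exists>d. \<forall>m\<in>Poly_Mapping.keys f. (\<Sum>i\<in>UNIV. Poly_Mapping.lookup m i) = d)"

text \<open>A commutative ring is a module over itself, and the submodule spanned by a set is the ideal it generates.\<close>

definition ideal_gen :: "('n::finite, 'k::comm_ring_1) mpolynomial set \<Rightarrow> ('n, 'k) mpolynomial set" where
  "ideal_gen B = module.span (*) B"


section \<open>Projective space and the Zariski topology\<close>

text \<open>
  A point of the projective space of \<open>K\<^sup>n\<close> is a line through the origin of \<open>K\<^sup>n\<close>, that is, a
  one-dimensional subspace.
\<close>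

definition proj_space :: "('k::field ^ 'n) set set" where
  "proj_space = {p. vec.subspace p \<and> vec.dim p = 1}"

text \<open>
  A polynomial vanishes at a projective point if it vanishes on the whole line; for a homogeneous
  polynomial this is the same as vanishing at one nonzero vector of the line.
\<close>

definition vanishes_at :: "('n::finite, 'k::field) mpolynomial \<Rightarrow> ('k ^ 'n) set \<Rightarrow> bool" where
  "vanishes_at f p \<longleftrightarrow> (\<forall>v\<in>p. eval_at f v = 0)"

definition proj_zeros :: "('n::finite, 'k::field) mpolynomial set \<Rightarrow> ('k ^ 'n) set set" where
  "proj_zeros F = {p \<in> proj_space. \<forall>f\<in>F. vanishes_at f p}"

definition zariski_closed :: "('k::field ^ 'n) set set \<Rightarrow> bool" where
  "zariski_closed Z \<longleftrightarrow> (\<exists>F. (\<forall>f\<in>F. homogeneous f) \<and> Z = proj_zeros F)"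

definition zariski_closure :: "('k::field ^ 'n) set set \<Rightarrow> ('k ^ 'n) set set" where
  "zariski_closure S = zariski_closed hull S"

definition zariski_irreducible :: "('k::field ^ 'n) set set \<Rightarrow> bool" where
  "zariski_irreducible Z \<longleftrightarrow>
     Z \<noteq> {} \<and>
     (\<forall>Z1 Z2. zariski_closed Z1 \<and> zariski_closed Z2 \<and> Z \<subseteq> Z1 \<union> Z2 \<longrightarrow> Z \<subseteq> Z1 \<or> Z \<subseteq> Z2)"

text \<open>The Krull dimension of a Zariski closed set.\<close>

definition proj_dim :: "('k::field ^ 'n) set set \<Rightarrow> enat" where
  "proj_dim X = Sup {enat r | r. \<exists>Z :: nat \<Rightarrow> ('k ^ 'n) set set.
     (\<forall>i\<le>r. zariski_closed (Z i) \<and> zariski_irreducible (Z i) \<and> Z i \<subseteq> X) \<and>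
     (\<forall>i<r. Z i \<subset> Z (Suc i))}"


section \<open>Regular points and the dual variety\<close>

text \<open>
  The linear subspace of \<open>K\<^sup>n\<close> whose projectivization is the embedded projective tangent space of
  \<open>X\<close> at \<open>p\<close>.  By homogeneity the choice of the representative \<open>v\<close> does not matter.
\<close>

definition tangent_space :: "('k::field ^ 'n) set set \<Rightarrow> ('k ^ 'n) set \<Rightarrow> ('k ^ 'n) set" where
  "tangent_space X p =
     {w. \<forall>f. homogeneous f \<and> (\<forall>q\<in>X. vanishes_at f q) \<longrightarrow>
           (\<forall>v\<in>p - {0}. (\<Sum>i\<in>UNIV. eval_at (partial_deriv i f) v * w $ i) = 0)}"

text \<open>
  The Jacobian criterion, for an irreducible \<open>X\<close> (so that the local dimension is the dimension of
  \<open>X\<close>): the tangent space, of projective dimension one less than its linear dimension, has the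
  same dimension as \<open>X\<close>.
\<close>

definition regular_point :: "('k::field ^ 'n) set set \<Rightarrow> ('k ^ 'n) set \<Rightarrow> bool" where
  "regular_point X p \<longleftrightarrow> p \<in> X \<and> enat (vec.dim (tangent_space X p)) = proj_dim X + 1"

text \<open>
  The dual of \<open>K\<^sup>n\<close> is identified with \<open>K\<^sup>n\<close> through the coefficients of a linear form, so a point
  \<open>h\<close> of the dual projective space is a line of coefficient vectors, and it stands for this hyperplane.
\<close>

definition hyperplane :: "('k::field ^ 'n) set \<Rightarrow> ('k ^ 'n) set" where
  "hyperplane h = {x. \<forall>c\<in>h. (\<Sum>i\<in>UNIV. c $ i * x $ i) = 0}"

definition transversal_at :: "('k::field ^ 'n) set \<Rightarrow> ('k ^ 'n) set set \<Rightarrow> ('k ^ 'n) set \<Rightarrow> bool" where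
  "transversal_at H X p \<longleftrightarrow> vec.span (tangent_space X p \<union> H) = UNIV"

definition dual_variety :: "('k::field ^ 'n) set set \<Rightarrow> ('k ^ 'n) set set" where
  "dual_variety X =
     zariski_closure {h \<in> proj_space.
       \<exists>p. regular_point X p \<and> p \<subseteq> hyperplane h \<and> \<not> transversal_at (hyperplane h) X p}"

text \<open>A linear isomorphism from \<open>K\<^sup>n\<close> to its dual is, in coordinates, an invertible matrix.\<close>

definition self_dual :: "('k::field ^ 'n) set set \<Rightarrow> bool" where
  "self_dual X \<longleftrightarrow>
     (\<exists>M :: 'k ^ 'n ^ 'n. invertible M \<and> (\<lambda>p. (\<lambda>v. M *v v) ` p) ` X = dual_variety X)"


section \<open>Toric ideals and toric varieties\<close>

text \<open>
  A configuration is the list of columns of an integer matrix, indexed by \<open>'n\<close>.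
\<close>

definition int_kernel :: "int ^ 'n ^ 'm \<Rightarrow> (int ^ 'n) set" where
  "int_kernel A = {u. A *v u = 0}"

text \<open>The exponent vectors \<open>u\<^sup>+\<close> and \<open>u\<^sup>-\<close>; note that \<open>nat\<close> sends negative integers to \<open>0\<close>.\<close>

lift_definition pos_exp :: "int ^ 'n \<Rightarrow> ('n::finite \<Rightarrow>\<^sub>0 nat)" is "\<lambda>u i. nat (u $ i)"
  by simp

lift_definition neg_exp :: "int ^ 'n \<Rightarrow> ('n::finite \<Rightarrow>\<^sub>0 nat)" is "\<lambda>u i. nat (- (u $ i))"
  by simp

definition binomial_of :: "int ^ 'n \<Rightarrow> ('n::finite, 'k::comm_ring_1) mpolynomial" where
  "binomial_of u = Poly_Mapping.single (pos_exp u) 1 - Poly_Mapping.single (neg_exp u) 1"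

definition toric_ideal :: "int ^ 'n ^ 'm \<Rightarrow> ('n::finite, 'k::comm_ring_1) mpolynomial set" where
  "toric_ideal A = ideal_gen (binomial_of ` int_kernel A)"

definition toric_variety :: "int ^ 'n ^ 'm \<Rightarrow> ('k::field ^ 'n) set set" where
  "toric_variety A = proj_zeros (toric_ideal A)"

definition ones_in_row_span :: "int ^ 'n ^ 'm \<Rightarrow> bool" where
  "ones_in_row_span A \<longleftrightarrow> (\<chi> j. 1) \<in> vec.span (rows (map_matrix rat_of_int A))"


section \<open>Toric bases\<close>

definition graver_basis :: "int ^ 'n ^ 'm \<Rightarrow> (int ^ 'n) set" where
  "graver_basis A =
     {u \<in> int_kernel A. u \<noteq> 0 \<and>
        \<not> (\<exists>v\<in>int_kernel A. \<exists>w\<in>int_kernel A. v \<noteq> 0 \<and> w \<noteq> 0 \<and> u = v + w \<and>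
             pos_exp u = pos_exp v + pos_exp w \<and> neg_exp u = neg_exp v + neg_exp w)}"

text \<open>
  The type argument names the coefficient field, which cannot be inferred from \<open>A\<close> and \<open>M\<close>.
\<close>

definition minimal_markov_basis ::
    "'k::comm_ring_1 itself \<Rightarrow> int ^ 'n ^ 'm \<Rightarrow> (int ^ 'n) set \<Rightarrow> bool" where
  "minimal_markov_basis _ A M \<longleftrightarrow>
     finite M \<and> M \<subseteq> int_kernel A \<and>
     ideal_gen (binomial_of ` M) = (toric_ideal A :: ('n, 'k) mpolynomial set) \<and>
     (\<forall>N. N \<subset> M \<longrightarrow> ideal_gen (binomial_of ` N) \<noteq> (toric_ideal A :: ('n, 'k) mpolynomial set))"

definition universal_markov_basis :: "'k::comm_ring_1 itself \<Rightarrow> int ^ 'n ^ 'm \<Rightarrow> (int ^ 'n) set" where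
  "universal_markov_basis K A = \<Union> {M. minimal_markov_basis K A M}"

text \<open>The image of a set of vectors under the identification of opposite vectors.\<close>

definition up_to_sign :: "(int ^ 'n) set \<Rightarrow> (int ^ 'n) set set" where
  "up_to_sign S = (\<lambda>u. {u, - u}) ` S"

definition weakly_robust :: "'k::comm_ring_1 itself \<Rightarrow> int ^ 'n ^ 'm \<Rightarrow> bool" where
  "weakly_robust K A \<longleftrightarrow> up_to_sign (graver_basis A) = up_to_sign (universal_markov_basis K A)"

end

theory Submission
  imports Defs
begin

text \<open>
  Let \<open>L\<close> be the kernel of \<open>A\<close>.  At a torus point \<open>t\<close> the tangent space is \<open>t \<cdot> L\<^sup>\<bottom>\<close>, so \<open>X\<^sub>A\<^sup>*\<close>
  contains \<open>T \<cdot> L\<close>.  Self-duality gives \<open>X\<^sub>A\<^sup>*\<close> the dimension of \<open>X\<^sub>A\<close>, and a comparison of linear spans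
  bounds the number of columns over which \<open>A\<close> is a pyramid by the number of repetitions of columns;
  hence already the translates by \<open>T\<close> of a generic \<open>l \<in> L\<close>, together with the vectors whose sums over
  classes of equal columns vanish, are dense in \<open>X\<^sub>A\<^sup>*\<close>.  As \<open>L \<subseteq> X\<^sub>A\<^sup>*\<close>, the class sums of any \<open>h \<in> L\<close>
  satisfy the same monomial equations as those of \<open>l\<close>, and orders of vanishing along a line in \<open>L\<close>
  show that every \<open>u \<in> L\<close> sums to zero over each parallel class of the Gale dual.  This sign
  condition makes any element of the fibre of a Graver element \<open>u\<close> that shares a variable with a
  monomial having the class degrees of \<open>u\<^sup>+\<close> have these class degrees too; so the binomial of \<open>u\<close> is
  not generated in lower degree and belongs to a minimal Markov basis.  The converse inclusion only
  needs homogeneity.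
\<close>

text \<open>Krull dimension enters only through an upper bound. A chain of irreducible closed sets
  yields algebraically independent functions on the affine cone, and counting characters allows at
  most rank-many. The opposite inequality comes from self-duality itself: a variety without regular
  points has an empty dual, so \<open>X\<^sub>A\<close> has a regular point, and the tangent
  dimension there forces equality. The same count closes the density argument: a polynomial
  vanishing on \<open>dual_family\<close> but not on the dual variety would be one independent
  function too many. Torus points are taken on curves with an integral weight \<open>y\<close>,
  along which polynomials become Laurent polynomials in one variable with finitely many zeros. Class
  sums stand for passing to the configuration of distinct columns. Coordinates of equal columns
  agree on the torus, so a conormal vector there is constrained only through its class sums: each
  repetition of a column adds a free direction to the dual variety, while each free class imposes a
  linear equation on it. Density needs enough free directions to make up for these
  equations.\<close>

abbreviation lookup :: "('a \<Rightarrow>\<^sub>0 'b::zero) \<Rightarrow> 'a \<Rightarrow> 'b" where "lookup \<equiv> Poly_Mapping.lookup"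
abbreviation keys :: "('a \<Rightarrow>\<^sub>0 'b::zero) \<Rightarrow> 'a set" where "keys \<equiv> Poly_Mapping.keys"
abbreviation single :: "'a \<Rightarrow> 'b::zero \<Rightarrow> 'a \<Rightarrow>\<^sub>0 'b" where "single \<equiv> Poly_Mapping.single"

section \<open>Polynomial functions\<close>

definition mon :: "'k::comm_ring_1 ^ 'n::finite \<Rightarrow> ('n \<Rightarrow>\<^sub>0 nat) \<Rightarrow> 'k" where
  "mon v m = (\<Prod>i\<in>UNIV. (v $ i) ^ lookup m i)"

lemma mon_zero [simp]: "mon v 0 = 1"
  by (simp add: mon_def)

lemma mon_add: "mon v (m + m') = mon v m * mon v m'"
  by (simp add: mon_def lookup_add power_add prod.distrib)

lemma eval_at_superset:
  assumes "finite S" "keys f \<subseteq> S"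
  shows "eval_at f v = (\<Sum>m\<in>S. lookup f m * mon v m)"
  unfolding eval_at_def mon_def using assms
  by (intro sum.mono_neutral_left) (auto simp: in_keys_iff)

lemma eval_at_mon: "eval_at f v = (\<Sum>m\<in>keys f. lookup f m * mon v m)"
  by (simp add: eval_at_def mon_def)

lemma eval_at_zero [simp]: "eval_at 0 v = 0"
  by (simp add: eval_at_def)

lemma eval_at_single [simp]: "eval_at (single m c) v = c * mon v m"
  by (subst eval_at_superset[of "{m}"]) auto

lemma eval_at_one [simp]: "eval_at 1 v = 1"
  using eval_at_single[of 0 1 v] by simp

lemma eval_at_add: "eval_at (f + g) v = eval_at f v + eval_at g v"
proof -
  let ?S = "keys f \<union> keys g"
  have "keys (f + g) \<subseteq> ?S" by (rule keys_add)
  then show ?thesis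
    by (simp add: eval_at_superset[of ?S] lookup_add algebra_simps sum.distrib)
qed

lemma eval_at_minus: "eval_at (- f) v = - eval_at f v"
  using eval_at_add[of f "- f" v] by (simp add: eq_neg_iff_add_eq_0 add.commute)

lemma eval_at_diff: "eval_at (f - g) v = eval_at f v - eval_at g v"
  using eval_at_add[of f "- g" v] by (simp add: eval_at_minus)

lemma eval_at_sum: "eval_at (\<Sum>x\<in>S. f x) v = (\<Sum>x\<in>S. eval_at (f x) v)"
  by (induction S rule: infinite_finite_induct) (auto simp: eval_at_add)

lemma sum_single_keys:
  "(\<Sum>m\<in>keys f. single m (lookup f m)) = f"
  by (rule poly_mapping_eqI)
     (auto simp: lookup_sum lookup_single when_def in_keys_iff)

lemma eval_at_mult: "eval_at (f * g) v = eval_at f v * eval_at g v"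
proof -
  have "f * g = (\<Sum>m\<in>keys f. \<Sum>m'\<in>keys g.
      single (m + m') (lookup f m * lookup g m'))"
  proof -
    have "f * g = (\<Sum>m\<in>keys f. single m (lookup f m)) *
        (\<Sum>m\<in>keys g. single m (lookup g m))"
      by (simp only: sum_single_keys)
    then show ?thesis by (simp only: sum_product mult_single)
  qed
  then have "eval_at (f * g) v = (\<Sum>m\<in>keys f. \<Sum>m'\<in>keys g.
      lookup f m * lookup g m' * mon v (m + m'))"
    by (simp only: eval_at_sum eval_at_single)
  also have "\<dots> = eval_at f v * eval_at g v"
    by (simp add: eval_at_mon[of f] eval_at_mon[of g] mon_add sum_product mult_ac)
  finally show ?thesis .
qed

lemma eval_at_prod: "eval_at (\<Prod>x\<in>S. f x) v = (\<Prod>x\<in>S. eval_at (f x) v)"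
  by (induction S rule: infinite_finite_induct) (auto simp: eval_at_mult)

lemma eval_at_power: "eval_at (f ^ e) v = eval_at f v ^ e"
  by (induction e) (auto simp: eval_at_mult)

lemma mon_single_one: "mon v (single i 1) = v $ i"
proof -
  have "mon v (single i 1) = (\<Prod>j\<in>{i}. v $ j ^ lookup (single i 1) j)"
    unfolding mon_def by (rule prod.mono_neutral_right) (auto simp: lookup_single when_def)
  then show ?thesis by simp
qed

section \<open>Degrees and homogeneous components\<close>

definition tdeg :: "('n::finite \<Rightarrow>\<^sub>0 nat) \<Rightarrow> nat" where
  "tdeg m = (\<Sum>i\<in>UNIV. lookup m i)"

lemma tdeg_zero [simp]: "tdeg 0 = 0" and tdeg_add: "tdeg (m + m') = tdeg m + tdeg m'"
  by (simp_all add: tdeg_def lookup_add sum.distrib)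

lemma tdeg_eq_0_iff [simp]: "tdeg m = 0 \<longleftrightarrow> m = 0"
proof
  assume "tdeg m = 0"
  then have "lookup m i = 0" for i by (simp add: tdeg_def)
  then show "m = 0" by (intro poly_mapping_eqI) simp
qed simp

lemma mon_smult: "mon (c *s v) m = c ^ tdeg m * mon v m"
  by (simp add: mon_def tdeg_def power_mult_distrib prod.distrib power_sum)

definition homdeg :: "nat \<Rightarrow> ('n::finite, 'k::comm_ring_1) mpolynomial \<Rightarrow> bool" where
  "homdeg e f \<longleftrightarrow> (\<forall>m\<in>keys f. tdeg m = e)"

lemma homogeneous_iff: "homogeneous f \<longleftrightarrow> (\<exists>e. homdeg e f)"
  by (simp add: homogeneous_def homdeg_def tdeg_def)

lemma eval_at_homdeg_smult: "homdeg e f \<Longrightarrow> eval_at f (c *s v) = c ^ e * eval_at f v"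
  by (simp add: eval_at_mon mon_smult homdeg_def sum_distrib_left mult_ac cong: sum.cong)

lemma homdeg_mult: "homdeg d f \<Longrightarrow> homdeg e g \<Longrightarrow> homdeg (d + e) (f * g)"
  using keys_mult[of f g] unfolding homdeg_def by (fastforce simp: tdeg_add)

lemma homdeg_add: "homdeg e f \<Longrightarrow> homdeg e g \<Longrightarrow> homdeg e (f + g)"
  using keys_add[of f g] unfolding homdeg_def by auto

lemma homdeg_zero [simp]: "homdeg e 0"
  by (simp add: homdeg_def)

lemma homdeg_uminus: "homdeg e f \<Longrightarrow> homdeg e (- f)"
  by (simp add: homdeg_def in_keys_iff)

lemma homdeg_diff: "homdeg e f \<Longrightarrow> homdeg e g \<Longrightarrow> homdeg e (f - g)"
  using homdeg_add[of e f "- g"] homdeg_uminus[of e g] by simp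

lemma homdeg_sum: "(\<And>x. x \<in> S \<Longrightarrow> homdeg e (f x)) \<Longrightarrow> homdeg e (\<Sum>x\<in>S. f x)"
  by (induction S rule: infinite_finite_induct) (auto intro: homdeg_add)

lemma homdeg_single: "tdeg m = e \<Longrightarrow> homdeg e (single m c)"
  by (simp add: homdeg_def)

definition hom_part :: "nat \<Rightarrow> ('n::finite, 'k::comm_ring_1) mpolynomial \<Rightarrow> ('n, 'k) mpolynomial" where
  "hom_part e f = (\<Sum>m\<in>{m \<in> keys f. tdeg m = e}. single m (lookup f m))"

lemma lookup_hom_part:
  "lookup (hom_part e f) m = (if tdeg m = e then lookup f m else 0)"
  by (auto simp: hom_part_def lookup_sum lookup_single when_def in_keys_iff)

lemma homdeg_hom_part: "homdeg e (hom_part e f)"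
  by (auto simp: homdeg_def in_keys_iff lookup_hom_part split: if_splits)

lemma hom_part_add: "hom_part e (f + g) = hom_part e f + hom_part e g"
  by (rule poly_mapping_eqI) (simp add: lookup_hom_part lookup_add)

lemma hom_part_homdeg: "homdeg d f \<Longrightarrow> hom_part e f = (if d = e then f else 0)"
  by (rule poly_mapping_eqI) (auto simp: lookup_hom_part homdeg_def in_keys_iff)

lemma sum_hom_parts:
  assumes "\<And>m. m \<in> keys f \<Longrightarrow> tdeg m \<le> N"
  shows "f = (\<Sum>e\<le>N. hom_part e f)"
  using assms by (intro poly_mapping_eqI) (fastforce simp: lookup_sum lookup_hom_part in_keys_iff)

lemma eval_at_hom_parts:
  assumes "\<And>m. m \<in> keys f \<Longrightarrow> tdeg m \<le> N"
  shows "eval_at f v = (\<Sum>e\<le>N. eval_at (hom_part e f) v)"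
  using sum_hom_parts[OF assms] by (metis eval_at_sum)

text \<open>Vanishing and independence concern values only. Working with functions makes
  substitutions such as \<open>M *v v\<close> a matter of closure rules.\<close>

definition polyfun :: "('k::comm_ring_1 ^ 'n::finite \<Rightarrow> 'k) \<Rightarrow> bool" where
  "polyfun g \<longleftrightarrow> (\<exists>p. g = eval_at p)"

lemma polyfun_eval_at: "polyfun (eval_at p)"
  by (auto simp: polyfun_def)

lemma polyfun_const: "polyfun (\<lambda>v. c)"
  unfolding polyfun_def by (rule exI[of _ "single 0 c"]) (simp add: fun_eq_iff)

lemma polyfun_coord: "polyfun (\<lambda>v. v $ i)"
  unfolding polyfun_def
  by (rule exI[of _ "single (single i 1) 1"])
     (simp add: mon_single_one fun_eq_iff del: One_nat_def)

lemma polyfun_add: "polyfun g \<Longrightarrow> polyfun h \<Longrightarrow> polyfun (\<lambda>v. g v + h v)"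
  unfolding polyfun_def by (elim exE, rule_tac x = "p + pa" in exI) (simp add: fun_eq_iff eval_at_add)

lemma polyfun_mult: "polyfun g \<Longrightarrow> polyfun h \<Longrightarrow> polyfun (\<lambda>v. g v * h v)"
  unfolding polyfun_def by (elim exE, rule_tac x = "p * pa" in exI) (simp add: fun_eq_iff eval_at_mult)

lemma polyfun_diff: "polyfun g \<Longrightarrow> polyfun h \<Longrightarrow> polyfun (\<lambda>v. g v - h v)"
  unfolding polyfun_def by (elim exE, rule_tac x = "p - pa" in exI) (simp add: fun_eq_iff eval_at_diff)

lemma polyfun_sum: "(\<And>x. x \<in> S \<Longrightarrow> polyfun (g x)) \<Longrightarrow> polyfun (\<lambda>v. \<Sum>x\<in>S. g x v)"
  by (induction S rule: infinite_finite_induct) (simp_all add: polyfun_const polyfun_add)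

lemma polyfun_prod: "(\<And>x. x \<in> S \<Longrightarrow> polyfun (g x)) \<Longrightarrow> polyfun (\<lambda>v. \<Prod>x\<in>S. g x v)"
  by (induction S rule: infinite_finite_induct) (simp_all add: polyfun_const polyfun_mult)

lemma polyfun_power: "polyfun g \<Longrightarrow> polyfun (\<lambda>v. g v ^ e)"
  by (induction e) (simp_all add: polyfun_const polyfun_mult)

lemma polyfun_compose:
  assumes "polyfun g" "\<And>i. polyfun (\<lambda>v. \<phi> v $ i)"
  shows "polyfun (\<lambda>v. g (\<phi> v))"
proof -
  obtain p where p: "g = eval_at p" using assms(1) by (auto simp: polyfun_def)
  show ?thesis unfolding p eval_at_mon mon_def
    by (intro polyfun_sum polyfun_mult polyfun_const polyfun_prod polyfun_power assms(2))
qed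

lemma polyfun_matrix_vector: "polyfun g \<Longrightarrow> polyfun (\<lambda>v. g (M *v v))"
  by (rule polyfun_compose)
     (simp_all add: matrix_vector_mult_def polyfun_sum polyfun_mult polyfun_const polyfun_coord)

section \<open>Finite linear algebra and generic elements\<close>

text \<open>Gaussian elimination, by induction on the set \<open>B\<close> of equations: a nonzero
  coefficient in equation \<open>b\<close> lets one unknown be eliminated from all the
  others.\<close>

lemma nontrivial_solution:
  fixes \<alpha> :: "'a \<Rightarrow> 'b \<Rightarrow> 'k::field"
  assumes "finite B" "finite I" "card I > card B"
  shows "\<exists>c. (\<exists>a\<in>I. c a \<noteq> 0) \<and> (\<forall>b\<in>B. (\<Sum>a\<in>I. c a * \<alpha> a b) = 0)"
  using assms
proof (induction B arbitrary: I \<alpha> rule: finite_induct)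
  case empty
  then obtain a where "a \<in> I" by fastforce
  then show ?case by (intro exI[of _ "\<lambda>_. 1"]) auto
next
  case (insert b B)
  show ?case
  proof (cases "\<forall>a\<in>I. \<alpha> a b = 0")
    case True
    have "card I > card B" using insert by simp
    then obtain c where "(\<exists>a\<in>I. c a \<noteq> 0)" "\<forall>b\<in>B. (\<Sum>a\<in>I. c a * \<alpha> a b) = 0"
      using insert.IH[OF insert.prems(1)] by blast
    then show ?thesis using True by (intro exI[of _ c]) auto
  next
    case False
    then obtain a0 where a0: "a0 \<in> I" "\<alpha> a0 b \<noteq> 0" by auto
    define I' where "I' = I - {a0}"
    \<comment> \<open>The coefficients after clearing equation \<open>b\<close> with the pivot
      \<open>a0\<close>; below, \<open>x\<close> is the value of the unknown \<open>a0\<close> found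
      by back substitution.\<close>
    define \<alpha>' where "\<alpha>' a b' = \<alpha> a b' - \<alpha> a b / \<alpha> a0 b * \<alpha> a0 b'" for a b'
    have I': "finite I'" "card I' > card B" using insert a0 by (auto simp: I'_def)
    then obtain c where c: "\<exists>a\<in>I'. c a \<noteq> 0" "\<forall>b'\<in>B. (\<Sum>a\<in>I'. c a * \<alpha>' a b') = 0"
      using insert.IH[OF I', of \<alpha>'] by blast
    define x where "x = - (\<Sum>a\<in>I'. c a * \<alpha> a b) / \<alpha> a0 b"
    define c' where "c' = c(a0 := x)"
    have split: "(\<Sum>a\<in>I. c' a * \<alpha> a b') = x * \<alpha> a0 b' + (\<Sum>a\<in>I'. c a * \<alpha> a b')" for b'
    proof -
      have "(\<Sum>a\<in>I. c' a * \<alpha> a b') = c' a0 * \<alpha> a0 b' + (\<Sum>a\<in>I'. c' a * \<alpha> a b')"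
        unfolding I'_def using a0 insert.prems by (simp add: sum.remove)
      moreover have "(\<Sum>a\<in>I'. c' a * \<alpha> a b') = (\<Sum>a\<in>I'. c a * \<alpha> a b')"
        by (intro sum.cong) (auto simp: c'_def I'_def)
      ultimately show ?thesis by (simp add: c'_def)
    qed
    have "(\<Sum>a\<in>I. c' a * \<alpha> a b) = 0" using a0 by (simp add: split x_def)
    moreover have "(\<Sum>a\<in>I. c' a * \<alpha> a b') = 0" if "b' \<in> B" for b'
    proof -
      have "0 = (\<Sum>a\<in>I'. c a * \<alpha>' a b')" using c that by simp
      also have "\<dots> = (\<Sum>a\<in>I'. c a * \<alpha> a b') - (\<Sum>a\<in>I'. c a * \<alpha> a b) / \<alpha> a0 b * \<alpha> a0 b'"
        by (simp add: \<alpha>'_def algebra_simps sum_subtractf sum_distrib_left sum_divide_distrib)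
      finally show ?thesis by (simp add: split x_def)
    qed
    moreover have "\<exists>a\<in>I. c' a \<noteq> 0" using c(1) by (auto simp: c'_def I'_def)
    ultimately show ?thesis by (intro exI[of _ c']) auto
  qed
qed

text \<open>A lattice is not a finite union of proper kernels of linear forms. A large multiple of
  the element found so far is added to one that suits the new form.\<close>

lemma generic_element:
  fixes G :: "(int ^ 'n::finite) set" and \<phi> :: "'a \<Rightarrow> int ^ 'n \<Rightarrow> int"
  assumes fin: "finite I"
    and G: "0 \<in> G" "\<And>x y c. x \<in> G \<Longrightarrow> y \<in> G \<Longrightarrow> c *s x + y \<in> G"
    and lin: "\<And>i x y c. \<phi> i (c *s x + y) = c * \<phi> i x + \<phi> i y"
    and ex: "\<And>i. i \<in> I \<Longrightarrow> \<exists>x\<in>G. \<phi> i x \<noteq> 0"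
  shows "\<exists>x\<in>G. \<forall>i\<in>I. \<phi> i x \<noteq> 0"
  using fin ex
proof (induction I rule: finite_induct)
  case empty
  then show ?case using G(1) by blast
next
  case (insert i I)
  have "\<exists>x\<in>G. \<forall>i\<in>I. \<phi> i x \<noteq> 0" by (rule insert.IH) (rule insert.prems, simp)
  then obtain x where x: "x \<in> G" "\<forall>i\<in>I. \<phi> i x \<noteq> 0" by blast
  obtain y where y: "y \<in> G" "\<phi> i y \<noteq> 0" using insert.prems[of i] by blast
  \<comment> \<open>\<open>N\<close> exceeds every \<open>\<bar>\<phi> j y\<bar>\<close>, whereas
    \<open>\<bar>\<phi> j x\<bar> \<ge> 1\<close>, so \<open>N * \<phi> j x\<close> cannot cancel
    \<open>\<phi> j y\<close>.\<close>
  define N where "N = 1 + (\<Sum>j\<in>I. \<bar>\<phi> j y\<bar>)"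
  show ?case
  proof (cases "\<phi> i x = 0")
    case True
    have "\<phi> j (N *s x + y) \<noteq> 0" if j: "j \<in> I" for j
    proof
      assume "\<phi> j (N *s x + y) = 0"
      then have "N * \<phi> j x = - \<phi> j y" unfolding lin by (rule eq_neg_iff_add_eq_0[THEN iffD2])
      then have eq: "\<bar>N\<bar> * \<bar>\<phi> j x\<bar> = \<bar>\<phi> j y\<bar>" by (metis abs_minus_cancel abs_mult)
      have "\<bar>\<phi> j x\<bar> \<ge> 1" using zero_less_abs_iff[of "\<phi> j x"] bspec[OF x(2) j] by linarith
      have "N \<le> \<bar>N\<bar> * 1" by simp
      also have "\<dots> \<le> \<bar>N\<bar> * \<bar>\<phi> j x\<bar>" by (rule mult_left_mono) (fact, simp)
      also have "\<dots> < N"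
        using member_le_sum[OF j, of "\<lambda>j. \<bar>\<phi> j y\<bar>"] insert.hyps unfolding eq by (simp add: N_def)
      finally show False by simp
    qed
    moreover have "\<phi> i (N *s x + y) \<noteq> 0" unfolding lin using True y by simp
    moreover have "N *s x + y \<in> G" using G(2)[OF x(1) y(1)] .
    ultimately show ?thesis by blast
  next
    case False
    then show ?thesis using x by blast
  qed
qed

section \<open>Points of the torus and the affine cone of a toric variety\<close>

definition idot :: "int ^ 'm::finite \<Rightarrow> int ^ 'm \<Rightarrow> int" where
  "idot y b = (\<Sum>k\<in>UNIV. y $ k * b $ k)"

text \<open>The multigrading by \<open>A\<close>: two monomials have the same degree iff their
  exponents differ by a kernel vector, and then they agree on the cone.\<close>

definition adeg :: "int ^ 'n ^ 'm \<Rightarrow> ('n::finite \<Rightarrow>\<^sub>0 nat) \<Rightarrow> int ^ 'm::finite" where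
  "adeg A m = (\<chi> k. \<Sum>i\<in>UNIV. A $ k $ i * int (lookup m i))"

text \<open>For fixed \<open>y\<close> this is a one-parameter subgroup of the torus, passing
  through the all-ones point at \<open>\<tau> = 1\<close>.\<close>

definition tor :: "int ^ 'n ^ 'm \<Rightarrow> int ^ 'm::finite \<Rightarrow> 'k::field \<Rightarrow> 'k ^ 'n::finite" where
  "tor A y \<tau> = (\<chi> i. \<tau> powi idot y (column i A))"

text \<open>The affine cone over the toric variety, cut out by the binomials alone.\<close>

definition toric_cone :: "int ^ 'n ^ 'm::finite \<Rightarrow> ('k::comm_ring_1 ^ 'n::finite) set" where
  "toric_cone A = {v. \<forall>u\<in>int_kernel A. mon v (pos_exp u) = mon v (neg_exp u)}"

lemma idot_linear: "idot (c *s x + y) b = c * idot x b + idot y b"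
  by (simp add: idot_def algebra_simps sum.distrib sum_distrib_left)

lemma idot_diff: "idot y (b - b') = idot y b - idot y b'"
  by (simp add: idot_def algebra_simps sum_subtractf)

lemma idot_sum: "idot y (\<Sum>x\<in>S. f x) = (\<Sum>x\<in>S. idot y (f x))"
  by (simp add: idot_def sum_component sum_distrib_left) (rule sum.swap)

lemma idot_self_eq_0: "idot b b = 0 \<longleftrightarrow> b = 0"
  by (simp add: idot_def sum_nonneg_eq_0_iff vec_eq_iff)

lemma idot_smult_right: "idot y (c *s b) = c * idot y b"
  by (simp add: idot_def sum_distrib_left mult_ac)

lemma adeg_columns: "adeg A m = (\<Sum>i\<in>UNIV. int (lookup m i) *s column i A)"
  by (simp add: adeg_def vec_eq_iff sum_component column_def mult.commute)

lemma adeg_add: "adeg A (m + m') = adeg A m + adeg A m'"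
  by (simp add: adeg_def vec_eq_iff lookup_add algebra_simps sum.distrib)

lemma int_kernel_iff: "u \<in> int_kernel A \<longleftrightarrow> (\<forall>k. (\<Sum>i\<in>UNIV. A $ k $ i * u $ i) = 0)"
  by (simp add: int_kernel_def vec_eq_iff matrix_vector_mult_def)

lemma lookup_pos_exp [simp]: "lookup (pos_exp u) i = nat (u $ i)"
  by (simp add: pos_exp.rep_eq)

lemma lookup_neg_exp [simp]: "lookup (neg_exp u) i = nat (- (u $ i))"
  by (simp add: neg_exp.rep_eq)

lemma adeg_pos_neg: "u \<in> int_kernel A \<Longrightarrow> adeg A (pos_exp u) = adeg A (neg_exp u)"
proof -
  assume u: "u \<in> int_kernel A"
  have "adeg A (pos_exp u) $ k - adeg A (neg_exp u) $ k = 0" for k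
  proof -
    have "adeg A (pos_exp u) $ k - adeg A (neg_exp u) $ k
        = (\<Sum>i\<in>UNIV. A $ k $ i * (int (nat (u $ i)) - int (nat (- (u $ i)))))"
      by (simp add: adeg_def sum_subtractf right_diff_distrib)
    also have "\<dots> = (\<Sum>i\<in>UNIV. A $ k $ i * u $ i)"
      by (intro sum.cong refl arg_cong2[of _ _ _ _ "(*)"]) simp
    finally show ?thesis using u by (simp add: int_kernel_iff)
  qed
  then show ?thesis by (simp add: vec_eq_iff)
qed

lemma adeg_eq_iff:
  "adeg A m = adeg A m' \<longleftrightarrow> (\<chi> i. int (lookup m i) - int (lookup m' i)) \<in> int_kernel A"
  by (simp add: int_kernel_iff adeg_def vec_eq_iff algebra_simps sum_subtractf)

lemma adeg_eq_imp:
  assumes "adeg A m = adeg A m'"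
  shows "\<exists>u\<in>int_kernel A. \<exists>r. m = r + pos_exp u \<and> m' = r + neg_exp u"
proof -
  define u :: "int ^ 'b" where "u = (\<chi> i. int (lookup m i) - int (lookup m' i))"
  have "u \<in> int_kernel A"
    using assms by (simp add: u_def adeg_eq_iff)
  moreover have "m = (m - pos_exp u) + pos_exp u" "m' = (m - pos_exp u) + neg_exp u"
    by (rule poly_mapping_eqI, simp add: lookup_add lookup_minus u_def)+
  ultimately show ?thesis by blast
qed

lemma mon_cong_adeg:
  assumes "v \<in> toric_cone A" "adeg A m = adeg A m'"
  shows "mon v m = mon v m'"
proof -
  obtain u r where "u \<in> int_kernel A" "m = r + pos_exp u" "m' = r + neg_exp u"
    using adeg_eq_imp[OF assms(2)] by blast
  then show ?thesis using assms(1) by (simp add: mon_add toric_cone_def)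
qed

section \<open>Characters along one-parameter subgroups\<close>

lemma power_int_sum: "\<tau> \<noteq> 0 \<Longrightarrow> \<tau> powi (\<Sum>x\<in>S. f x) = (\<Prod>x\<in>S. (\<tau>::'k::field) powi f x)"
  by (induction S rule: infinite_finite_induct) (auto simp: power_int_add)

lemma power_int_mult_nat: "(\<tau>::'k::field) powi (a * int n) = (\<tau> powi a) ^ n"
  by (simp add: power_int_mult)

lemma power_int_nonneg_exp: "k \<ge> 0 \<Longrightarrow> x powi k = x ^ nat k"
  by (simp add: power_int_def)

lemma mon_tor: "\<tau> \<noteq> 0 \<Longrightarrow> mon (tor A y \<tau>) m = \<tau> powi idot y (adeg A m)"
  by (simp add: mon_def tor_def adeg_columns idot_sum idot_smult_right power_int_sum
      mult.commute[of "int _"] power_int_mult_nat)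

lemma tor_in_cone: "\<tau> \<noteq> 0 \<Longrightarrow> tor A y \<tau> \<in> toric_cone A"
  by (auto simp: toric_cone_def mon_tor adeg_pos_neg)

lemma tor_nz: "\<tau> \<noteq> 0 \<Longrightarrow> tor A y \<tau> $ i \<noteq> 0"
  by (simp add: tor_def)

text \<open>The exponents \<open>k e\<close> may repeat; the hypothesis says that the coefficient
  collected at exponent \<open>k0\<close> is nonzero. Multiplication by \<open>\<tau> powi N\<close>
  leaves a nonzero polynomial.\<close>

lemma laurent_finite_zeros:
  fixes \<alpha> :: "'a \<Rightarrow> 'k::field"
  assumes "finite E" "(\<Sum>e\<in>{e\<in>E. k e = k0}. \<alpha> e) \<noteq> 0"
  shows "finite {\<tau>. \<tau> \<noteq> 0 \<and> (\<Sum>e\<in>E. \<alpha> e * \<tau> powi k e) = 0}"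
proof -
  define N where "N = \<bar>k0\<bar> + (\<Sum>e\<in>E. \<bar>k e\<bar>)"
  have N: "k e + N \<ge> 0" if "e \<in> E" for e
    using member_le_sum[OF that, of "\<lambda>e. \<bar>k e\<bar>"] assms(1) by (simp add: N_def)
  have N0: "k0 + N \<ge> 0" 
  proof -
    have "(\<Sum>e\<in>E. \<bar>k e\<bar>) \<ge> 0" by (simp add: sum_nonneg)
    then show ?thesis unfolding N_def by linarith
  qed
  define p where "p = (\<Sum>e\<in>E. monom (\<alpha> e) (nat (k e + N)))"
  have "coeff p (nat (k0 + N)) = (\<Sum>e\<in>E. if k e = k0 then \<alpha> e else 0)"
    unfolding p_def coeff_sum using N N0 by (intro sum.cong refl) (auto simp: nat_eq_iff)
  also have "\<dots> = (\<Sum>e\<in>{e\<in>E. k e = k0}. \<alpha> e)" using assms(1) by (simp add: sum.inter_filter)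
  finally have "p \<noteq> 0" using assms(2) by auto
  then have fin: "finite {\<tau>. poly p \<tau> = 0}" by (rule poly_roots_finite)
  have "poly p \<tau> = \<tau> powi N * (\<Sum>e\<in>E. \<alpha> e * \<tau> powi k e)" if "\<tau> \<noteq> 0" for \<tau>
  proof -
    have "\<tau> ^ nat (k e + N) = \<tau> powi N * \<tau> powi k e" if "e \<in> E" for e
      using \<open>\<tau> \<noteq> 0\<close>
      by (simp only: power_int_nonneg_exp[OF N[OF that], symmetric] power_int_add mult.commute simp_thms)
    then show ?thesis
      by (simp add: p_def poly_sum poly_monom sum_distrib_left mult_ac cong: sum.cong)
  qed
  then show ?thesis by (intro rev_finite_subset[OF fin]) auto
qed

text \<open>The form \<open>idot y (b e - b e')\<close> is nonzero at \<open>y = b e - b e'\<close>,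
  so a generic weight avoids the finitely many kernels.\<close>

lemma separating_weight:
  fixes b :: "'a \<Rightarrow> int ^ 'm::finite"
  assumes "finite E"
  shows "\<exists>y. \<forall>e\<in>E. \<forall>e'\<in>E. idot y (b e) = idot y (b e') \<longrightarrow> b e = b e'"
proof -
  let ?I = "{(e, e') \<in> E \<times> E. b e \<noteq> b e'}"
  have "\<exists>y\<in>UNIV. \<forall>p\<in>?I. (\<lambda>(e, e') y. idot y (b e - b e')) p y \<noteq> 0"
  proof (rule generic_element)
    show "finite ?I" using assms by (auto intro: finite_subset[of _ "E \<times> E"])
    show "\<exists>x\<in>UNIV. (case p of (e, e') \<Rightarrow> \<lambda>y. idot y (b e - b e')) x \<noteq> 0" if "p \<in> ?I" for p
      using that by (auto intro!: exI[of _ "b (fst p) - b (snd p)"] simp: idot_self_eq_0)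
  qed (auto simp: idot_linear)
  then show ?thesis by (fastforce simp: idot_diff)
qed

lemma eval_at_tor:
  "\<tau> \<noteq> 0 \<Longrightarrow> eval_at f (tor A y \<tau>) =
    (\<Sum>m\<in>keys f. lookup f m * \<tau> powi idot y (adeg A m))"
  by (simp add: eval_at_mon mon_tor)

text \<open>Independence of the characters of a torus. A separating weight merges only equal
  characters, and the resulting Laurent polynomial would vanish at infinitely many points.\<close>

lemma characters_independent:
  fixes \<alpha> :: "'a \<Rightarrow> 'k::field_char_0" and b :: "'a \<Rightarrow> int ^ 'm::finite"
  assumes "finite E" "\<And>y \<tau>. \<tau> \<noteq> 0 \<Longrightarrow> (\<Sum>e\<in>E. \<alpha> e * \<tau> powi idot y (b e)) = 0"
  shows "(\<Sum>e\<in>{e\<in>E. b e = b0}. \<alpha> e) = 0"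
proof (rule ccontr)
  assume nz: "(\<Sum>e\<in>{e\<in>E. b e = b0}. \<alpha> e) \<noteq> 0"
  then obtain e0 where e0: "e0 \<in> E" "b e0 = b0" by (smt (verit) Collect_empty_eq sum.empty)
  obtain y where y: "\<forall>e\<in>E. \<forall>e'\<in>E. idot y (b e) = idot y (b e') \<longrightarrow> b e = b e'"
    using separating_weight[OF assms(1), of b] by blast
  have "{e\<in>E. b e = b0} = {e\<in>E. idot y (b e) = idot y b0}" using y e0 by auto
  then have "finite {\<tau>::'k. \<tau> \<noteq> 0 \<and> (\<Sum>e\<in>E. \<alpha> e * \<tau> powi idot y (b e)) = 0}"
    using nz by (intro laurent_finite_zeros[OF assms(1)]) auto
  moreover have "{\<tau>::'k. \<tau> \<noteq> 0 \<and> (\<Sum>e\<in>E. \<alpha> e * \<tau> powi idot y (b e)) = 0} = - {0}"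
    using assms(2) by auto
  ultimately show False using infinite_UNIV_char_0[where 'a='k] by (simp add: finite_compl)
qed

text \<open>On the cone a monomial depends on its degree only, so any representative will do. For a
  degree in \<open>S\<close> that \<open>f\<close> does not attain, the inner sum is empty and the
  choice is immaterial.\<close>

lemma eval_at_cone:
  assumes v: "v \<in> toric_cone A" and S: "finite S" "adeg A ` keys f \<subseteq> S"
  shows "eval_at f v = (\<Sum>b\<in>S. mon v (SOME m. adeg A m = b) *
     (\<Sum>m\<in>{m\<in>keys f. adeg A m = b}. lookup f m))"
proof -
  have "eval_at f v = (\<Sum>b\<in>S. \<Sum>m\<in>{m\<in>keys f. adeg A m = b}. lookup f m * mon v m)"
    unfolding eval_at_mon by (rule sum.group[symmetric]) (use S in auto)
  also have "\<dots> = (\<Sum>b\<in>S. mon v (SOME m. adeg A m = b) *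
     (\<Sum>m\<in>{m\<in>keys f. adeg A m = b}. lookup f m))"
  proof (intro sum.cong refl)
    fix b
    have "mon v m = mon v (SOME m. adeg A m = b)" if "adeg A m = b" for m
      using someI[of "\<lambda>m. adeg A m = b", OF that] that by (intro mon_cong_adeg[OF v]) auto
    then show "(\<Sum>m\<in>{m\<in>keys f. adeg A m = b}. lookup f m * mon v m) =
        mon v (SOME m. adeg A m = b) *
        (\<Sum>m\<in>{m\<in>keys f. adeg A m = b}. lookup f m)"
      by (subst sum_distrib_left) (intro sum.cong refl, auto simp: mult.commute)
  qed
  finally show ?thesis .
qed

lemma fibre_sum_nonzero:
  assumes "v \<in> toric_cone A" "eval_at f v \<noteq> 0"
  shows "\<exists>b. (\<Sum>m\<in>{m\<in>keys f. adeg A m = b}. lookup f m) \<noteq> 0"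
  using assms(2) unfolding eval_at_cone[OF assms(1) finite_imageI[OF finite_keys] subset_refl]
  by (metis (no_types, lifting) mult_zero_right sum.neutral)

text \<open>A weight separating the degrees in \<open>f\<close> and in \<open>g\<close> gives a curve in the torus on which both have finitely many zeros.\<close>

lemma cone_generic_torus_point:
  fixes g h :: "'k::field_char_0 ^ 'n::finite \<Rightarrow> 'k"
  assumes "polyfun g" "polyfun h"
    and "\<exists>v\<in>toric_cone A. g v \<noteq> 0" "\<exists>v\<in>toric_cone A. h v \<noteq> 0"
  shows "\<exists>y \<tau>. \<tau> \<noteq> 0 \<and> g (tor A y \<tau>) \<noteq> 0 \<and> h (tor A y \<tau>) \<noteq> 0"
proof -
  obtain p q where pq: "g = eval_at p" "h = eval_at q" using assms by (auto simp: polyfun_def)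
  let ?s = "\<lambda>p b. (\<Sum>m\<in>{m\<in>keys p. adeg A m = b}. lookup p m)"
  obtain b b' where b: "?s p b \<noteq> 0" "?s q b' \<noteq> 0"
    using assms(3,4) fibre_sum_nonzero[of _ A p] fibre_sum_nonzero[of _ A q] unfolding pq by blast
  let ?E = "keys p \<union> keys q"
  obtain y where y: "\<forall>e\<in>?E. \<forall>e'\<in>?E. idot y (adeg A e) = idot y (adeg A e') \<longrightarrow> adeg A e = adeg A e'"
    using separating_weight[of ?E "adeg A"] by auto
  have fin: "finite {\<tau>::'k. \<tau> \<noteq> 0 \<and> eval_at r (tor A y \<tau>) = 0}"
    if r: "keys r \<subseteq> ?E" and nz: "?s r c \<noteq> 0" for r c
  proof -
    obtain e0 where e0: "e0 \<in> keys r" "adeg A e0 = c"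
      using nz by (smt (verit) Collect_empty_eq sum.empty)
    have "{m\<in>keys r. adeg A m = c} = {m\<in>keys r. idot y (adeg A m) = idot y c}"
      using y e0 r by auto
    then have "finite {\<tau>. \<tau> \<noteq> 0 \<and> (\<Sum>m\<in>keys r. lookup r m * \<tau> powi idot y (adeg A m)) = 0}"
      using nz by (intro laurent_finite_zeros[where ?k0.0 = "idot y c"]) auto
    then show ?thesis by (rule rev_finite_subset) (auto simp: eval_at_tor)
  qed
  define Z where "Z = {0} \<union> {\<tau>::'k. \<tau> \<noteq> 0 \<and> g (tor A y \<tau>) = 0} \<union> {\<tau>. \<tau> \<noteq> 0 \<and> h (tor A y \<tau>) = 0}"
  have "finite Z"
    unfolding Z_def pq by (intro finite_UnI fin[OF _ b(1)] fin[OF _ b(2)]) simp_all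
  then obtain \<tau> where "\<tau> \<notin> Z"
    using ex_new_if_finite[OF infinite_UNIV_char_0, of Z] by auto
  then show ?thesis by (auto simp: Z_def)
qed

lemma vanishing_on_torus:
  fixes g :: "'k::field_char_0 ^ 'n::finite \<Rightarrow> 'k"
  assumes "polyfun g" "\<And>y \<tau>. \<tau> \<noteq> 0 \<Longrightarrow> g (tor A y \<tau>) = 0" "v \<in> toric_cone A"
  shows "g v = 0"
  using cone_generic_torus_point[OF assms(1) assms(1), of A] assms(2,3) by blast

text \<open>The coefficient form of membership in the toric ideal: modulo the binomials, monomials
  of equal degree coincide.\<close>

lemma vanishing_fibre_sums:
  fixes f :: "('n::finite, 'k::field_char_0) mpolynomial"
  assumes "\<And>v. v \<in> toric_cone A \<Longrightarrow> eval_at f v = 0"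
  shows "(\<Sum>m\<in>{m\<in>keys f. adeg A m = b}. lookup f m) = 0"
  using assms[OF tor_in_cone]
  by (intro characters_independent[where b = "adeg A"]) (simp_all add: eval_at_tor)

section \<open>Algebraic independence\<close>

text \<open>\<open>g\<close> is a nonzerodivisor modulo the functions vanishing on \<open>S\<close>.
  This is the form in which irreducibility is used.\<close>

definition cancels :: "('k::comm_ring_1 ^ 'n::finite) set \<Rightarrow> ('k ^ 'n \<Rightarrow> 'k) \<Rightarrow> bool" where
  "cancels S g \<longleftrightarrow> (\<forall>h. polyfun h \<and> (\<forall>v\<in>S. g v * h v = 0) \<longrightarrow> (\<forall>v\<in>S. h v = 0))"

text \<open>Exponent vectors are extensional on \<open>I\<close>, so that every monomial in the
  \<open>g i\<close> is counted once.\<close>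

definition alg_indep_on :: "'i set \<Rightarrow> ('i \<Rightarrow> 'k::comm_ring_1 ^ 'n::finite \<Rightarrow> 'k) \<Rightarrow> ('k ^ 'n) set \<Rightarrow> bool" where
  "alg_indep_on I g S \<longleftrightarrow>
     (\<forall>E c. finite E \<and> E \<subseteq> I \<rightarrow>\<^sub>E (UNIV :: nat set) \<and>
        (\<forall>v\<in>S. (\<Sum>a\<in>E. c a * (\<Prod>i\<in>I. g i v ^ a i)) = 0) \<longrightarrow> (\<forall>a\<in>E. c a = 0))"

lemma alg_indep_onD:
  assumes "alg_indep_on I g S" "finite E" "E \<subseteq> I \<rightarrow>\<^sub>E UNIV"
    "\<And>v. v \<in> S \<Longrightarrow> (\<Sum>a\<in>E. c a * (\<Prod>i\<in>I. g i v ^ a i)) = 0" "a \<in> E"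
  shows "c a = 0"
  using assms(1)[unfolded alg_indep_on_def, rule_format, of E c a] assms(2-5) by simp

lemma alg_indep_on_mono:
  assumes "alg_indep_on I g S" "S \<subseteq> S'"
  shows "alg_indep_on I g S'"
  unfolding alg_indep_on_def
proof (intro allI impI ballI, elim conjE)
  fix E c a assume E: "finite E" "E \<subseteq> I \<rightarrow>\<^sub>E (UNIV :: nat set)"
    and rel: "\<forall>v\<in>S'. (\<Sum>a\<in>E. c a * (\<Prod>i\<in>I. g i v ^ a i)) = 0" and a: "a \<in> E"
  show "c a = 0"
    by (rule alg_indep_onD[OF assms(1) E _ a]) (rule bspec[OF rel subsetD[OF assms(2)]])
qed

lemma cancelsD:
  assumes "cancels S g" "polyfun h" "\<forall>v\<in>S. g v * h v = 0"
  shows "\<forall>v\<in>S. h v = 0"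
  using assms(1)[unfolded cancels_def, rule_format, of h] assms(2,3) by simp

lemma cancels_toric_cone:
  fixes g :: "'k::field_char_0 ^ 'n::finite \<Rightarrow> 'k"
  assumes "polyfun g" "\<exists>v\<in>toric_cone A. g v \<noteq> 0"
  shows "cancels (toric_cone A) g"
  unfolding cancels_def
proof (intro allI impI ballI, elim conjE, rule ccontr)
  fix h :: "'k ^ 'n \<Rightarrow> 'k" and v :: "'k ^ 'n"
  assume h: "polyfun h" "\<forall>v\<in>toric_cone A. g v * h v = 0" "v \<in> toric_cone A" "h v \<noteq> 0"
  then obtain y \<tau> where "\<tau> \<noteq> 0" "g (tor A y \<tau>) \<noteq> 0" "h (tor A y \<tau>) \<noteq> 0"
    using cone_generic_torus_point[OF assms(1) h(1) assms(2)] by blast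
  then show False using h(2) tor_in_cone[of \<tau> A y] by force
qed

lemma cancels_power:
  assumes "cancels S g" "polyfun g" "polyfun h" "\<forall>v\<in>S. g v ^ e * h v = 0"
  shows "\<forall>v\<in>S. h v = 0"
  using assms(4)
proof (induction e)
  case (Suc e)
  have "polyfun (\<lambda>v. g v ^ e * h v)" by (intro polyfun_mult polyfun_power assms)
  moreover have "\<forall>v\<in>S. g v * (g v ^ e * h v) = 0" using Suc.prems by (simp add: mult.assoc)
  ultimately have "\<forall>v\<in>S. g v ^ e * h v = 0" by (rule cancelsD[OF assms(1)])
  then show ?case by (rule Suc.IH)
qed simp

text \<open>Passing to a hypersurface lowers the transcendence degree. A relation on
  \<open>S\<close> is divided by the highest possible power of \<open>g i\<close>; restricted to
  \<open>S'\<close>, where \<open>g i\<close> vanishes, it becomes a nontrivial relation among the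
  remaining functions.\<close>

lemma alg_indep_on_insert:
  fixes g :: "'i \<Rightarrow> 'k::field ^ 'n::finite \<Rightarrow> 'k"
  assumes I: "finite I" "i \<notin> I" and sub: "S' \<subseteq> S"
    and poly: "\<And>j. j \<in> insert i I \<Longrightarrow> polyfun (g j)"
    and ind: "alg_indep_on I g S'" and van: "\<And>v. v \<in> S' \<Longrightarrow> g i v = 0" and can: "cancels S (g i)"
  shows "alg_indep_on (insert i I) g S"
  unfolding alg_indep_on_def
proof (intro allI impI, elim conjE, rule ccontr)
  fix E and c :: "('i \<Rightarrow> nat) \<Rightarrow> 'k"
  assume E: "finite E" "E \<subseteq> insert i I \<rightarrow>\<^sub>E UNIV"
    and rel: "\<forall>v\<in>S. (\<Sum>a\<in>E. c a * (\<Prod>j\<in>insert i I. g j v ^ a j)) = 0"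
    and nz: "\<not> (\<forall>a\<in>E. c a = 0)"
  define E' where "E' = {a\<in>E. c a \<noteq> 0}"
  have E': "finite E'" "E' \<noteq> {}" using E nz by (auto simp: E'_def)
  define k where "k = Min ((\<lambda>a. a i) ` E')"
  have k: "k \<le> a i" if "a \<in> E'" for a using that E' by (simp add: k_def)
  define R where "R v = (\<Sum>a\<in>E'. c a * g i v ^ (a i - k) * (\<Prod>j\<in>I. g j v ^ a j))" for v
  have "polyfun R" unfolding R_def
    by (intro polyfun_sum polyfun_mult polyfun_const polyfun_power polyfun_prod poly) auto
  moreover have "\<forall>v\<in>S. g i v ^ k * R v = 0"
  proof
    fix v assume "v \<in> S"
    have "g i v ^ k * R v = (\<Sum>a\<in>E'. c a * (\<Prod>j\<in>insert i I. g j v ^ a j))"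
      unfolding R_def sum_distrib_left using I k
      by (intro sum.cong refl) (simp add: mult_ac power_add[symmetric])
    also have "\<dots> = (\<Sum>a\<in>E. c a * (\<Prod>j\<in>insert i I. g j v ^ a j))"
      unfolding E'_def using E by (intro sum.mono_neutral_left) auto
    finally show "g i v ^ k * R v = 0" using rel \<open>v \<in> S\<close> by simp
  qed
  ultimately have "\<forall>v\<in>S. R v = 0" using cancels_power[OF can poly] by blast
  \<comment> \<open>The terms that survive on \<open>S'\<close>: exactly those in which no factor
    \<open>g i\<close> is left after the division.\<close>
  define F where "F = {a\<in>E'. a i = k}"
  have F: "F \<subseteq> insert i I \<rightarrow>\<^sub>E UNIV" "finite F" using E E' by (auto simp: F_def E'_def)
  have inj: "inj_on (\<lambda>a. restrict a I) F"
  proof (rule inj_onI)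
    fix a b assume a: "a \<in> F" "b \<in> F" "restrict a I = restrict b I"
    show "a = b"
    proof
      fix j show "a j = b j"
      proof (cases "j \<in> I")
        case True
        then show ?thesis using fun_cong[OF a(3), of j] by simp
      next
        case False
        have "a \<in> insert i I \<rightarrow>\<^sub>E UNIV" "b \<in> insert i I \<rightarrow>\<^sub>E UNIV" using F a by blast+
        then show ?thesis using False a(1,2) PiE_arb[of a "insert i I" _ j] PiE_arb[of b "insert i I" _ j]
          by (cases "j = i") (simp_all add: F_def)
      qed
    qed
  qed
  define c' where "c' = (\<lambda>a'. c (the_inv_into F (\<lambda>a. restrict a I) a'))"
  have "\<forall>v\<in>S'. (\<Sum>a\<in>(\<lambda>a. restrict a I) ` F. c' a * (\<Prod>j\<in>I. g j v ^ a j)) = 0"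
  proof
    fix v assume v: "v \<in> S'"
    have "(\<Sum>a\<in>(\<lambda>a. restrict a I) ` F. c' a * (\<Prod>j\<in>I. g j v ^ a j)) =
        (\<Sum>a\<in>F. c a * (\<Prod>j\<in>I. g j v ^ a j))"
      by (subst sum.reindex[OF inj])
         (auto intro!: sum.cong prod.cong simp: c'_def the_inv_into_f_f[OF inj])
    also have "\<dots> = (\<Sum>a\<in>F. c a * g i v ^ (a i - k) * (\<Prod>j\<in>I. g j v ^ a j))"
      by (intro sum.cong refl) (simp add: F_def)
    also have "\<dots> = R v" unfolding R_def F_def
    proof (intro sum.mono_neutral_left ballI E')
      fix a assume "a \<in> E' - {a \<in> E'. a i = k}"
      then have "a i - k > 0" using k by fastforce
      then show "c a * g i v ^ (a i - k) * (\<Prod>j\<in>I. g j v ^ a j) = 0"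
        using van[OF v] by simp
    qed auto
    also have "\<dots> = 0" using \<open>\<forall>v\<in>S. R v = 0\<close> v sub by auto
    finally show "(\<Sum>a\<in>(\<lambda>a. restrict a I) ` F. c' a * (\<Prod>j\<in>I. g j v ^ a j)) = 0" .
  qed
  moreover have "(\<lambda>a. restrict a I) ` F \<subseteq> I \<rightarrow>\<^sub>E UNIV" by auto
  ultimately have "\<forall>a\<in>(\<lambda>a. restrict a I) ` F. c' a = 0"
    using alg_indep_onD[OF ind, of "(\<lambda>a. restrict a I) ` F" c'] F(2) by simp
  then have "\<forall>a\<in>F. c a = 0" by (auto simp: c'_def the_inv_into_f_f[OF inj])
  moreover have "k \<in> (\<lambda>a. a i) ` E'" unfolding k_def using E' by (intro Min_in) auto
  ultimately show False by (auto simp: F_def E'_def)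
qed

section \<open>Bounding the number of independent functions\<close>

text \<open>Independence of the rows of the matrix \<open>a\<close> indexed by \<open>X\<close>.
  Indexing makes two equal rows dependent, which a set of vectors would not.\<close>

definition fam_indep :: "('x \<Rightarrow> 'y \<Rightarrow> 'k::field) \<Rightarrow> 'x set \<Rightarrow> bool" where
  "fam_indep a X \<longleftrightarrow> (\<forall>c. (\<forall>y. (\<Sum>x\<in>X. c x * a x y) = 0) \<longrightarrow> (\<forall>x\<in>X. c x = 0))"

lemma basis_subfamily:
  fixes a :: "'x::finite \<Rightarrow> 'y \<Rightarrow> 'k::field"
  shows "\<exists>X. fam_indep a X \<and> (\<forall>x. \<exists>c. \<forall>y. a x y = (\<Sum>x'\<in>X. c x' * a x' y))"
proof -
  have "\<exists>X. fam_indep a X \<and> (\<forall>Y. fam_indep a Y \<longrightarrow> card Y \<le> card X)"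
    by (rule ex_has_greatest_nat[of _ "{}" _ "Suc CARD('x)"])
       (auto simp: fam_indep_def less_Suc_eq_le intro: card_mono)
  then obtain X where X: "fam_indep a X" "\<And>Y. fam_indep a Y \<Longrightarrow> card Y \<le> card X" by blast
  have "\<exists>c. \<forall>y. a x y = (\<Sum>x'\<in>X. c x' * a x' y)" for x
  proof (cases "x \<in> X")
    case True
    then have "\<forall>y. a x y = (\<Sum>x'\<in>X. (if x' = x then 1 else 0) * a x' y)"
      by (simp add: if_distrib[of "\<lambda>z. z * _"] cong: if_cong)
    then show ?thesis by (intro exI[of _ "\<lambda>x'. if x' = x then 1 else 0"])
  next
    case False
    then have "\<not> fam_indep a (insert x X)" using X(2)[of "insert x X"] by auto
    then obtain c x0 where c: "\<And>y. (\<Sum>x'\<in>insert x X. c x' * a x' y) = 0" "x0 \<in> insert x X" "c x0 \<noteq> 0"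
      unfolding fam_indep_def by blast
    have eq: "c x * a x y + (\<Sum>x'\<in>X. c x' * a x' y) = 0" for y using c(1)[of y] False by simp
    have "c x \<noteq> 0"
    proof
      assume "c x = 0"
      then have "\<forall>x'\<in>X. c x' = 0" using X(1) eq unfolding fam_indep_def by simp
      then show False using c \<open>c x = 0\<close> by auto
    qed
    then have "\<forall>y. a x y = (\<Sum>x'\<in>X. (- c x' / c x) * a x' y)"
      using eq by (auto simp: sum_negf sum_divide_distrib[symmetric] field_simps eq_neg_iff_add_eq_0)
    then show ?thesis by (intro exI[of _ "\<lambda>x'. - c x' / c x"])
  qed
  with X(1) show ?thesis by blast
qed

text \<open>Row rank is at most column rank: with more rows than generating columns, a combination
  killing those columns kills all of them.\<close>

lemma fam_indep_card_le:
  fixes a :: "'x \<Rightarrow> 'y \<Rightarrow> 'k::field"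
  assumes X: "fam_indep a X" "finite X" and Y: "finite Y"
    and gen: "\<And>y. \<exists>c. \<forall>x\<in>X. a x y = (\<Sum>y'\<in>Y. c y' * a x y')"
  shows "card X \<le> card Y"
proof (rule ccontr)
  assume "\<not> card X \<le> card Y"
  then obtain c where c: "\<exists>x\<in>X. c x \<noteq> 0" "\<forall>y\<in>Y. (\<Sum>x\<in>X. c x * a x y) = 0"
    using nontrivial_solution[OF Y X(2), of a] by auto
  have "(\<Sum>x\<in>X. c x * a x y) = 0" for y
  proof -
    obtain e where e: "\<And>x. x \<in> X \<Longrightarrow> a x y = (\<Sum>y'\<in>Y. e y' * a x y')" using gen[of y] by blast
    have "(\<Sum>x\<in>X. c x * a x y) = (\<Sum>x\<in>X. \<Sum>y'\<in>Y. c x * (e y' * a x y'))"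
      by (simp add: e sum_distrib_left)
    also have "\<dots> = (\<Sum>y'\<in>Y. e y' * (\<Sum>x\<in>X. c x * a x y'))"
      by (subst sum.swap) (simp add: sum_distrib_left mult_ac)
    finally show ?thesis using c(2) by simp
  qed
  then show False using X(1) c(1) unfolding fam_indep_def by blast
qed

definition key_bounded :: "int ^ 'n ^ 'm \<Rightarrow> int \<Rightarrow> ('n::finite, 'k::comm_ring_1) mpolynomial \<Rightarrow> bool" where
  "key_bounded A B f \<longleftrightarrow> (\<forall>m\<in>keys f. \<forall>k. \<bar>adeg A m $ k\<bar> \<le> B)"

lemma key_bounded_mult: "key_bounded A B f \<Longrightarrow> key_bounded A C g \<Longrightarrow> key_bounded A (B + C) (f * g)"
  unfolding key_bounded_def
proof (intro ballI allI)
  fix m k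
  assume f: "\<forall>m\<in>keys f. \<forall>k. \<bar>adeg A m $ k\<bar> \<le> B"
    and g: "\<forall>m\<in>keys g. \<forall>k. \<bar>adeg A m $ k\<bar> \<le> C"
    and "m \<in> keys (f * g)"
  then obtain m1 m2 where m: "m = m1 + m2" "m1 \<in> keys f" "m2 \<in> keys g"
    using keys_mult[of f g] by blast
  have "\<bar>adeg A m $ k\<bar> \<le> \<bar>adeg A m1 $ k\<bar> + \<bar>adeg A m2 $ k\<bar>" by (simp add: m adeg_add)
  then show "\<bar>adeg A m $ k\<bar> \<le> B + C" using f[rule_format, OF m(2), of k] g[rule_format, OF m(3), of k] by linarith
qed

lemma key_bounded_one: "key_bounded A 0 1"
  by (simp add: key_bounded_def adeg_def)

lemma key_bounded_power: "key_bounded A B f \<Longrightarrow> key_bounded A (int e * B) (f ^ e)"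
proof (induction e)
  case (Suc e)
  then have "key_bounded A (B + int e * B) (f * f ^ e)" by (intro key_bounded_mult) auto
  then show ?case by (simp add: algebra_simps)
qed (simp add: key_bounded_one)

lemma key_bounded_prod:
  "finite I \<Longrightarrow> (\<And>i. i \<in> I \<Longrightarrow> key_bounded A (B i) (f i)) \<Longrightarrow> key_bounded A (\<Sum>i\<in>I. B i) (\<Prod>i\<in>I. f i)"
  by (induction I rule: finite_induct) (auto simp: key_bounded_one intro: key_bounded_mult)

lemma key_bounded_mono: "key_bounded A B f \<Longrightarrow> B \<le> C \<Longrightarrow> key_bounded A C f"
  unfolding key_bounded_def by (meson order_trans)

lemma key_bounded_exists: "\<exists>B\<ge>0. key_bounded A B f"
proof -
  define B where "B = (\<Sum>m\<in>keys f. \<Sum>k\<in>UNIV. \<bar>adeg A m $ k\<bar>)"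
  have "\<bar>adeg A m $ k\<bar> \<le> B" if "m \<in> keys f" for m k
  proof -
    have "\<bar>adeg A m $ k\<bar> \<le> (\<Sum>k\<in>UNIV. \<bar>adeg A m $ k\<bar>)" by (rule member_le_sum) auto
    also have "\<dots> \<le> B" unfolding B_def by (rule member_le_sum[OF that]) (auto simp: sum_nonneg)
    finally show ?thesis .
  qed
  moreover have "B \<ge> 0" by (simp add: B_def sum_nonneg)
  ultimately show ?thesis by (auto simp: key_bounded_def)
qed

text \<open>Spanning of the row space in dual form: the rows in \<open>R\<close> already cut out the
  kernel. No coefficients have to be chosen, and the statement stays integral.\<close>

definition row_generating :: "int ^ 'n ^ 'm \<Rightarrow> 'm::finite set \<Rightarrow> bool" where
  "row_generating A R \<longleftrightarrow> (\<forall>u. (\<forall>k\<in>R. (\<Sum>i\<in>UNIV. A $ k $ i * u $ i) = 0) \<longrightarrow> u \<in> int_kernel A)"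

text \<open>
  Functions on the cone of degree at most \<open>q\<close> are combinations of the characters of \<open>O(q\<^sup>r)\<close>
  degrees, where \<open>r\<close> is the rank; the monomials of degree at most \<open>q\<close> in more than \<open>r\<close>
  independent functions would be too many.
\<close>

lemma not_alg_indep_toric_cone:
  fixes A :: "int ^ 'n::finite ^ 'm::finite" and g :: "'i \<Rightarrow> 'k::field ^ 'n \<Rightarrow> 'k"
  assumes R: "row_generating A R" and I: "finite I" "card R < card I"
    and poly: "\<And>i. i \<in> I \<Longrightarrow> polyfun (g i)"
  shows "\<not> alg_indep_on I g (toric_cone A)"
proof
  assume ind: "alg_indep_on I g (toric_cone A)"
  have "\<forall>i. \<exists>p. i \<in> I \<longrightarrow> g i = eval_at p" using poly unfolding polyfun_def by blast
  then obtain p where p: "\<And>i. i \<in> I \<Longrightarrow> g i = eval_at (p i)" by metis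
  have "\<forall>i. \<exists>B. B \<ge> 0 \<and> key_bounded A B (p i)" using key_bounded_exists[of A] by blast
  then obtain Bf where Bf: "\<And>i. Bf i \<ge> 0 \<and> key_bounded A (Bf i) (p i)" by metis
  define C where "C = nat (\<Sum>i\<in>I. Bf i)"
  have C: "key_bounded A (int C) (p i)" if "i \<in> I" for i
  proof -
    have "Bf i \<le> (\<Sum>i\<in>I. Bf i)" using that Bf I by (intro member_le_sum) auto
    then show ?thesis using Bf[of i] by (auto intro: key_bounded_mono simp: C_def)
  qed
  \<comment> \<open>\<open>D\<close> gives \<open>2 * B + 1 \<le> D * (q + 1)\<close> for the box
    radius \<open>B\<close> below, and \<open>q\<close> is chosen so that the factor
    \<open>D ^ card R\<close> is smaller than \<open>q + 1\<close>.\<close>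
  define D where "D = 2 * card I * C + 1"
  define q where "q = D ^ card R"
  define B where "B = card I * q * C"
  define E where "E = I \<rightarrow>\<^sub>E {..q}"
  define P where "P a = (\<Prod>i\<in>I. p i ^ a i)" for a
  have P: "key_bounded A (int B) (P a)" if "a \<in> E" for a
  proof -
    have "key_bounded A (\<Sum>i\<in>I. int (a i) * int C) (P a)"
      unfolding P_def by (intro key_bounded_prod key_bounded_power C I)
    moreover have "(\<Sum>i\<in>I. int (a i) * int C) \<le> (\<Sum>i\<in>I. int q * int C)"
      using that by (intro sum_mono mult_right_mono) (auto simp: E_def PiE_def Pi_def)
    ultimately show ?thesis by (auto intro: key_bounded_mono simp: B_def mult_ac)
  qed
  have finE: "finite E" and cardE: "card E = (q + 1) ^ card I"
    using I by (auto simp: E_def card_funcsetE finite_PiE)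
  define S where "S = (\<Union>a\<in>E. adeg A ` keys (P a))"
  have finS: "finite S" using finE by (simp add: S_def)
  \<comment> \<open>Degrees agreeing on \<open>R\<close> come from exponents whose difference lies
    in the kernel, so only \<open>card R\<close> coordinates of a degree count.\<close>
  have "inj_on (\<lambda>b. restrict (\<lambda>k. b $ k) R) S"
  proof (rule inj_onI)
    fix b b' assume "b \<in> S" "b' \<in> S" and eq: "restrict (\<lambda>k. b $ k) R = restrict (\<lambda>k. b' $ k) R"
    then obtain m m' where m: "b = adeg A m" "b' = adeg A m'" by (auto simp: S_def)
    define u :: "int ^ 'n" where "u = (\<chi> i. int (lookup m i) - int (lookup m' i))"
    have u: "(\<Sum>i\<in>UNIV. A $ k $ i * u $ i) = b $ k - b' $ k" for k
      by (simp add: m u_def adeg_def right_diff_distrib sum_subtractf)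
    have "b $ k = b' $ k" if "k \<in> R" for k using fun_cong[OF eq, of k] that by simp
    then have "u \<in> int_kernel A" using R unfolding row_generating_def by (simp add: u)
    then show "b = b'" by (simp add: int_kernel_iff u vec_eq_iff)
  qed
  moreover have "(\<lambda>b. restrict (\<lambda>k. b $ k) R) ` S \<subseteq> R \<rightarrow>\<^sub>E {- int B..int B}"
    using P by (auto simp: S_def key_bounded_def abs_le_iff minus_le_iff)
  ultimately have "card S \<le> card (R \<rightarrow>\<^sub>E {- int B..int B})"
    by (intro card_inj_on_le) (auto intro: finite_PiE)
  also have "\<dots> = (2 * B + 1) ^ card R" by (simp add: card_funcsetE nat_add_distrib nat_mult_distrib)
  also have "\<dots> \<le> (D * (q + 1)) ^ card R"
    by (intro power_mono) (auto simp: D_def B_def algebra_simps)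
  also have "\<dots> = q * (q + 1) ^ card R" by (subst power_mult_distrib) (simp only: q_def)
  also have "\<dots> < (q + 1) ^ Suc (card R)" by simp
  also have "\<dots> \<le> (q + 1) ^ card I" using I by (intro power_increasing) auto
  finally have "card S < card E" by (simp add: cardE)
  then obtain c where c: "\<exists>a\<in>E. c a \<noteq> 0"
    "\<forall>b\<in>S. (\<Sum>a\<in>E. c a * (\<Sum>m\<in>{m\<in>keys (P a). adeg A m = b}. lookup (P a) m)) = 0"
    using nontrivial_solution[OF finS finE,
        of "\<lambda>a b. \<Sum>m\<in>{m\<in>keys (P a). adeg A m = b}. lookup (P a) m"] by blast
  have "(\<Sum>a\<in>E. c a * (\<Prod>i\<in>I. g i v ^ a i)) = 0" if v: "v \<in> toric_cone A" for v
  proof -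
    have ev: "(\<Prod>i\<in>I. g i v ^ a i) = (\<Sum>b\<in>S. mon v (SOME m. adeg A m = b) *
        (\<Sum>m\<in>{m\<in>keys (P a). adeg A m = b}. lookup (P a) m))"
      if "a \<in> E" for a
    proof -
      have "(\<Prod>i\<in>I. g i v ^ a i) = eval_at (P a) v"
        unfolding P_def by (simp add: eval_at_prod eval_at_power p)
      also have "\<dots> = (\<Sum>b\<in>S. mon v (SOME m. adeg A m = b) *
        (\<Sum>m\<in>{m\<in>keys (P a). adeg A m = b}. lookup (P a) m))"
        by (rule eval_at_cone[OF v finS]) (use that in \<open>auto simp: S_def\<close>)
      finally show ?thesis .
    qed
    have "(\<Sum>a\<in>E. c a * (\<Prod>i\<in>I. g i v ^ a i)) = (\<Sum>a\<in>E. \<Sum>b\<in>S. mon v (SOME m. adeg A m = b) *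
        (c a * (\<Sum>m\<in>{m\<in>keys (P a). adeg A m = b}. lookup (P a) m)))"
      by (intro sum.cong refl) (simp only: ev sum_distrib_left mult_ac)
    also have "\<dots> = (\<Sum>b\<in>S. mon v (SOME m. adeg A m = b) *
        (\<Sum>a\<in>E. c a * (\<Sum>m\<in>{m\<in>keys (P a). adeg A m = b}. lookup (P a) m)))"
      by (subst sum.swap) (simp only: sum_distrib_left)
    also have "\<dots> = 0" using c(2) by simp
    finally show ?thesis .
  qed
  then have "c a = 0" if "a \<in> E" for a
    using alg_indep_onD[OF ind finE _ _ that, of c] by (force simp: E_def PiE_def Pi_def)
  then show False using c(1) by blast
qed

section \<open>The dimension of a projective toric variety\<close>

lemma proj_spaceD: "p \<in> proj_space \<Longrightarrow> vec.subspace p" "p \<in> proj_space \<Longrightarrow> vec.dim p = 1"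
  by (auto simp: proj_space_def)

lemma proj_space_span: "v \<noteq> 0 \<Longrightarrow> vec.span {v} \<in> proj_space"
  by (simp add: proj_space_def vec.dim_eq_card_independent)

lemma proj_space_line:
  assumes "p \<in> proj_space"
  obtains b where "b \<noteq> 0" "p = vec.span {b}"
proof -
  obtain B where B: "B \<subseteq> p" "vec.independent B" "p \<subseteq> vec.span B" "card B = vec.dim p"
    using vec.basis_exists[of p] by blast
  then obtain b where b: "B = {b}" using proj_spaceD(2)[OF assms] by (auto simp: card_1_singleton_iff)
  have "vec.span B \<subseteq> p" using B proj_spaceD(1)[OF assms] by (intro vec.span_minimal) auto
  then show ?thesis using that[of b] B b by (auto dest: vec.dependent_zero)
qed

lemma proj_space_proportional:
  assumes "p \<in> proj_space" "v \<in> p" "w \<in> p"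
  shows "\<exists>c. w = c *s v \<or> v = c *s w"
proof -
  obtain b where b: "p = vec.span {b}" using proj_space_line[OF assms(1)] by blast
  obtain c d where cd: "v = c *s b" "w = d *s b"
    using assms b by (auto simp: vec.span_singleton)
  show ?thesis
  proof (cases "c = 0")
    case True
    then have "v = 0 *s w" using cd by simp
    then show ?thesis by blast
  next
    case False
    then have "w = (d / c) *s v" using cd by simp
    then show ?thesis by blast
  qed
qed

lemma zariski_closed_subset: "zariski_closed Z \<Longrightarrow> Z \<subseteq> proj_space"
  by (auto simp: zariski_closed_def proj_zeros_def)

lemma zariski_closed_proj_zeros: "homdeg e f \<Longrightarrow> zariski_closed (proj_zeros {f})"
  unfolding zariski_closed_def homogeneous_iff by blast

text \<open>The definition of irreducibility speaks of homogeneous equations, but \<open>h\<close>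
  is arbitrary. Scaling along the lines in \<open>Z\<close> shows that \<open>g\<close> times each
  homogeneous component of \<open>h\<close> vanishes, and irreducibility applies to these
  products.\<close>

lemma cancels_irreducible:
  fixes Z :: "('k::field_char_0 ^ 'n::finite) set set"
  assumes Z: "zariski_irreducible Z" "Z \<subseteq> proj_space"
    and g: "homdeg e g" and nz: "\<exists>v\<in>\<Union>Z. eval_at g v \<noteq> 0"
  shows "cancels (\<Union>Z) (eval_at g)"
  unfolding cancels_def
proof (intro allI impI, elim conjE)
  fix h :: "'k ^ 'n \<Rightarrow> 'k"
  assume "polyfun h" and gh: "\<forall>v\<in>\<Union>Z. eval_at g v * h v = 0"
  then obtain f where h: "h = eval_at f" by (auto simp: polyfun_def)
  define N where "N = Max (insert 0 (tdeg ` keys f))"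
  have N: "tdeg m \<le> N" if "m \<in> keys f" for m
    unfolding N_def using that by (intro Max_ge) auto
  have part: "eval_at g v * eval_at (hom_part j f) v = 0" if v: "v \<in> \<Union>Z" and j: "j \<le> N" for v j
  proof -
    \<comment> \<open>The restriction of the product to the line through \<open>v\<close>, as a
      polynomial in the scaling factor and up to a power of it.\<close>
    define P where "P = (\<Sum>j\<le>N. monom (eval_at g v * eval_at (hom_part j f) v) j)"
    have "poly P l = 0" if l: "l \<noteq> 0" for l
    proof -
      have "l *s v \<in> \<Union>Z" using v Z proj_spaceD(1) by (auto intro: vec.subspace_scale)
      then have "eval_at g (l *s v) * eval_at f (l *s v) = 0" using gh h by blast
      then have "eval_at g v * eval_at f (l *s v) = 0"
        using l by (simp add: eval_at_homdeg_smult[OF g])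
      also have "eval_at f (l *s v) = (\<Sum>j\<le>N. l ^ j * eval_at (hom_part j f) v)"
        by (subst eval_at_hom_parts[OF N]) (simp_all add: eval_at_homdeg_smult[OF homdeg_hom_part])
      finally show ?thesis by (simp add: P_def poly_sum poly_monom sum_distrib_left mult_ac)
    qed
    then have "- {0} \<subseteq> {l. poly P l = 0}" by auto
    moreover have "infinite (- {0::'k})" using infinite_UNIV_char_0[where 'a='k] by (simp add: finite_compl)
    ultimately have "P = 0" using poly_roots_finite[of P] finite_subset by blast
    then have "coeff P j = 0" by simp
    then show ?thesis using j by (simp add: P_def coeff_sum if_distrib cong: if_cong)
  qed
  have van: "eval_at (hom_part j f) v = 0" if v: "v \<in> \<Union>Z" and j: "j \<le> N" for v j
  proof -
    let ?f = "hom_part j f"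
    have f: "homdeg j ?f" by (rule homdeg_hom_part)
    have "Z \<subseteq> proj_zeros {g} \<union> proj_zeros {?f}"
    proof
      fix p assume p: "p \<in> Z"
      show "p \<in> proj_zeros {g} \<union> proj_zeros {?f}"
      proof (rule ccontr)
        assume "p \<notin> proj_zeros {g} \<union> proj_zeros {?f}"
        then obtain v w where vw: "v \<in> p" "eval_at g v \<noteq> 0" "w \<in> p" "eval_at ?f w \<noteq> 0"
          using p Z by (auto simp: proj_zeros_def vanishes_at_def)
        obtain c where "w = c *s v \<or> v = c *s w"
          using proj_space_proportional[OF _ vw(1,3)] p Z by blast
        then show False
        proof
          assume "w = c *s v"
          then have "eval_at ?f v \<noteq> 0" using vw by (auto simp: eval_at_homdeg_smult[OF f])
          then show False using part[OF _ j, of v] vw p by auto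
        next
          assume "v = c *s w"
          then have "eval_at g w \<noteq> 0" using vw by (auto simp: eval_at_homdeg_smult[OF g])
          then show False using part[OF _ j, of w] vw p by auto
        qed
      qed
    qed
    then have "Z \<subseteq> proj_zeros {g} \<or> Z \<subseteq> proj_zeros {?f}"
      using Z(1) zariski_closed_proj_zeros[OF g] zariski_closed_proj_zeros[OF f]
      unfolding zariski_irreducible_def by blast
    moreover have "\<not> Z \<subseteq> proj_zeros {g}" using nz by (auto simp: proj_zeros_def vanishes_at_def)
    ultimately show ?thesis using v by (auto simp: proj_zeros_def vanishes_at_def)
  qed
  show "\<forall>v\<in>\<Union>Z. h v = 0"
    unfolding h by (subst eval_at_hom_parts[OF N]) (simp_all add: van)
qed

lemma alg_indep_on_cong:
  assumes "\<And>i. i \<in> I \<Longrightarrow> g i = h i"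
  shows "alg_indep_on I g S \<longleftrightarrow> alg_indep_on I h S"
proof -
  have "(\<Prod>i\<in>I. g i v ^ a i) = (\<Prod>i\<in>I. h i v ^ a i)" for v and a :: "_ \<Rightarrow> nat"
    using assms by (intro prod.cong) auto
  then show ?thesis by (simp add: alg_indep_on_def)
qed

text \<open>Each strict inclusion supplies a form that vanishes on the smaller set and is a
  nonzerodivisor on the larger one. The chain starts one step lower, at the apex of the cone, hence
  \<open>r + 1\<close> functions.\<close>

lemma chain_alg_indep:
  fixes Z :: "nat \<Rightarrow> ('k::field_char_0 ^ 'n::finite) set set"
  assumes "\<forall>i\<le>r. zariski_closed (Z i) \<and> zariski_irreducible (Z i)" "\<forall>i<r. Z i \<subset> Z (Suc i)"
  shows "\<exists>g. (\<forall>i. polyfun (g i)) \<and> alg_indep_on {..r} g (\<Union>(Z r))"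
  using assms
proof (induction r)
  case 0
  then have Z: "zariski_irreducible (Z 0)" "Z 0 \<subseteq> proj_space" by (auto dest: zariski_closed_subset)
  then obtain p where p: "p \<in> Z 0" by (auto simp: zariski_irreducible_def)
  then obtain v where v: "v \<noteq> 0" "p = vec.span {v}" using Z proj_space_line by blast
  then obtain j where j: "v $ j \<noteq> 0" by (auto simp: vec_eq_iff)
  define x :: "('n, 'k) mpolynomial" where "x = single (single j 1) 1"
  have x: "eval_at x w = w $ j" for w unfolding x_def by (simp add: mon_single_one del: One_nat_def)
  have "homdeg (tdeg (single j (1::nat))) x" unfolding x_def by (rule homdeg_single) simp
  moreover have "v \<in> \<Union>(Z 0)" using p v by (auto intro: vec.span_base)
  ultimately have can: "cancels (\<Union>(Z 0)) (eval_at x)"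
    using j by (intro cancels_irreducible[OF Z]) (auto simp: x)
  \<comment> \<open>The apex \<open>{0}\<close> is the smaller set; a coordinate vanishes there but
    not on all of the lines in \<open>Z 0\<close>.\<close>
  have "alg_indep_on (insert 0 {}) (\<lambda>_::nat. eval_at x) (\<Union>(Z 0))"
  proof (rule alg_indep_on_insert[where S' = "{0}"])
    show "{0} \<subseteq> \<Union>(Z 0)" using p v by (auto intro: vec.span_zero)
    show "alg_indep_on {} (\<lambda>_::nat. eval_at x) {0}"
      unfolding alg_indep_on_def by (auto simp: subset_singleton_iff)
  qed (use can in \<open>auto simp: x polyfun_eval_at\<close>)
  then show ?case by (intro exI[of _ "\<lambda>_. eval_at x"]) (simp add: polyfun_eval_at)
next
  case (Suc r)
  then obtain g where g: "\<And>i. polyfun (g i)" "alg_indep_on {..r} g (\<Union>(Z r))" by force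
  have Z: "zariski_irreducible (Z (Suc r))" "Z (Suc r) \<subseteq> proj_space" "Z r \<subset> Z (Suc r)" "zariski_closed (Z r)"
    using Suc.prems by (auto dest: zariski_closed_subset)
  then obtain q where q: "q \<in> Z (Suc r)" "q \<notin> Z r" by blast
  obtain F where F: "\<forall>f\<in>F. homogeneous f" "Z r = proj_zeros F" using Z(4) by (auto simp: zariski_closed_def)
  then obtain f where f: "f \<in> F" "\<not> vanishes_at f q" using q Z by (auto simp: proj_zeros_def)
  obtain e where e: "homdeg e f" using F f by (auto simp: homogeneous_iff)
  have van: "eval_at f v = 0" if "v \<in> \<Union>(Z r)" for v
    using that F f by (auto simp: proj_zeros_def vanishes_at_def)
  have can: "cancels (\<Union>(Z (Suc r))) (eval_at f)"
    using f q by (intro cancels_irreducible[OF Z(1,2) e]) (auto simp: vanishes_at_def)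
  define g' where "g' = g(Suc r := eval_at f)"
  have ind: "alg_indep_on {..r} g' (\<Union>(Z r))"
    by (rule alg_indep_on_cong[THEN iffD1, OF _ g(2)]) (simp add: g'_def)
  have "alg_indep_on (insert (Suc r) {..r}) g' (\<Union>(Z (Suc r)))"
    by (rule alg_indep_on_insert[OF _ _ _ _ ind])
       (use Z(3) van can g(1) in \<open>auto simp: g'_def polyfun_eval_at\<close>)
  moreover have "polyfun (g' i)" for i using g(1) by (simp add: g'_def polyfun_eval_at)
  ultimately show ?case unfolding atMost_Suc by blast
qed

lemma eval_at_binomial_of:
  "eval_at (binomial_of u) v = mon v (pos_exp u) - mon v (neg_exp u)"
  by (simp add: binomial_of_def eval_at_diff)

interpretation ideal: module "(*) :: 'a::comm_ring_1 \<Rightarrow> 'a \<Rightarrow> 'a"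
  by unfold_locales (simp_all add: algebra_simps)

lemmas [simp del] = ideal.scale_scale

lemma binomial_in_toric_ideal: "u \<in> int_kernel A \<Longrightarrow> binomial_of u \<in> toric_ideal A"
  unfolding toric_ideal_def ideal_gen_def by (intro ideal.span_base) auto

lemma toric_ideal_vanishes:
  assumes "f \<in> toric_ideal A" "v \<in> toric_cone A"
  shows "eval_at f v = 0"
  using assms(1) unfolding toric_ideal_def ideal_gen_def
proof (induction rule: ideal.span_induct_alt)
  case (step c x y)
  then show ?case using assms(2) by (auto simp: eval_at_add eval_at_mult eval_at_binomial_of toric_cone_def)
qed simp

lemma toric_variety_iff: "p \<in> toric_variety A \<longleftrightarrow> p \<in> proj_space \<and> p \<subseteq> toric_cone A"
proof
  assume p: "p \<in> toric_variety A"
  have "mon v (pos_exp u) = mon v (neg_exp u)" if "v \<in> p" "u \<in> int_kernel A" for v u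
  proof -
    have "eval_at (binomial_of u) v = 0"
      using p that binomial_in_toric_ideal[OF that(2)]
      by (auto simp: toric_variety_def proj_zeros_def vanishes_at_def)
    then show ?thesis by (simp add: eval_at_binomial_of)
  qed
  then show "p \<in> proj_space \<and> p \<subseteq> toric_cone A"
    using p by (auto simp: toric_variety_def proj_zeros_def toric_cone_def)
qed (auto simp: toric_variety_def proj_zeros_def vanishes_at_def toric_ideal_vanishes)

text \<open>A chain of length \<open>r\<close> uses \<open>r + 1\<close> of the at most
  \<open>card R\<close> independent functions; \<open>R \<noteq> {}\<close> keeps
  \<open>card R - 1\<close> from truncating.\<close>

lemma proj_dim_toric_variety_le:
  fixes A :: "int ^ 'n::finite ^ 'm::finite"
  assumes "row_generating A R" "R \<noteq> {}"
  shows "proj_dim (toric_variety A :: ('k::field_char_0 ^ 'n) set set) + 1 \<le> enat (card R)"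
proof -
  have "enat r \<le> enat (card R - 1)"
    if Z: "\<forall>i\<le>r. zariski_closed (Z i) \<and> zariski_irreducible (Z i) \<and> Z i \<subseteq> (toric_variety A :: ('k ^ 'n) set set)"
      "\<forall>i<r. Z i \<subset> Z (Suc i)" for r Z
  proof -
    obtain g where g: "\<And>i. polyfun (g i)" "alg_indep_on {..r} g (\<Union>(Z r))"
      using chain_alg_indep[of r Z] Z by blast
    have "Z r \<subseteq> toric_variety A" using Z(1) by simp
    then have "\<Union>(Z r) \<subseteq> toric_cone A" by (auto simp: subset_iff toric_variety_iff)
    then have "alg_indep_on {..r} g (toric_cone A)" by (rule alg_indep_on_mono[OF g(2)])
    then have "\<not> card R < card {..r}" using not_alg_indep_toric_cone[OF assms(1)] g(1) by blast
    then show ?thesis by simp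
  qed
  then have "proj_dim (toric_variety A :: ('k ^ 'n) set set) \<le> enat (card R - 1)"
    unfolding proj_dim_def by (intro Sup_least) blast
  then have "proj_dim (toric_variety A :: ('k ^ 'n) set set) + 1 \<le> enat (card R - 1) + 1"
    by (rule add_right_mono)
  also have "\<dots> = enat (card R)" using assms(2)
    by (simp add: one_enat_def Suc_leI card_gt_0_iff)
  finally show ?thesis .
qed

lemma dim_le_kernel_trivial:
  fixes N :: "'k::field ^ 'a::finite ^ 'b::finite"
  assumes S: "vec.subspace S" and ker: "\<And>x. x \<in> S \<Longrightarrow> N *v x = 0 \<Longrightarrow> x = 0"
    and T: "\<And>x. x \<in> S \<Longrightarrow> N *v x \<in> T"
  shows "vec.dim S \<le> vec.dim T"
proof -
  have "inj_on ((*v) N) (vec.span S)"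
  proof (rule inj_onI)
    fix x y assume xy: "x \<in> vec.span S" "y \<in> vec.span S" "N *v x = N *v y"
    have span: "vec.span S = S" using S by (rule vec.span_eq_iff[THEN iffD2])
    have "x - y \<in> S" using xy(1,2) unfolding span by (rule vec.subspace_diff[OF S])
    moreover have "N *v (x - y) = 0" using xy(3) by (simp add: matrix_vector_mult_diff_distrib)
    ultimately show "x = y" using ker[of "x - y"] by simp
  qed
  then have "vec.dim S = vec.dim ((*v) N ` S)"
    by (rule vec.dim_image_eq[OF matrix_vector_mul_linear_gen, symmetric])
  also have "\<dots> \<le> vec.dim T" using T by (intro vec.dim_subset) auto
  finally show ?thesis .
qed

definition diag_matrix :: "'k::field ^ 'n \<Rightarrow> 'k ^ 'n ^ 'n::finite" where
  "diag_matrix v = (\<chi> i j. if i = j then v $ i else 0)"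

lemma diag_matrix_mult: "diag_matrix v *v x = (\<chi> i. v $ i * x $ i)"
  by (simp add: diag_matrix_def matrix_vector_mult_def vec_eq_iff if_distrib[of "\<lambda>z. z * _"] cong: if_cong)

lemma sum_mult_right_add:
  fixes x y :: "'k::comm_ring_1 ^ 'n::finite"
  shows "(\<Sum>i\<in>UNIV. a i * (x + y) $ i) = (\<Sum>i\<in>UNIV. a i * x $ i) + (\<Sum>i\<in>UNIV. a i * y $ i)"
  by (simp add: distrib_left sum.distrib)

lemma sum_mult_right_smult:
  fixes x :: "'k::comm_ring_1 ^ 'n::finite"
  shows "(\<Sum>i\<in>UNIV. a i * (c *s x) $ i) = c * (\<Sum>i\<in>UNIV. a i * x $ i)"
  unfolding sum_distrib_left by (intro sum.cong refl) (simp add: mult.left_commute)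

lemma sum_mult_left_lincomb:
  fixes x y :: "'k::comm_ring_1 ^ 'n::finite"
  shows "(\<Sum>i\<in>UNIV. (c *s x + y) $ i * a i) = c * (\<Sum>i\<in>UNIV. x $ i * a i) + (\<Sum>i\<in>UNIV. y $ i * a i)"
  unfolding sum_distrib_left sum.distrib[symmetric]
  by (intro sum.cong refl) (simp add: distrib_right mult.assoc)

lemma sum_mult_left_smult:
  fixes x :: "'k::comm_ring_1 ^ 'n::finite"
  shows "(\<Sum>i\<in>UNIV. (c *s x) $ i * a i) = c * (\<Sum>i\<in>UNIV. x $ i * a i)"
  unfolding sum_distrib_left by (intro sum.cong refl) (simp add: mult.assoc)

section \<open>Tangent spaces of a toric variety\<close>

text \<open>For balanced \<open>A\<close>, the embedded tangent space of the toric variety at the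
  all-ones point.\<close>

definition ker_perp :: "int ^ 'n::finite ^ 'm::finite \<Rightarrow> ('k::field ^ 'n) set" where
  "ker_perp A = {w. \<forall>u\<in>int_kernel A. (\<Sum>i\<in>UNIV. of_int (u $ i) * w $ i) = 0}"

lemma subspace_ker_perp: "vec.subspace (ker_perp A)"
  unfolding vec.subspace_def ker_perp_def mem_Collect_eq sum_mult_right_add sum_mult_right_smult
  by simp

text \<open>The standing assumption in dual form; it says that the binomials of kernel vectors are
  homogeneous.\<close>

definition balanced :: "int ^ 'n::finite ^ 'm::finite \<Rightarrow> bool" where
  "balanced A \<longleftrightarrow> (\<forall>u\<in>int_kernel A. (\<Sum>i\<in>UNIV. u $ i) = 0)"

lemma balanced_if_ones_in_row_span:
  assumes "ones_in_row_span A"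
  shows "balanced A"
  unfolding balanced_def
proof
  fix u assume u: "u \<in> int_kernel A"
  have "(\<Sum>i\<in>UNIV. x $ i * rat_of_int (u $ i)) = 0" if "x \<in> vec.span (rows (map_matrix rat_of_int A))" for x
    using that
  proof (induction rule: vec.span_induct_alt)
    case (step c x y)
    then obtain k where x: "x = row k (map_matrix rat_of_int A)" by (auto simp: rows_def)
    have "(\<Sum>i\<in>UNIV. x $ i * rat_of_int (u $ i)) = rat_of_int (\<Sum>i\<in>UNIV. A $ k $ i * u $ i)"
      by (simp add: x row_def map_matrix_def)
    also have "\<dots> = 0" using u by (simp add: int_kernel_iff)
    finally show ?case using step(2) unfolding sum_mult_left_lincomb by simp
  qed simp
  from this[OF assms[unfolded ones_in_row_span_def]]
  have "rat_of_int (\<Sum>i\<in>UNIV. u $ i) = 0" by simp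
  then show "(\<Sum>i\<in>UNIV. u $ i) = 0" by (simp only: of_int_eq_0_iff)
qed

lemma tdeg_pos_neg:
  assumes "balanced A" "u \<in> int_kernel A"
  shows "tdeg (pos_exp u) = tdeg (neg_exp u)"
proof -
  have "int (tdeg (pos_exp u)) - int (tdeg (neg_exp u)) = (\<Sum>i\<in>UNIV. int (nat (u $ i)) - int (nat (- (u $ i))))"
    by (simp add: tdeg_def sum_subtractf)
  also have "\<dots> = (\<Sum>i\<in>UNIV. u $ i)" by (intro sum.cong) auto
  also have "\<dots> = 0" using assms by (simp add: balanced_def)
  finally show ?thesis by simp
qed

lemma toric_cone_scale: "balanced A \<Longrightarrow> v \<in> toric_cone A \<Longrightarrow> c *s v \<in> toric_cone A"
  by (auto simp: toric_cone_def mon_smult tdeg_pos_neg)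

lemma span_in_toric_variety:
  assumes "balanced A" "v \<in> toric_cone A" "v \<noteq> 0"
  shows "vec.span {v} \<in> toric_variety A"
  using proj_space_span[OF assms(3)] toric_cone_scale[OF assms(1,2)]
  by (simp add: toric_variety_iff) (auto simp: vec.span_singleton)

lemma zero_in_toric_cone: "balanced A \<Longrightarrow> (0 :: 'k::field ^ 'n) \<in> toric_cone A"
  using toric_cone_scale[of A "tor A 0 (1::'k)" 0] tor_in_cone[of "1::'k" A 0] by simp

lemma tor_nonzero: "\<tau> \<noteq> 0 \<Longrightarrow> tor A y \<tau> \<noteq> 0"
  using tor_nz[of \<tau> A y] by (auto simp: vec_eq_iff)

lemma vanishes_on_cone:
  fixes f :: "('n::finite, 'k::field_char_0) mpolynomial"
  assumes "balanced A" "\<forall>q\<in>toric_variety A. vanishes_at f q" "v \<in> toric_cone A"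
  shows "eval_at f v = 0"
proof (rule vanishing_on_torus[OF polyfun_eval_at _ assms(3)])
  fix y and \<tau> :: 'k assume "\<tau> \<noteq> 0"
  then have "vec.span {tor A y \<tau>} \<in> toric_variety A"
    by (intro span_in_toric_variety assms tor_in_cone tor_nonzero)
  then show "eval_at f (tor A y \<tau>) = 0"
    using assms(2) vec.span_base[of "tor A y \<tau>" "{tor A y \<tau>}"] by (auto simp: vanishes_at_def)
qed

text \<open>Taking for \<open>F\<close> a derivative of monomials shows that a vector is tangent
  without differentiating generators of the ideal: it suffices that the derivative depends on the
  degree only.\<close>

lemma sum_over_fibres_zero:
  fixes f :: "('n::finite, 'k::comm_ring_1) mpolynomial"
  assumes "\<And>b. (\<Sum>m\<in>{m\<in>keys f. adeg A m = b}. lookup f m) = 0"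
    and F: "\<And>m m'. adeg A m = adeg A m' \<Longrightarrow> F m = F m'"
  shows "(\<Sum>m\<in>keys f. lookup f m * F m) = 0"
proof -
  have "(\<Sum>m\<in>keys f. lookup f m * F m) =
     (\<Sum>b\<in>adeg A ` keys f. \<Sum>m\<in>{m\<in>keys f. adeg A m = b}. lookup f m * F m)"
    by (rule sum.group[symmetric]) auto
  also have "\<dots> = 0"
  proof (rule sum.neutral, rule ballI)
    fix b
    have "(\<Sum>m\<in>{m\<in>keys f. adeg A m = b}. lookup f m * F m) =
      (\<Sum>m\<in>{m\<in>keys f. adeg A m = b}. lookup f m) * F (SOME m. adeg A m = b)"
      unfolding sum_distrib_right
    proof (intro sum.cong refl)
      fix m assume "m \<in> {m\<in>keys f. adeg A m = b}"
      then have "adeg A m = b" by simp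
      then show "lookup f m * F m = lookup f m * F (SOME m. adeg A m = b)"
        using someI[of "\<lambda>m. adeg A m = b" m] F[of m "SOME m. adeg A m = b"] by simp
    qed
    then show "(\<Sum>m\<in>{m\<in>keys f. adeg A m = b}. lookup f m * F m) = 0"
      using assms(1) by simp
  qed
  finally show ?thesis .
qed

text \<open>The partial derivative of a monomial at \<open>v\<close>. Where the exponent subtraction
  truncates, the factor in front is zero.\<close>

definition dmon :: "'k::comm_ring_1 ^ 'n::finite \<Rightarrow> 'n \<Rightarrow> ('n \<Rightarrow>\<^sub>0 nat) \<Rightarrow> 'k" where
  "dmon v i m = of_nat (lookup m i) * mon v (m - single i 1)"

lemma eval_at_partial_deriv:
  "eval_at (partial_deriv i f) v = (\<Sum>m\<in>keys f. lookup f m * dmon v i m)"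
  by (simp add: partial_deriv_def eval_at_sum dmon_def mult_ac)

lemma minus_single_add:
  assumes "lookup m i > (0::nat)"
  shows "(m - single i 1) + single i 1 = m"
  using assms by (intro poly_mapping_eqI) (auto simp: lookup_add lookup_minus lookup_single when_def)

lemma coord_mult_dmon: "v $ i * dmon v i m = of_nat (lookup m i) * mon v m"
proof (cases "lookup m i > 0")
  case True
  have "mon v m = mon v (m - single i 1) * v $ i"
    by (subst minus_single_add[OF True, symmetric]) (simp only: mon_add mon_single_one)
  then show ?thesis by (simp add: dmon_def mult_ac)
qed (simp add: dmon_def)

lemma dmon_smult: "dmon (c *s v) i m = c ^ (tdeg m - 1) * dmon v i m"
proof (cases "lookup m i > 0")
  case True
  have "tdeg m = tdeg (m - single i 1) + tdeg (single i 1)"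
    by (subst minus_single_add[OF True, symmetric]) (rule tdeg_add)
  moreover have "tdeg (single i 1) = (\<Sum>j\<in>{i}. 1)"
    unfolding tdeg_def by (intro sum.mono_neutral_cong_right) (auto simp: lookup_single when_def)
  ultimately show ?thesis by (simp add: dmon_def mon_smult)
qed (simp add: dmon_def)

definition grad :: "('n::finite, 'k::comm_ring_1) mpolynomial \<Rightarrow> 'k ^ 'n \<Rightarrow> 'k ^ 'n" where
  "grad f v = (\<chi> i. eval_at (partial_deriv i f) v)"

lemma grad_smult: "homdeg e f \<Longrightarrow> grad f (c *s v) = c ^ (e - 1) *s grad f v"
  by (simp add: grad_def vec_eq_iff eval_at_partial_deriv dmon_smult homdeg_def sum_distrib_left
      mult_ac cong: sum.cong)

text \<open>The derivations \<open>v $ i\<close> times the \<open>i\<close>-th partial are diagonal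
  on monomials: in the direction with entries \<open>v $ i * w $ i\<close>, a monomial is multiplied
  by its weight under \<open>w\<close>.\<close>

lemma grad_dot_torus:
  fixes v :: "'k::field ^ 'n::finite"
  shows "(\<Sum>i\<in>UNIV. eval_at (partial_deriv i f) v * (v $ i * w $ i)) =
    (\<Sum>m\<in>keys f. lookup f m *
      (mon v m * (\<Sum>i\<in>UNIV. of_nat (lookup m i) * w $ i)))"
proof -
  have "(\<Sum>i\<in>UNIV. eval_at (partial_deriv i f) v * (v $ i * w $ i)) =
     (\<Sum>i\<in>UNIV. \<Sum>m\<in>keys f. lookup f m * (v $ i * dmon v i m) * w $ i)"
    by (simp add: eval_at_partial_deriv sum_distrib_right sum_distrib_left mult_ac)
  also have "\<dots> = (\<Sum>m\<in>keys f. \<Sum>i\<in>UNIV. lookup f m * (v $ i * dmon v i m) * w $ i)"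
    by (rule sum.swap)
  finally show ?thesis by (simp add: coord_mult_dmon sum_distrib_left mult_ac)
qed

lemma pos_exp_eq_neg_exp: "pos_exp u = neg_exp u \<longleftrightarrow> u = 0"
proof
  assume eq: "pos_exp u = neg_exp u"
  have "nat (u $ i) = nat (- (u $ i))" for i using arg_cong[OF eq, of "\<lambda>m. lookup m i"] by simp
  then have "u $ i = 0" for i by (metis nat_le_0 nat_eq_iff2 neg_0_le_iff_le neg_le_0_iff_le nle_le minus_zero minus_equation_iff)
  then show "u = 0" by (simp add: vec_eq_iff)
qed (auto intro!: poly_mapping_eqI)

lemma homdeg_binomial: "balanced A \<Longrightarrow> u \<in> int_kernel A \<Longrightarrow> homdeg (tdeg (pos_exp u)) (binomial_of u)"
  unfolding binomial_of_def by (intro homdeg_diff homdeg_single) (simp_all add: tdeg_pos_neg)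

lemma binomial_vanishes: "u \<in> int_kernel A \<Longrightarrow> q \<in> toric_variety A \<Longrightarrow> vanishes_at (binomial_of u) q"
  by (auto simp: toric_variety_def proj_zeros_def binomial_in_toric_ideal)

lemma of_nat_nat_diff: "of_nat (nat a) - of_nat (nat (- a)) = (of_int a :: 'k::ring_1)"
  by (cases "a \<ge> 0") simp_all

text \<open>One inclusion tests a tangent vector against the binomials. For the other, the weight of
  a monomial under \<open>w \<in> ker_perp A\<close> depends on its degree only.\<close>

lemma tangent_space_torus:
  fixes v :: "'k::field_char_0 ^ 'n::finite"
  assumes bal: "balanced A" and v: "v \<in> toric_cone A" "\<And>i. v $ i \<noteq> 0"
  shows "tangent_space (toric_variety A) (vec.span {v}) = (*v) (diag_matrix v) ` ker_perp A"
proof (intro equalityI subsetI)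
  fix x assume x: "x \<in> tangent_space (toric_variety A) (vec.span {v})"
  define w where "w = (\<chi> i. x $ i / v $ i)"
  have xw: "x = diag_matrix v *v w" using v(2) by (simp add: diag_matrix_mult w_def vec_eq_iff)
  have "v \<noteq> 0" using v(2) by (auto simp: vec_eq_iff)
  have "(\<Sum>i\<in>UNIV. of_int (u $ i) * w $ i) = 0" if u: "u \<in> int_kernel A" for u
  proof (cases "u = 0")
    case False
    then have ne: "pos_exp u \<noteq> neg_exp u" by (simp add: pos_exp_eq_neg_exp)
    let ?f = "binomial_of u :: ('n, 'k) mpolynomial"
    have "homogeneous ?f" using homdeg_binomial[OF bal u] by (auto simp: homogeneous_iff)
    then have "(\<Sum>i\<in>UNIV. eval_at (partial_deriv i ?f) v * x $ i) = 0"
      using x u binomial_vanishes \<open>v \<noteq> 0\<close> unfolding tangent_space_def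
      by (auto intro: vec.span_base)
    then have "0 = (\<Sum>m\<in>keys ?f. lookup ?f m *
        (mon v m * (\<Sum>i\<in>UNIV. of_nat (lookup m i) * w $ i)))"
      unfolding xw by (simp add: diag_matrix_mult grad_dot_torus)
    also have "\<dots> = (\<Sum>m\<in>{pos_exp u, neg_exp u}. lookup ?f m *
        (mon v m * (\<Sum>i\<in>UNIV. of_nat (lookup m i) * w $ i)))"
    proof (intro sum.mono_neutral_left)
      show "keys ?f \<subseteq> {pos_exp u, neg_exp u}"
        unfolding binomial_of_def using keys_diff by fastforce
    qed (auto simp: in_keys_iff)
    also have "\<dots> = mon v (pos_exp u) * (\<Sum>i\<in>UNIV. (of_nat (nat (u $ i)) - of_nat (nat (- (u $ i)))) * w $ i)"
      using ne v(1) u by (simp add: binomial_of_def lookup_minus lookup_single toric_cone_def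
          algebra_simps sum_subtractf)
    also have "(\<Sum>i\<in>UNIV. (of_nat (nat (u $ i)) - of_nat (nat (- (u $ i)))) * w $ i) =
        (\<Sum>i\<in>UNIV. of_int (u $ i) * w $ i)"
      by (simp only: of_nat_nat_diff)
    finally show ?thesis using v(2) by (simp add: mon_def)
  qed simp
  then have "w \<in> ker_perp A" by (simp add: ker_perp_def)
  then show "x \<in> (*v) (diag_matrix v) ` ker_perp A" using xw by blast
next
  fix x assume "x \<in> (*v) (diag_matrix v) ` ker_perp A"
  then obtain w where w: "w \<in> ker_perp A" "x = diag_matrix v *v w" by blast
  have const: "(\<Sum>i\<in>UNIV. of_nat (lookup m i) * w $ i) =
      (\<Sum>i\<in>UNIV. of_nat (lookup m' i) * w $ i)" if eq: "adeg A m = adeg A m'" for m m'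
  proof -
    define u :: "int ^ 'n" where "u = (\<chi> i. int (lookup m i) - int (lookup m' i))"
    have "u \<in> int_kernel A"
      using eq by (simp add: u_def adeg_eq_iff)
    then have "(\<Sum>i\<in>UNIV. of_int (u $ i) * w $ i) = 0" using w(1) by (simp add: ker_perp_def)
    then show ?thesis by (simp add: u_def left_diff_distrib sum_subtractf)
  qed
  show "x \<in> tangent_space (toric_variety A) (vec.span {v})"
    unfolding tangent_space_def
  proof (intro CollectI allI impI ballI, elim conjE)
    fix f :: "('n, 'k) mpolynomial" and v' :: "'k ^ 'n"
    assume f: "homogeneous f" "\<forall>q\<in>toric_variety A. vanishes_at f q" and v': "v' \<in> vec.span {v} - {0}"
    obtain e where e: "homdeg e f" using f by (auto simp: homogeneous_iff)
    obtain c where c: "v' = c *s v" using v' by (auto simp: vec.span_singleton)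
    have "(\<Sum>i\<in>UNIV. eval_at (partial_deriv i f) v * x $ i) = (\<Sum>m\<in>keys f. lookup f m *
        (mon v m * (\<Sum>i\<in>UNIV. of_nat (lookup m i) * w $ i)))"
      unfolding w(2) by (simp add: diag_matrix_mult grad_dot_torus)
    also have "\<dots> = 0"
    proof (rule sum_over_fibres_zero[where A = A])
      fix m m' :: "'n \<Rightarrow>\<^sub>0 nat" assume eq: "adeg A m = adeg A m'"
      show "mon v m * (\<Sum>i\<in>UNIV. of_nat (lookup m i) * w $ i) =
          mon v m' * (\<Sum>i\<in>UNIV. of_nat (lookup m' i) * w $ i)"
        by (simp only: const[OF eq] mon_cong_adeg[OF v(1) eq])
    qed (intro vanishing_fibre_sums vanishes_on_cone[OF bal f(2)])
    finally have z: "(\<Sum>i\<in>UNIV. grad f v $ i * x $ i) = 0" by (simp add: grad_def)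
    have "(\<Sum>i\<in>UNIV. grad f v' $ i * x $ i) = c ^ (e - 1) * (\<Sum>i\<in>UNIV. grad f v $ i * x $ i)"
      unfolding c grad_smult[OF e] by (rule sum_mult_left_smult)
    then show "(\<Sum>i\<in>UNIV. eval_at (partial_deriv i f) v' * x $ i) = 0"
      using z by (simp add: grad_def)
  qed
qed

lemma dim_tangent_space_torus:
  fixes v :: "'k::field_char_0 ^ 'n::finite"
  assumes "balanced A" "v \<in> toric_cone A" "\<And>i. v $ i \<noteq> 0"
  shows "vec.dim (tangent_space (toric_variety A) (vec.span {v})) = vec.dim (ker_perp A :: ('k ^ 'n) set)"
proof -
  have "inj_on ((*v) (diag_matrix v)) (vec.span (ker_perp A))"
    using assms(3) by (auto intro!: inj_onI simp: diag_matrix_mult vec_eq_iff)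
  then show ?thesis
    unfolding tangent_space_torus[OF assms] by (rule vec.dim_image_eq[OF matrix_vector_mul_linear_gen])
qed

lemma polyfun_det:
  assumes "\<And>i j. polyfun (\<lambda>v. N v $ i $ j)"
  shows "polyfun (\<lambda>v. det (N v))"
  unfolding det_def by (intro polyfun_sum polyfun_mult polyfun_const polyfun_prod assms)

text \<open>
  Lower semicontinuity of the rank of the gradients: an invertible matrix made of gradients at a
  given point and of constant rows stays invertible at some torus point.
\<close>

lemma dim_tangent_space_ge:
  fixes A :: "int ^ 'n::finite ^ 'm::finite" and p :: "('k::field_char_0 ^ 'n) set"
  assumes bal: "balanced A" and p: "p \<in> toric_variety A"
  shows "vec.dim (ker_perp A :: ('k ^ 'n) set) \<le> vec.dim (tangent_space (toric_variety A) p)"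
proof -
  let ?X = "toric_variety A :: ('k ^ 'n) set set"
  obtain v where v: "v \<noteq> 0" "p = vec.span {v}" using p proj_space_line by (auto simp: toric_variety_iff)
  have vc: "v \<in> toric_cone A" using p v by (auto simp: toric_variety_iff intro: vec.span_base)
  define I where "I = {f. homogeneous f \<and> (\<forall>q\<in>?X. vanishes_at f q)}"
  define G where "G = (\<lambda>f. grad f v) ` I"
  \<comment> \<open>A basis of the space of gradients at \<open>v\<close>; it is completed to a
    basis of the whole space, which is then indexed by coordinates to form a square matrix.\<close>
  obtain B where B: "B \<subseteq> G" "vec.independent B" "G \<subseteq> vec.span B"
    using vec.maximal_independent_subset by blast
  obtain B' where B': "B \<subseteq> B'" "vec.independent B'" "UNIV \<subseteq> vec.span B'"
    by (rule vec.maximal_independent_subset_extend[OF subset_UNIV B(2)])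
  have "card B' = CARD('n)" using vec.basis_card_eq_dim[OF subset_UNIV B'(3,2)] by (simp only: vec_dim_card)
  moreover have "finite B'" using B'(2) by (rule vec.finiteI_independent)
  ultimately obtain \<beta> :: "'n \<Rightarrow> 'k ^ 'n" where \<beta>: "bij_betw \<beta> UNIV B'"
    using finite_same_card_bij[of "UNIV :: 'n set" B'] by auto
  have "\<forall>i. \<exists>f. \<beta> i \<in> B \<longrightarrow> f \<in> I \<and> grad f v = \<beta> i" using B(1) by (fastforce simp: G_def)
  then obtain f where f: "\<And>i. \<beta> i \<in> B \<Longrightarrow> f i \<in> I \<and> grad (f i) v = \<beta> i" by metis
  define N where "N w = (\<chi> i. if \<beta> i \<in> B then grad (f i) w else \<beta> i)" for w
  \<comment> \<open>The constant rows. Their number is the corank of the gradients at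
    \<open>v\<close>, and it is compared with the tangent dimension at \<open>p\<close> and at a
    torus point: the inverse of \<open>N v\<close> embeds \<open>S\<close> into the tangent space at
    \<open>p\<close>.\<close>
  define C where "C = {i. \<beta> i \<notin> B}"
  have Nv: "N v = (\<chi> i. \<beta> i)" using f by (simp add: N_def vec_eq_iff)
  have "rows (N v) = B'" using \<beta> by (auto simp: Nv rows_def row_def bij_betw_def)
  then have inv: "invertible (N v)"
    using B'(3) matrix_left_invertible_span_rows_gen[of "N v"] invertible_left_inverse[of "N v"] by auto
  define S where "S = {x::'k ^ 'n. \<forall>i. i \<notin> C \<longrightarrow> x $ i = 0}"
  have dimS: "vec.dim S = card C" unfolding S_def by (rule dim_substandard_cart)
  have subS: "vec.subspace S" by (simp add: S_def vec.subspace_def)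
  have "card C \<le> vec.dim (tangent_space ?X p)"
  proof -
    obtain N' where N': "N v ** N' = mat 1" "N' ** N v = mat 1" using inv by (auto simp: invertible_def)
    have "vec.dim S \<le> vec.dim (tangent_space ?X p)"
    proof (rule dim_le_kernel_trivial[OF subS, of N'])
      fix x assume "x \<in> S" "N' *v x = 0"
      then have "N v *v (N' *v x) = 0" by simp
      then show "x = 0" by (simp add: matrix_vector_mul_assoc N')
    next
      fix x assume x: "x \<in> S"
      define w where "w = N' *v x"
      have "N v *v w = x" by (simp add: w_def matrix_vector_mul_assoc N')
      then have "(\<Sum>j\<in>UNIV. \<beta> i $ j * w $ j) = x $ i" for i by (auto simp: Nv matrix_vector_mult_def)
      then have Bw: "(\<Sum>j\<in>UNIV. b $ j * w $ j) = 0" if "b \<in> B" for b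
        using that x \<beta> B'(1) by (auto simp: S_def C_def bij_betw_def)
      have B0: "(\<Sum>j\<in>UNIV. b $ j * w $ j) = 0" if "b \<in> vec.span B" for b
        using that
      proof (induction rule: vec.span_induct_alt)
        case (step c x y)
        then show ?case unfolding sum_mult_left_lincomb by (simp add: Bw)
      qed simp
      have "(\<Sum>i\<in>UNIV. eval_at (partial_deriv i g) v' * w $ i) = 0"
        if g: "homogeneous g" "\<forall>q\<in>?X. vanishes_at g q" and v': "v' \<in> p" for g v'
      proof -
        obtain e where e: "homdeg e g" using g by (auto simp: homogeneous_iff)
        obtain c where c: "v' = c *s v" using v' v by (auto simp: vec.span_singleton)
        have "grad g v \<in> vec.span B" using g B(3) by (auto simp: G_def I_def)
        then have "(\<Sum>i\<in>UNIV. grad g v $ i * w $ i) = 0" by (rule B0)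
        moreover have "(\<Sum>i\<in>UNIV. grad g v' $ i * w $ i) = c ^ (e - 1) * (\<Sum>i\<in>UNIV. grad g v $ i * w $ i)"
          unfolding c grad_smult[OF e] by (rule sum_mult_left_smult)
        ultimately show ?thesis by (simp add: grad_def)
      qed
      then show "N' *v x \<in> tangent_space ?X p" by (auto simp: tangent_space_def w_def)
    qed
    then show ?thesis by (simp add: dimS)
  qed
  \<comment> \<open>Conversely, at a torus point \<open>t\<close> with \<open>N t\<close>
    invertible, the gradient rows kill tangent vectors, so \<open>N t\<close> embeds the tangent
    space into \<open>S\<close>.\<close>
  moreover have "vec.dim (ker_perp A :: ('k ^ 'n) set) \<le> card C"
  proof -
    have poly: "polyfun (\<lambda>w. det (N w))"
    proof (rule polyfun_det)
      fix i j show "polyfun (\<lambda>w. N w $ i $ j)"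
        by (cases "\<beta> i \<in> B") (simp_all add: N_def grad_def polyfun_eval_at polyfun_const)
    qed
    have "\<exists>w\<in>toric_cone A. det (N w) \<noteq> 0" using inv vc by (auto simp: invertible_det_nz)
    then obtain y \<tau> where t: "\<tau> \<noteq> 0" "det (N (tor A y \<tau>)) \<noteq> 0"
      using cone_generic_torus_point[OF poly poly] by blast
    define t where "t = tor A y \<tau>"
    have tc: "t \<in> toric_cone A" "\<And>i. t $ i \<noteq> 0" unfolding t_def by (rule tor_in_cone[OF t(1)], rule tor_nz[OF t(1)])
    let ?T = "tangent_space ?X (vec.span {t})"
    have subT: "vec.subspace ?T"
      unfolding tangent_space_torus[OF bal tc]
      using vec.subspace_image[OF subspace_ker_perp] by blast
    have "vec.dim ?T \<le> vec.dim S"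
    proof (rule dim_le_kernel_trivial[OF subT, of "N t"])
      fix x assume "N t *v x = 0"
      moreover obtain N' where "N' ** N t = mat 1"
        using t invertible_det_nz[of "N t"] by (auto simp: t_def invertible_def)
      ultimately show "x = 0" by (metis matrix_vector_mul_assoc matrix_vector_mul_lid matrix_vector_mult_0_right)
    next
      fix x assume x: "x \<in> ?T"
      have "(\<Sum>j\<in>UNIV. grad (f i) t $ j * x $ j) = 0" if "i \<notin> C" for i
        using that f[of i] x tor_nonzero[OF t(1), of A y]
        by (auto simp: C_def I_def tangent_space_def grad_def t_def intro: vec.span_base)
      then show "N t *v x \<in> S" by (auto simp: S_def N_def C_def matrix_vector_mult_def)
    qed
    then show ?thesis by (simp add: dimS dim_tangent_space_torus[OF bal tc])
  qed
  ultimately show ?thesis by (rule order_trans[rotated])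
qed

section \<open>The dual variety\<close>

lemma row_basis:
  fixes A :: "int ^ 'n::finite ^ 'm::finite"
  obtains R :: "'m set" where "fam_indep (\<lambda>k i. of_int (A $ k $ i) :: 'k::field_char_0) R" "row_generating A R"
proof -
  let ?a = "\<lambda>k i. of_int (A $ k $ i) :: 'k"
  obtain R where R: "fam_indep ?a R" "\<And>k. \<exists>c. \<forall>i. ?a k i = (\<Sum>k'\<in>R. c k' * ?a k' i)"
    using basis_subfamily[of ?a] by blast
  have "row_generating A R"
    unfolding row_generating_def int_kernel_iff
  proof (intro allI impI)
    fix u :: "int ^ 'n" and k
    assume u: "\<forall>k\<in>R. (\<Sum>i\<in>UNIV. A $ k $ i * u $ i) = 0"
    obtain c where c: "\<And>i. ?a k i = (\<Sum>k'\<in>R. c k' * ?a k' i)" using R(2)[of k] by blast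
    have "of_int (\<Sum>i\<in>UNIV. A $ k $ i * u $ i) = (\<Sum>i\<in>UNIV. \<Sum>k'\<in>R. c k' * (?a k' i * of_int (u $ i)))"
      by (simp add: c sum_distrib_right mult.assoc)
    also have "\<dots> = (\<Sum>k'\<in>R. c k' * of_int (\<Sum>i\<in>UNIV. A $ k' $ i * u $ i))"
      by (subst sum.swap) (simp add: sum_distrib_left)
    also have "\<dots> = 0" using u by simp
    finally show "(\<Sum>i\<in>UNIV. A $ k $ i * u $ i) = 0" by (simp only: of_int_eq_0_iff)
  qed
  then show ?thesis using R(1) that by blast
qed

lemma card_rows_le_dim_ker_perp:
  fixes A :: "int ^ 'n::finite ^ 'm::finite"
  assumes "fam_indep (\<lambda>k i. of_int (A $ k $ i) :: 'k::field_char_0) R"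
  shows "card R \<le> vec.dim (ker_perp A :: ('k ^ 'n) set)"
proof -
  define N :: "'k ^ 'm ^ 'n" where "N = (\<chi> i k. of_int (A $ k $ i))"
  define S where "S = {x::'k ^ 'm. \<forall>k. k \<notin> R \<longrightarrow> x $ k = 0}"
  have Nx: "(N *v x) $ i = (\<Sum>k\<in>R. x $ k * of_int (A $ k $ i))" if "x \<in> S" for x i
    using that by (auto simp: N_def matrix_vector_mult_def S_def mult.commute intro!: sum.mono_neutral_right)
  have "vec.dim S \<le> vec.dim (ker_perp A :: ('k ^ 'n) set)"
  proof (rule dim_le_kernel_trivial[of _ N])
    show "vec.subspace S" by (simp add: S_def vec.subspace_def)
  next
    fix x assume x: "x \<in> S" "N *v x = 0"
    then have "(\<Sum>k\<in>R. x $ k * of_int (A $ k $ i)) = 0" for i using Nx[OF x(1), of i] by simp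
    then have "x $ k = 0" for k using assms x(1) by (cases "k \<in> R") (auto simp: fam_indep_def S_def)
    then show "x = 0" by (simp add: vec_eq_iff)
  next
    fix x assume x: "x \<in> S"
    have "(\<Sum>i\<in>UNIV. of_int (u $ i) * (N *v x) $ i) = 0" if u: "u \<in> int_kernel A" for u
    proof -
      have "(\<Sum>i\<in>UNIV. of_int (u $ i) * (N *v x) $ i) =
          (\<Sum>i\<in>UNIV. \<Sum>k\<in>R. x $ k * of_int (A $ k $ i * u $ i))"
        by (simp add: Nx[OF x] sum_distrib_left mult_ac)
      also have "\<dots> = (\<Sum>k\<in>R. x $ k * of_int (\<Sum>i\<in>UNIV. A $ k $ i * u $ i))"
        by (subst sum.swap) (simp add: sum_distrib_left)
      finally show ?thesis using u unfolding int_kernel_iff by (simp del: of_int_sum of_int_mult)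
    qed
    then show "N *v x \<in> ker_perp A" by (simp add: ker_perp_def)
  qed
  then show ?thesis by (simp add: S_def dim_substandard_cart)
qed

lemma row_basis_nonempty:
  assumes "balanced A" "row_generating A R"
  shows "R \<noteq> {}"
proof
  assume "R = {}"
  then have "axis undefined 1 \<in> int_kernel A" using assms(2) by (simp add: row_generating_def)
  then show False using assms(1) by (auto simp: balanced_def axis_def)
qed

text \<open>A sandwich: the tangent dimension at \<open>p\<close> is \<open>proj_dim + 1\<close>,
  hence at most the rank, which is at most the dimension of \<open>ker_perp A\<close>, which is at
  most the tangent dimension at \<open>p\<close>. So the torus value is the regular one.\<close>

lemma regular_point_torus:
  fixes A :: "int ^ 'n::finite ^ 'm::finite" and p :: "('k::field_char_0 ^ 'n) set"
  assumes bal: "balanced A" and p: "regular_point (toric_variety A) p"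
    and t: "t \<in> toric_cone A" "\<And>i. (t :: 'k ^ 'n) $ i \<noteq> 0"
  shows "regular_point (toric_variety A) (vec.span {t})"
proof -
  let ?X = "toric_variety A :: ('k ^ 'n) set set"
  obtain R :: "'m set" where R: "fam_indep (\<lambda>k i. of_int (A $ k $ i) :: 'k) R" "row_generating A R"
    by (rule row_basis)
  have pX: "p \<in> ?X" "enat (vec.dim (tangent_space ?X p)) = proj_dim ?X + 1"
    using p by (auto simp: regular_point_def)
  have "enat (vec.dim (tangent_space ?X p)) \<le> enat (card R)"
    unfolding pX(2) by (rule proj_dim_toric_variety_le[OF R(2) row_basis_nonempty[OF bal R(2)]])
  then have "vec.dim (tangent_space ?X p) = vec.dim (ker_perp A :: ('k ^ 'n) set)"
    using dim_tangent_space_ge[OF bal pX(1)] card_rows_le_dim_ker_perp[OF R(1)] by simp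
  moreover have "t \<noteq> 0" using t(2) by (auto simp: vec_eq_iff)
  ultimately show ?thesis
    using pX(2) span_in_toric_variety[OF bal t(1)] dim_tangent_space_torus[OF bal t]
    by (simp add: regular_point_def)
qed

lemma subspace_hyperplane: "vec.subspace (hyperplane h)"
  unfolding hyperplane_def vec.subspace_def mem_Collect_eq sum_mult_right_add sum_mult_right_smult
  by simp

lemma hyperplane_span: "hyperplane (vec.span {b}) = {x. (\<Sum>i\<in>UNIV. b $ i * x $ i) = 0}"
proof -
  have "(\<Sum>i\<in>UNIV. (c *s b) $ i * x $ i) = c * (\<Sum>i\<in>UNIV. b $ i * x $ i)" for c x
    by (rule sum_mult_left_smult)
  then show ?thesis
    unfolding hyperplane_def vec.span_singleton
    by (auto dest: bspec[of _ _ "1 *s b"] simp del: vector_smult_component)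
qed

text \<open>A hyperplane is a maximal proper subspace: with one tangent vector outside, it spans
  everything.\<close>

lemma not_transversal_iff:
  assumes "h \<in> proj_space"
  shows "\<not> transversal_at (hyperplane h) X p \<longleftrightarrow> tangent_space X p \<subseteq> hyperplane h"
proof -
  obtain b where b: "b \<noteq> 0" "h = vec.span {b}" using proj_space_line[OF assms] by blast
  have H: "hyperplane h = {x. (\<Sum>i\<in>UNIV. b $ i * x $ i) = 0}" by (simp add: b hyperplane_span)
  have proper: "hyperplane h \<noteq> UNIV"
  proof
    assume U: "hyperplane h = UNIV"
    obtain j where j: "b $ j \<noteq> 0" using b by (auto simp: vec_eq_iff)
    have "axis j 1 \<in> hyperplane h" by (simp add: U)
    then have "(\<Sum>i\<in>UNIV. b $ i * axis j 1 $ i) = 0" by (simp only: H mem_Collect_eq)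
    then show False using j by (simp add: axis_def if_distrib[of "\<lambda>z. _ * z"] cong: if_cong)
  qed
  show ?thesis
  proof
    assume sub: "tangent_space X p \<subseteq> hyperplane h"
    then have "vec.span (tangent_space X p \<union> hyperplane h) = hyperplane h"
      using vec.span_eq_iff[of "hyperplane h"] subspace_hyperplane by (simp add: Un_absorb1)
    then show "\<not> transversal_at (hyperplane h) X p" using proper by (simp add: transversal_at_def)
  next
    assume nt: "\<not> transversal_at (hyperplane h) X p"
    show "tangent_space X p \<subseteq> hyperplane h"
    proof (rule ccontr)
      assume "\<not> ?thesis"
      then obtain x where x: "x \<in> tangent_space X p" "(\<Sum>i\<in>UNIV. b $ i * x $ i) \<noteq> 0" by (auto simp: H)
      let ?S = "vec.span (tangent_space X p \<union> hyperplane h)"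
      have "y \<in> ?S" for y
      proof -
        define c where "c = (\<Sum>i\<in>UNIV. b $ i * y $ i) / (\<Sum>i\<in>UNIV. b $ i * x $ i)"
        have "(\<Sum>i\<in>UNIV. b $ i * (y - c *s x) $ i) =
            (\<Sum>i\<in>UNIV. b $ i * y $ i) - c * (\<Sum>i\<in>UNIV. b $ i * x $ i)"
          unfolding sum_mult_right_smult[symmetric] sum_subtractf[symmetric]
          by (intro sum.cong refl) (simp add: right_diff_distrib)
        also have "\<dots> = 0" using x(2) by (simp add: c_def)
        finally have "y - c *s x \<in> hyperplane h" by (simp only: H mem_Collect_eq)
        then have "(y - c *s x) + c *s x \<in> ?S"
          using x(1) by (intro vec.span_add vec.span_scale) (auto intro: vec.span_base)
        then show ?thesis by simp
      qed
      then show False using nt by (auto simp: transversal_at_def)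
    qed
  qed
qed

lemma dual_variety_superset:
  assumes "h \<in> proj_space" "regular_point X p" "p \<subseteq> hyperplane h" "tangent_space X p \<subseteq> hyperplane h"
  shows "h \<in> dual_variety X"
proof -
  have "h \<in> {h \<in> proj_space. \<exists>p. regular_point X p \<and> p \<subseteq> hyperplane h \<and> \<not> transversal_at (hyperplane h) X p}"
    using assms by (auto simp: not_transversal_iff)
  then show ?thesis unfolding dual_variety_def zariski_closure_def by (rule subsetD[OF hull_subset])
qed

lemma dual_variety_subset:
  assumes "zariski_closed Z"
    and "\<And>h p. h \<in> proj_space \<Longrightarrow> regular_point X p \<Longrightarrow> tangent_space X p \<subseteq> hyperplane h \<Longrightarrow> h \<in> Z"
  shows "dual_variety X \<subseteq> Z"
  unfolding dual_variety_def zariski_closure_def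
  by (rule hull_minimal) (use assms in \<open>auto simp: not_transversal_iff\<close>)

text \<open>This makes self-duality produce a regular point, since the toric variety is not
  empty.\<close>

lemma dual_variety_empty:
  fixes X :: "('k::field ^ 'n::finite) set set"
  assumes "\<And>p. \<not> regular_point X p"
  shows "dual_variety X = {}"
proof -
  have "homdeg 0 (1 :: ('n, 'k) mpolynomial)" by (simp add: homdeg_def)
  moreover have "proj_zeros {1 :: ('n, 'k) mpolynomial} = {}"
    by (auto simp: proj_zeros_def vanishes_at_def elim!: proj_space_line intro: vec.span_zero)
  ultimately have "zariski_closed ({} :: ('k ^ 'n) set set)" by (metis zariski_closed_proj_zeros)
  then show ?thesis using dual_variety_subset[of "{}" X] assms by blast
qed

section \<open>Classes of equal columns\<close>

definition cls :: "int ^ 'n::finite ^ 'm::finite \<Rightarrow> 'n \<Rightarrow> 'n set" where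
  "cls A j = {i. column i A = column j A}"

definition csum :: "int ^ 'n::finite ^ 'm::finite \<Rightarrow> 'a::comm_monoid_add ^ 'n \<Rightarrow> 'n \<Rightarrow> 'a" where
  "csum A x j = (\<Sum>i\<in>cls A j. x $ i)"

text \<open>The free classes are the columns of the reduced configuration over which it is a pyramid.\<close>

definition free_class :: "int ^ 'n::finite ^ 'm::finite \<Rightarrow> 'n \<Rightarrow> bool" where
  "free_class A j \<longleftrightarrow> (\<forall>u\<in>int_kernel A. csum A u j = 0)"

lemma cls_self [simp]: "j \<in> cls A j"
  by (simp add: cls_def)

lemma cls_cong: "i \<in> cls A j \<Longrightarrow> cls A i = cls A j"
  by (simp add: cls_def)

lemma csum_cls: "i \<in> cls A j \<Longrightarrow> csum A x i = csum A x j"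
  by (simp add: csum_def cls_cong)

lemma free_class_cls: "i \<in> cls A j \<Longrightarrow> free_class A i \<longleftrightarrow> free_class A j"
  by (simp add: free_class_def csum_cls)

lemma csum_add: "csum A (x + y) j = csum A x j + csum A y j"
  by (simp add: csum_def sum.distrib)

lemma csum_diff: "csum A (x - y :: 'a::ab_group_add ^ 'n::finite) j = csum A x j - csum A y j"
  by (simp add: csum_def sum_subtractf)

lemma csum_smult: "csum A (c *s x) j = c * csum A (x :: 'a::comm_ring_1 ^ 'n::finite) j"
  by (simp add: csum_def sum_distrib_left)

lemma csum_of_int: "csum A (\<chi> i. of_int (x $ i)) j = of_int (csum A x j)"
  by (simp add: csum_def)

lemma int_kernel_lincomb: "x \<in> int_kernel A \<Longrightarrow> y \<in> int_kernel A \<Longrightarrow> c *s x + y \<in> int_kernel A"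
  by (simp add: int_kernel_iff distrib_left sum.distrib mult.left_commute[of _ c] sum_distrib_left[symmetric])

lemma int_kernel_zero: "0 \<in> int_kernel A"
  by (simp add: int_kernel_def)

lemma int_kernel_uminus: "x \<in> int_kernel A \<Longrightarrow> - x \<in> int_kernel A"
  by (simp add: int_kernel_iff sum_negf)

lemma int_kernel_diff: "x \<in> int_kernel A \<Longrightarrow> y \<in> int_kernel A \<Longrightarrow> x - y \<in> int_kernel A"
  by (simp add: int_kernel_def matrix_vector_mult_diff_distrib)

lemma sum_class_constant:
  fixes c :: "'n::finite \<Rightarrow> 'a::comm_ring_1"
  assumes c: "\<And>i j. i \<in> cls A j \<Longrightarrow> c i = c j" and x: "\<And>j. csum A x j = 0"
  shows "(\<Sum>i\<in>UNIV. x $ i * c i) = 0"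
proof -
  have "(\<Sum>i\<in>UNIV. x $ i * c i) = (\<Sum>b\<in>range (\<lambda>i. column i A). \<Sum>i\<in>{i\<in>UNIV. column i A = b}. x $ i * c i)"
    by (rule sum.group[symmetric]) auto
  also have "\<dots> = 0"
  proof (rule sum.neutral, rule ballI)
    fix b assume "b \<in> range (\<lambda>i. column i A)"
    then obtain j where b: "b = column j A" by auto
    have "(\<Sum>i\<in>{i\<in>UNIV. column i A = b}. x $ i * c i) = (\<Sum>i\<in>cls A j. x $ i * c j)"
      unfolding b cls_def by (intro sum.cong) (auto intro!: arg_cong[of _ _ "(*) _"] c simp: cls_def)
    also have "\<dots> = csum A x j * c j" by (simp add: csum_def sum_distrib_right)
    finally show "(\<Sum>i\<in>{i\<in>UNIV. column i A = b}. x $ i * c i) = 0" by (simp add: x)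
  qed
  finally show ?thesis .
qed

lemma int_kernel_if_csum_zero:
  assumes "\<And>j. csum A x j = 0"
  shows "x \<in> int_kernel A"
  unfolding int_kernel_iff
proof
  fix k
  have "(\<Sum>i\<in>UNIV. x $ i * A $ k $ i) = 0"
    by (rule sum_class_constant[OF _ assms]) (simp add: cls_def column_def vec_eq_iff)
  then show "(\<Sum>i\<in>UNIV. A $ k $ i * x $ i) = 0" by (simp add: mult.commute)
qed

lemma tor_cls: "i \<in> cls A j \<Longrightarrow> tor A y \<tau> $ i = tor A y \<tau> $ j"
  by (simp add: tor_def cls_def)

lemma ker_perp_cls:
  fixes A :: "int ^ 'n::finite ^ 'm::finite"
  assumes "w \<in> ker_perp A" "i \<in> cls A j"
  shows "w $ i = w $ j"
proof (cases "i = j")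
  case False
  define u :: "int ^ 'n" where "u = axis i 1 - axis j 1"
  have "csum A u k = 0" for k
    using assms(2) by (auto simp: csum_def u_def axis_def sum_subtractf cls_def)
  then have "u \<in> int_kernel A" by (rule int_kernel_if_csum_zero)
  then have "(\<Sum>x\<in>UNIV. of_int (u $ x) * w $ x) = 0" using assms(1) by (simp add: ker_perp_def)
  then show ?thesis
    by (simp add: u_def axis_def left_diff_distrib sum_subtractf if_distrib[of of_int]
        if_distrib[of "\<lambda>z. z * _"] cong: if_cong)
qed simp

lemma adeg_single_one: "adeg A (single i 1) = column i A"
  by (simp add: adeg_def vec_eq_iff column_def lookup_single when_def if_distrib[of int]
      if_distrib[of "\<lambda>z. _ * z"] cong: if_cong)

text \<open>The toric variety is a cone with this indicator vector as vertex, so the vertex is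
  tangent everywhere, also off the torus. Algebraically, the derivative of a monomial along the
  class is its class degree times the monomial with one class variable removed, and both depend on
  the degree only.\<close>

lemma free_class_tangent:
  fixes A :: "int ^ 'n::finite ^ 'm::finite" and p :: "('k::field_char_0 ^ 'n) set"
  assumes bal: "balanced A" and j: "free_class A j" and p: "p \<in> toric_variety A"
  shows "(\<chi> i. if i \<in> cls A j then 1 else 0) \<in> tangent_space (toric_variety A) p"
  unfolding tangent_space_def
proof (intro CollectI allI impI ballI, elim conjE)
  fix f :: "('n, 'k) mpolynomial" and v :: "'k ^ 'n"
  assume f: "homogeneous f" "\<forall>q\<in>toric_variety A. vanishes_at f q" and v: "v \<in> p - {0}"
  have vc: "v \<in> toric_cone A" using v p by (auto simp: toric_variety_iff)
  define F where "F m = (\<Sum>i\<in>cls A j. dmon v i m)" for m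
  have cong: "F m = F m'" if eq: "adeg A m = adeg A m'" for m m'
  proof -
    define u :: "int ^ 'n" where "u = (\<chi> i. int (lookup m i) - int (lookup m' i))"
    have "u \<in> int_kernel A"
      using eq by (simp add: u_def adeg_eq_iff)
    then have "csum A u j = 0" using j by (simp add: free_class_def)
    then have "int (\<Sum>i\<in>cls A j. lookup m i) = int (\<Sum>i\<in>cls A j. lookup m' i)"
      by (simp add: csum_def u_def sum_subtractf)
    then have s: "(\<Sum>i\<in>cls A j. lookup m i) = (\<Sum>i\<in>cls A j. lookup m' i)"
      by (simp only: of_nat_eq_iff)
    have mon_eq: "mon v (n - single i 1) = mon v (n' - single i' 1)"
      if "i \<in> cls A j" "i' \<in> cls A j" "lookup n i > 0" "lookup n' i' > 0"
        "adeg A n = adeg A n'" for i i' n n'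
    proof (rule mon_cong_adeg[OF vc])
      have "adeg A (n - single i 1) + column i A = adeg A n"
        unfolding adeg_single_one[symmetric] adeg_add[symmetric] by (simp only: minus_single_add[OF that(3)])
      moreover have "adeg A (n' - single i' 1) + column i' A = adeg A n'"
        unfolding adeg_single_one[symmetric] adeg_add[symmetric] by (simp only: minus_single_add[OF that(4)])
      ultimately show "adeg A (n - single i 1) = adeg A (n' - single i' 1)"
        using that by (simp add: cls_def) (metis add_right_cancel)
    qed
    show ?thesis
    proof (cases "\<exists>i0\<in>cls A j. lookup m i0 > 0")
      case True
      then obtain i0 where i0: "i0 \<in> cls A j" "lookup m i0 > 0" by blast
      define c where "c = mon v (m - single i0 1)"
      have F: "F n = of_nat (\<Sum>i\<in>cls A j. lookup n i) * c" if n: "adeg A n = adeg A m" for n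
        unfolding F_def of_nat_sum sum_distrib_right
      proof (intro sum.cong refl)
        fix i assume i: "i \<in> cls A j"
        show "dmon v i n = of_nat (lookup n i) * c"
        proof (cases "lookup n i > 0")
          case True
          show ?thesis unfolding dmon_def c_def by (subst mon_eq[OF i i0(1) True i0(2) n]) (rule refl)
        qed (simp add: dmon_def)
      qed
      show ?thesis using F[OF refl] F[OF eq[symmetric]] s by simp
    next
      case False
      then have "(\<Sum>i\<in>cls A j. lookup m i) = 0" by simp
      then have "\<forall>i\<in>cls A j. lookup m' i = 0" using s by (simp add: sum_eq_0_iff)
      then show ?thesis using False by (simp add: F_def dmon_def)
    qed
  qed
  have "(\<Sum>i\<in>UNIV. eval_at (partial_deriv i f) v * (\<chi> i. if i \<in> cls A j then 1 else 0) $ i) =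
      (\<Sum>i\<in>cls A j. eval_at (partial_deriv i f) v)"
    by (auto simp: if_distrib[of "\<lambda>z. _ * z"] sum.If_cases cong: if_cong)
  also have "\<dots> = (\<Sum>m\<in>keys f. lookup f m * F m)"
    unfolding eval_at_partial_deriv F_def by (subst sum.swap) (simp add: sum_distrib_left)
  also have "\<dots> = 0"
    by (rule sum_over_fibres_zero[where A = A])
       (intro vanishing_fibre_sums vanishes_on_cone[OF bal f(2)], assumption, rule cong)
  finally show "(\<Sum>i\<in>UNIV. eval_at (partial_deriv i f) v * (\<chi> i. if i \<in> cls A j then 1 else 0) $ i) = 0" .
qed

lemma polyfun_csum: "polyfun (\<lambda>x. csum A x j)"
  unfolding csum_def by (intro polyfun_sum polyfun_coord)

text \<open>Tangent hyperplanes contain the vertex of the cone. This is a linear condition on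
  \<open>h\<close>, so it survives the closure.\<close>

lemma dual_variety_free_class:
  fixes A :: "int ^ 'n::finite ^ 'm::finite" and h :: "'k::field_char_0 ^ 'n"
  assumes bal: "balanced A" and j: "free_class A j" and q: "q \<in> dual_variety (toric_variety A)" "h \<in> q"
  shows "csum A h j = 0"
proof -
  define f :: "('n, 'k) mpolynomial"
    where "f = (\<Sum>i\<in>cls A j. single (single i 1) 1)"
  have ev: "eval_at f x = csum A x j" for x
    by (simp add: f_def eval_at_sum csum_def mon_single_one del: One_nat_def)
  have "homdeg 1 f" unfolding f_def
  proof (intro homdeg_sum homdeg_single)
    fix i :: 'n
    have "tdeg (single i 1) = (\<Sum>j\<in>{i}. 1)"
      unfolding tdeg_def by (intro sum.mono_neutral_cong_right) (auto simp: lookup_single when_def)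
    then show "tdeg (single i 1) = 1" by simp
  qed
  then have "zariski_closed (proj_zeros {f})" by (rule zariski_closed_proj_zeros)
  then have "dual_variety (toric_variety A) \<subseteq> proj_zeros {f}"
  proof (rule dual_variety_subset)
    fix h p :: "('k ^ 'n) set"
    assume h: "h \<in> proj_space" "regular_point (toric_variety A) p"
      "tangent_space (toric_variety A) p \<subseteq> hyperplane h"
    then have "p \<in> toric_variety A" by (simp add: regular_point_def)
    then have "(\<chi> i. if i \<in> cls A j then 1 else 0) \<in> hyperplane h"
      using free_class_tangent[OF bal j] h(3) by blast
    then have "\<forall>c\<in>h. csum A c j = 0"
      by (auto simp: hyperplane_def csum_def if_distrib[of "\<lambda>z. _ * z"] sum.If_cases cong: if_cong)
    then show "h \<in> proj_zeros {f}" using h(1) by (simp add: proj_zeros_def vanishes_at_def ev)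
  qed
  then show ?thesis using q by (auto simp: proj_zeros_def vanishes_at_def ev)
qed

text \<open>All that is used of self-duality, stated for affine cones. The last property says that
  every conormal vector at a torus point is the image of a cone point; it rests on the regularity of
  torus points.\<close>

lemma self_dual_matrix:
  fixes A :: "int ^ 'n::finite ^ 'm::finite"
  assumes bal: "balanced A" and sd: "self_dual (toric_variety A :: ('k::field_char_0 ^ 'n) set set)"
  obtains M :: "'k::field_char_0 ^ 'n ^ 'n" where "invertible M"
    "\<And>v j. v \<in> toric_cone A \<Longrightarrow> free_class A j \<Longrightarrow> csum A (M *v v) j = 0"
    "\<And>y \<tau> h. \<tau> \<noteq> 0 \<Longrightarrow> (\<And>w. w \<in> ker_perp A \<Longrightarrow> (\<Sum>i\<in>UNIV. h $ i * (tor A y \<tau> $ i * w $ i)) = 0)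
       \<Longrightarrow> \<exists>v\<in>toric_cone A. h = M *v v"
proof -
  let ?X = "toric_variety A :: ('k ^ 'n) set set"
  obtain M :: "'k ^ 'n ^ 'n" where M: "invertible M" "(\<lambda>p. (\<lambda>v. M *v v) ` p) ` ?X = dual_variety ?X"
    using sd unfolding self_dual_def by blast
  have "csum A (M *v v) j = 0" if v: "v \<in> toric_cone A" and j: "free_class A j" for v j
  proof (cases "v = 0")
    case False
    then have "vec.span {v} \<in> ?X" by (rule span_in_toric_variety[OF bal v])
    then have "(\<lambda>v. M *v v) ` vec.span {v} \<in> dual_variety ?X" unfolding M(2)[symmetric] by (rule imageI)
    moreover have "M *v v \<in> (\<lambda>v. M *v v) ` vec.span {v}" by (intro imageI vec.span_base) simp
    ultimately show ?thesis by (rule dual_variety_free_class[OF bal j])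
  qed (simp add: csum_def)
  moreover have "\<exists>v\<in>toric_cone A. h = M *v v"
    if t: "\<tau> \<noteq> 0" and h: "\<And>w. w \<in> ker_perp A \<Longrightarrow> (\<Sum>i\<in>UNIV. h $ i * (tor A y \<tau> $ i * w $ i)) = 0" for y \<tau> h
  proof (cases "h = 0")
    case True
    then show ?thesis using zero_in_toric_cone[OF bal] by (intro bexI[of _ 0]) simp
  next
    case False
    have "vec.span {tor A 0 (1::'k)} \<in> ?X"
      by (intro span_in_toric_variety bal tor_in_cone tor_nonzero) simp_all
    then have "dual_variety ?X \<noteq> {}" unfolding M(2)[symmetric] by blast
    then obtain p where p: "regular_point ?X p" using dual_variety_empty by blast
    define t where "t = tor A y \<tau>"
    have tc: "t \<in> toric_cone A" "\<And>i. t $ i \<noteq> 0"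
      unfolding t_def by (rule tor_in_cone[OF t], rule tor_nz[OF t])
    have T: "tangent_space ?X (vec.span {t}) \<subseteq> hyperplane (vec.span {h})"
      unfolding tangent_space_torus[OF bal tc] hyperplane_span using h by (auto simp: diag_matrix_mult t_def)
    \<comment> \<open>By balance the all-ones vector lies in \<open>ker_perp A\<close>, so
      \<open>t\<close> belongs to its own tangent space and the hyperplane passes through
      it.\<close>
    have "(\<Sum>i\<in>UNIV. of_int (u $ i)) = (0::'k)" if "u \<in> int_kernel A" for u
      using bal that unfolding balanced_def by (simp only: of_int_sum[symmetric] of_int_0)
    then have "(\<chi> i. 1) \<in> (ker_perp A :: ('k ^ 'n) set)" by (simp add: ker_perp_def)
    from h[OF this] have "t \<in> hyperplane (vec.span {h})" by (simp add: hyperplane_span t_def)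
    then have "vec.span {t} \<subseteq> hyperplane (vec.span {h})"
      by (intro vec.span_minimal subspace_hyperplane) simp
    then have "vec.span {h} \<in> dual_variety ?X"
      by (intro dual_variety_superset[OF proj_space_span[OF False] regular_point_torus[OF bal p tc]] T)
    then obtain p' where p': "p' \<in> ?X" "vec.span {h} = (\<lambda>v. M *v v) ` p'" unfolding M(2)[symmetric] by blast
    have "h \<in> vec.span {h}" by (rule vec.span_base) simp
    then obtain v where "v \<in> p'" "h = M *v v" unfolding p'(2) by blast
    then show ?thesis using p'(1) by (auto simp: toric_variety_iff)
  qed
  ultimately show ?thesis using that[OF M(1)] by blast
qed

section \<open>A dense family in the dual variety\<close>

definition dual_family :: "int ^ 'n::finite ^ 'm::finite \<Rightarrow> int ^ 'n \<Rightarrow> ('k::field ^ 'n) set" where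
  "dual_family A l = {h. \<exists>y \<tau> \<nu>. \<tau> \<noteq> 0 \<and> (\<forall>j. csum A \<nu> j = 0) \<and>
     h = (\<chi> i. tor A y \<tau> $ i * of_int (l $ i)) + \<nu>}"

lemma tor_uminus: "\<tau> \<noteq> 0 \<Longrightarrow> tor A (- y) \<tau> $ i * tor A y \<tau> $ i = 1"
  by (simp add: tor_def idot_def sum_negf power_int_minus)

text \<open>A translate of \<open>l\<close> by \<open>t\<close> is conormal at the inverse of
  \<open>t\<close>. The summand \<open>\<nu>\<close> is conormal at every torus point, as
  \<open>tor\<close> and \<open>ker_perp\<close> are constant on classes.\<close>

lemma dual_family_annihilates:
  fixes A :: "int ^ 'n::finite ^ 'm::finite"
  assumes l: "l \<in> int_kernel A" and h: "h \<in> (dual_family A l :: ('k::field ^ 'n) set)"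
  shows "\<exists>y \<tau>. \<tau> \<noteq> 0 \<and> (\<forall>w\<in>ker_perp A. (\<Sum>i\<in>UNIV. h $ i * (tor A y \<tau> $ i * w $ i)) = 0)"
proof -
  obtain y \<tau> \<nu> where h: "\<tau> \<noteq> 0" "\<And>j. csum A \<nu> j = 0" "h = (\<chi> i. tor A y \<tau> $ i * of_int (l $ i)) + \<nu>"
    using h unfolding dual_family_def by blast
  have "(\<Sum>i\<in>UNIV. h $ i * (tor A (- y) \<tau> $ i * w $ i)) = 0" if w: "w \<in> ker_perp A" for w
  proof -
    have "h $ i * (tor A (- y) \<tau> $ i * w $ i) =
        of_int (l $ i) * w $ i + \<nu> $ i * (tor A (- y) \<tau> $ i * w $ i)" for i
    proof -
      have "h $ i * (tor A (- y) \<tau> $ i * w $ i) =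
          (tor A (- y) \<tau> $ i * tor A y \<tau> $ i) * (of_int (l $ i) * w $ i) + \<nu> $ i * (tor A (- y) \<tau> $ i * w $ i)"
        by (simp add: h(3) algebra_simps)
      then show ?thesis by (simp add: tor_uminus[OF h(1)])
    qed
    then have "(\<Sum>i\<in>UNIV. h $ i * (tor A (- y) \<tau> $ i * w $ i)) =
        (\<Sum>i\<in>UNIV. of_int (l $ i) * w $ i) + (\<Sum>i\<in>UNIV. \<nu> $ i * (tor A (- y) \<tau> $ i * w $ i))"
      by (simp add: sum.distrib)
    moreover have "(\<Sum>i\<in>UNIV. \<nu> $ i * (tor A (- y) \<tau> $ i * w $ i)) = 0"
      by (rule sum_class_constant[OF _ h(2)]) (simp add: tor_cls ker_perp_cls[OF w])
    ultimately show ?thesis using w l by (simp add: ker_perp_def)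
  qed
  then show ?thesis using h(1) by blast
qed

lemma column_basis:
  fixes A :: "int ^ 'n::finite ^ 'm::finite"
  assumes R: "fam_indep (\<lambda>k i. of_int (A $ k $ i) :: 'k::field) R"
  obtains J where "fam_indep (\<lambda>i k. of_int (A $ k $ i) :: 'k) J" "card R \<le> card J"
proof -
  obtain J where J: "fam_indep (\<lambda>i k. of_int (A $ k $ i) :: 'k) J"
    "\<And>i. \<exists>c. \<forall>k. (of_int (A $ k $ i) :: 'k) = (\<Sum>i'\<in>J. c i' * of_int (A $ k $ i'))"
    using basis_subfamily[of "\<lambda>i k. of_int (A $ k $ i) :: 'k"] by blast
  have "card R \<le> card J"
  proof (rule fam_indep_card_le[OF R])
    fix i
    obtain c where "\<forall>k. (of_int (A $ k $ i) :: 'k) = (\<Sum>i'\<in>J. c i' * of_int (A $ k $ i'))"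
      using J(2)[of i] by blast
    then show "\<exists>c. \<forall>k\<in>R. (of_int (A $ k $ i) :: 'k) = (\<Sum>i'\<in>J. c i' * of_int (A $ k $ i'))"
      by (intro exI[of _ c]) simp
  qed simp_all
  then show ?thesis using J(1) that by blast
qed

lemma fam_indep_columns_inj:
  fixes A :: "int ^ 'n::finite ^ 'm::finite"
  assumes J: "fam_indep (\<lambda>i k. of_int (A $ k $ i) :: 'k::field) J" and "i \<in> J" "j \<in> J" "i \<in> cls A j"
  shows "i = j"
proof (rule ccontr)
  assume ne: "i \<noteq> j"
  define c :: "'n \<Rightarrow> 'k" where "c x = (if x = i then 1 else if x = j then - 1 else 0)" for x
  have col: "A $ k $ i = A $ k $ j" for k using assms(4) by (simp add: cls_def column_def vec_eq_iff)
  have "(\<Sum>x\<in>J. c x * of_int (A $ k $ x)) = 0" for k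
  proof -
    have "(\<Sum>x\<in>J. c x * of_int (A $ k $ x)) = (\<Sum>x\<in>{i, j}. c x * of_int (A $ k $ x))"
      by (rule sum.mono_neutral_right) (use assms in \<open>auto simp: c_def\<close>)
    then show ?thesis using ne by (simp add: c_def col)
  qed
  then have "c i = 0" using J assms(2) unfolding fam_indep_def by blast
  then show False by (simp add: c_def)
qed

text \<open>The choice depends on the class only, so the indices differing from their representative
  count the repetitions of columns.\<close>

definition class_rep :: "int ^ 'n::finite ^ 'm::finite \<Rightarrow> 'n \<Rightarrow> 'n" where
  "class_rep A i = (SOME j. j \<in> cls A i)"

lemma class_rep_cls: "class_rep A i \<in> cls A i"
  unfolding class_rep_def by (rule someI[of _ i]) simp

lemma class_rep_cong: "i \<in> cls A j \<Longrightarrow> class_rep A i = class_rep A j"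
  by (simp add: class_rep_def cls_cong)

text \<open>
  The linear forms that vanish on the dual variety because of the free classes pull back to linear
  forms vanishing on \<open>X\<^sub>A\<close>, and these are spanned by the differences of variables of a class.
\<close>

lemma card_free_le:
  fixes A :: "int ^ 'n::finite ^ 'm::finite" and M :: "'k::field_char_0 ^ 'n ^ 'n"
  assumes M: "invertible M"
    and van: "\<And>v j. v \<in> toric_cone A \<Longrightarrow> free_class A j \<Longrightarrow> csum A (M *v v) j = 0"
    and J: "fam_indep (\<lambda>i k. of_int (A $ k $ i) :: 'k) J"
  shows "card {j\<in>J. free_class A j} \<le> card {i. class_rep A i \<noteq> i}"
proof -
  let ?J = "{j\<in>J. free_class A j}" and ?N = "{i. class_rep A i \<noteq> i}"
  \<comment> \<open>The coefficients of the class sum at \<open>j\<close> pulled back along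
    \<open>M\<close>.\<close>
  define W where "W j i = (\<Sum>i'\<in>cls A j. M $ i' $ i)" for j i
  have Wc: "(\<Sum>i'\<in>cls A i. W j i') = 0" if j: "free_class A j" for j i
  proof -
    have "(\<Sum>i'\<in>{i'\<in>UNIV. column i' A = column i A}. W j i') = 0"
    proof (rule characters_independent)
      fix y and \<tau> :: 'k assume t: "\<tau> \<noteq> 0"
      have "csum A (M *v tor A y \<tau>) j = (\<Sum>i'\<in>cls A j. \<Sum>i\<in>UNIV. M $ i' $ i * tor A y \<tau> $ i)"
        by (simp add: csum_def matrix_vector_mult_def)
      also have "\<dots> = (\<Sum>i\<in>UNIV. W j i * \<tau> powi idot y (column i A))"
        by (subst sum.swap) (simp add: W_def sum_distrib_right tor_def)
      finally show "(\<Sum>i\<in>UNIV. W j i * \<tau> powi idot y (column i A)) = 0"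
        using van[OF tor_in_cone[OF t] j] by simp
    qed simp
    then show ?thesis by (simp add: cls_def)
  qed
  show ?thesis
  proof (rule fam_indep_card_le[of W])
    show "fam_indep W ?J"
      unfolding fam_indep_def
    proof (intro allI impI ballI)
      fix c j assume c: "\<forall>i. (\<Sum>j\<in>?J. c j * W j i) = 0" and j: "j \<in> ?J"
      \<comment> \<open>A combination of indicator vectors of distinct classes; it is killed by the
        invertible \<open>transpose M\<close>, so its coefficients vanish.\<close>
      define z where "z = (\<chi> i'. \<Sum>j\<in>?J. c j * (if i' \<in> cls A j then 1 else 0))"
      have "(transpose M *v z) $ i = 0" for i
      proof -
        have "(transpose M *v z) $ i = (\<Sum>i'\<in>UNIV. \<Sum>j\<in>?J. c j * (if i' \<in> cls A j then M $ i' $ i else 0))"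
          by (simp add: matrix_vector_mult_def transpose_def z_def sum_distrib_left if_distrib[of "\<lambda>x. _ * x"]
              mult.commute cong: if_cong)
        also have "\<dots> = (\<Sum>j\<in>?J. c j * W j i)"
          by (subst sum.swap) (simp add: W_def sum_distrib_left[symmetric] sum.If_cases)
        finally show ?thesis using c by simp
      qed
      then have "transpose M *v z = 0" by (simp add: vec_eq_iff)
      moreover obtain M' where "M' ** transpose M = mat 1"
        using M left_invertible_transpose[of M] by (auto simp: invertible_def)
      ultimately have "z = 0"
        by (metis matrix_vector_mul_assoc matrix_vector_mul_lid matrix_vector_mult_0_right)
      then have "0 = (\<Sum>j'\<in>?J. c j' * (if j \<in> cls A j' then 1 else 0))" by (simp add: z_def vec_eq_iff)
      also have "\<dots> = (\<Sum>j'\<in>?J. if j' = j then c j' else 0)"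
        using j fam_indep_columns_inj[OF J] by (intro sum.cong refl) auto
      finally show "c j = 0" using j by simp
    qed
  next
    fix i
    show "\<exists>c. \<forall>j\<in>?J. W j i = (\<Sum>n\<in>?N. c n * W j n)"
    proof (cases "i \<in> ?N")
      case True
      then show ?thesis
        by (intro exI[of _ "\<lambda>n. if n = i then 1 else 0"]) (simp add: if_distrib[of "\<lambda>z. z * _"] cong: if_cong)
    next
      case False
      \<comment> \<open>Coefficients sum to zero over a class, so the one at the representative is
        determined by the others.\<close>
      have sub: "cls A i - {i} \<subseteq> ?N"
      proof
        fix n assume n: "n \<in> cls A i - {i}"
        then have "class_rep A n = i" using class_rep_cong[of n A i] False by simp
        then show "n \<in> ?N" using n by auto
      qed
      have "W j i = (\<Sum>n\<in>?N. (if n \<in> cls A i - {i} then - 1 else 0) * W j n)" if "j \<in> ?J" for j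
      proof -
        have "0 = W j i + (\<Sum>n\<in>cls A i - {i}. W j n)"
          using Wc[of j i] that by (simp add: sum.remove[of "cls A i" i])
        moreover have "(\<Sum>n\<in>?N. (if n \<in> cls A i - {i} then - 1 else 0) * W j n) = (\<Sum>n\<in>cls A i - {i}. - W j n)"
          by (rule sum.mono_neutral_cong_right) (use sub in auto)
        ultimately show ?thesis unfolding sum_negf by (metis eq_neg_iff_add_eq_0)
      qed
      then show ?thesis by (intro exI[of _ "\<lambda>n. if n \<in> cls A i - {i} then - 1 else 0"] ballI)
    qed
  qed simp_all
qed

text \<open>
  As many linear forms as the rank of \<open>A\<close> are independent on \<open>dual_family A l\<close>: the class sums of
  the basis columns that are not free, and for each free one a coordinate that the summand with
  zero class sums makes arbitrary.
\<close>

lemma alg_indep_dual_family: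
  fixes A :: "int ^ 'n::finite ^ 'm::finite" and S :: "('k::field_char_0 ^ 'n) set"
  assumes l: "\<And>j. \<not> free_class A j \<Longrightarrow> csum A l j \<noteq> 0"
    and J: "fam_indep (\<lambda>i k. of_int (A $ k $ i) :: 'k) J"
    and \<iota>: "inj_on \<iota> {j\<in>J. free_class A j}" "\<iota> ` {j\<in>J. free_class A j} \<subseteq> {i. class_rep A i \<noteq> i}"
    and S: "\<And>h. h \<in> dual_family A l \<Longrightarrow> \<exists>v\<in>S. M *v v = h"
    and G: "\<And>j v. j \<in> J \<Longrightarrow> G (Some j) v = (if free_class A j then (M *v v) $ \<iota> j else csum A (M *v v) j)"
  shows "alg_indep_on (Some ` J) G S"
  unfolding alg_indep_on_def
proof (intro allI impI ballI, elim conjE)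
  fix E and c :: "('n option \<Rightarrow> nat) \<Rightarrow> 'k" and a0
  assume E: "finite E" "E \<subseteq> Some ` J \<rightarrow>\<^sub>E UNIV"
    and rel: "\<forall>v\<in>S. (\<Sum>a\<in>E. c a * (\<Prod>i\<in>Some ` J. G i v ^ a i)) = 0" and a0: "a0 \<in> E"
  define \<mu> where "\<mu> j = (if free_class A j then 1 else (of_int (csum A l j) :: 'k))" for j
  have \<mu>: "\<mu> j \<noteq> 0" for j using l[of j] by (simp add: \<mu>_def)
  define b where "b a = (\<Sum>j\<in>J. int (a (Some j)) *s column j A)" for a
  let ?F = "{j\<in>J. free_class A j}"
  have point: "\<exists>v\<in>S. \<forall>j\<in>J. G (Some j) v = \<mu> j * tor A y \<tau> $ j" if t: "\<tau> \<noteq> 0" for y and \<tau> :: 'k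
  proof -
    define t where "t = tor A y \<tau>"
    \<comment> \<open>Chosen so that the coordinate \<open>\<iota> j\<close> of \<open>h\<close>
      becomes \<open>t $ j\<close> for each free \<open>j\<close>. The representative absorbs the
      class sum, and \<open>\<iota> j\<close> is never a representative.\<close>
    define \<nu>0 where "\<nu>0 i = (if i \<in> \<iota> ` ?F then t $ the_inv_into ?F \<iota> i - t $ i * of_int (l $ i) else 0)" for i
    define \<nu> where "\<nu> = (\<chi> i. if class_rep A i = i then - (\<Sum>n\<in>cls A i - {i}. \<nu>0 n) else \<nu>0 i)"
    have \<nu>: "csum A \<nu> j = 0" for j
    proof -
      let ?r = "class_rep A j"
      have r: "?r \<in> cls A j" "cls A ?r = cls A j" "class_rep A ?r = ?r"
        using class_rep_cls[of A j] cls_cong class_rep_cong by blast+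
      have "csum A \<nu> j = \<nu> $ ?r + (\<Sum>n\<in>cls A j - {?r}. \<nu> $ n)"
        unfolding csum_def by (rule sum.remove) (use r in simp_all)
      also have "\<nu> $ ?r = - (\<Sum>n\<in>cls A j - {?r}. \<nu>0 n)" using r by (simp add: \<nu>_def)
      also have "(\<Sum>n\<in>cls A j - {?r}. \<nu> $ n) = (\<Sum>n\<in>cls A j - {?r}. \<nu>0 n)"
      proof (intro sum.cong refl)
        fix n assume n: "n \<in> cls A j - {?r}"
        then have "class_rep A n \<noteq> n" using class_rep_cong[of n A j] by auto
        then show "\<nu> $ n = \<nu>0 n" by (simp add: \<nu>_def)
      qed
      finally show ?thesis by simp
    qed
    define h where "h = (\<chi> i. t $ i * of_int (l $ i)) + \<nu>"
    have "h \<in> dual_family A l" unfolding dual_family_def h_def t_def using t \<nu> by blast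
    then obtain v where v: "v \<in> S" "M *v v = h" using S by blast
    have "G (Some j) v = \<mu> j * t $ j" if j: "j \<in> J" for j
    proof (cases "free_class A j")
      case True
      then have "\<iota> j \<in> \<iota> ` ?F" "class_rep A (\<iota> j) \<noteq> \<iota> j" using j \<iota>(2) by auto
      moreover have "the_inv_into ?F \<iota> (\<iota> j) = j" using True j by (intro the_inv_into_f_f[OF \<iota>(1)]) simp
      ultimately have "h $ \<iota> j = t $ j" by (simp add: h_def \<nu>_def \<nu>0_def)
      then show ?thesis using True by (simp add: G[OF j] v(2) \<mu>_def)
    next
      case False
      have "csum A h j = (\<Sum>i\<in>cls A j. t $ i * of_int (l $ i)) + csum A \<nu> j"
        by (simp add: h_def csum_add) (simp add: csum_def)
      also have "(\<Sum>i\<in>cls A j. t $ i * of_int (l $ i)) = t $ j * of_int (csum A l j)"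
        unfolding csum_def of_int_sum sum_distrib_left
        by (intro sum.cong refl arg_cong2[of _ _ _ _ "(*)"]) (simp_all add: t_def tor_cls)
      finally show ?thesis using False by (simp add: G[OF j] v(2) \<mu>_def \<nu> mult.commute)
    qed
    then show ?thesis using v(1) unfolding t_def by blast
  qed
  have "(\<Sum>a\<in>{a\<in>E. b a = b a0}. c a * (\<Prod>j\<in>J. \<mu> j ^ a (Some j))) = 0"
  proof (rule characters_independent[OF E(1)])
    fix y and \<tau> :: 'k assume t: "\<tau> \<noteq> 0"
    obtain v where v: "v \<in> S" "\<And>j. j \<in> J \<Longrightarrow> G (Some j) v = \<mu> j * tor A y \<tau> $ j"
      using point[OF t, of y] by blast
    have "(\<Prod>i\<in>Some ` J. G i v ^ a i) = (\<Prod>j\<in>J. \<mu> j ^ a (Some j)) * \<tau> powi idot y (b a)" for a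
    proof -
      have "\<tau> powi idot y (b a) = (\<Prod>j\<in>J. \<tau> powi idot y (int (a (Some j)) *s column j A))"
        by (simp add: b_def idot_sum power_int_sum[OF t])
      also have "\<dots> = (\<Prod>j\<in>J. (tor A y \<tau> $ j) ^ a (Some j))"
        by (intro prod.cong refl) (simp add: idot_smult_right mult.commute[of "int _"] power_int_mult_nat tor_def)
      finally show ?thesis
        by (simp add: prod.reindex v(2) power_mult_distrib prod.distrib)
    qed
    then show "(\<Sum>a\<in>E. c a * (\<Prod>j\<in>J. \<mu> j ^ a (Some j)) * \<tau> powi idot y (b a)) = 0"
      using bspec[OF rel v(1)] by (simp add: mult.assoc)
  qed
  \<comment> \<open>The columns in \<open>J\<close> are independent, so different exponent vectors
    give different characters.\<close>
  moreover have "{a\<in>E. b a = b a0} = {a0}"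
  proof -
    have "a = a0" if a: "a \<in> E" "b a = b a0" for a
    proof -
      have eq: "b a $ k = b a0 $ k" for k using a(2) by simp
      have "(\<Sum>j\<in>J. (of_int (int (a (Some j)) - int (a0 (Some j))) :: 'k) * of_int (A $ k $ j)) = 0" for k
      proof -
        have "(\<Sum>j\<in>J. (int (a (Some j)) - int (a0 (Some j))) * A $ k $ j) = 0"
          using eq[of k] by (simp add: b_def sum_component column_def left_diff_distrib sum_subtractf)
        then have "of_int (\<Sum>j\<in>J. (int (a (Some j)) - int (a0 (Some j))) * A $ k $ j) = (0::'k)"
          by (simp only: of_int_0)
        then show ?thesis by (simp only: of_int_sum of_int_mult)
      qed
      then have "\<forall>j\<in>J. (of_int (int (a (Some j)) - int (a0 (Some j))) :: 'k) = 0"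
        using J[unfolded fam_indep_def, rule_format,
            of "\<lambda>j. of_int (int (a (Some j)) - int (a0 (Some j)))"] by blast
      then have "\<forall>j\<in>J. a (Some j) = a0 (Some j)" by (simp only: of_int_eq_0_iff) simp
      then have "a x = a0 x" if "x \<in> Some ` J" for x using that by auto
      moreover have "a \<in> Some ` J \<rightarrow>\<^sub>E UNIV" "a0 \<in> Some ` J \<rightarrow>\<^sub>E UNIV" using a(1) a0 E(2) by blast+
      ultimately show ?thesis by (intro PiE_ext)
    qed
    then show ?thesis using a0 by auto
  qed
  ultimately show "c a0 = 0" using \<mu> by simp
qed

text \<open>Otherwise \<open>P\<close> after \<open>M\<close> is a nonzerodivisor on the cone that
  vanishes on the preimage of \<open>dual_family\<close>, where rank-many functions are already
  independent. Adding it, under the index \<open>None\<close>, exceeds the rank.\<close>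

lemma vanishing_on_dual_family:
  fixes A :: "int ^ 'n::finite ^ 'm::finite" and M :: "'k::field_char_0 ^ 'n ^ 'n"
  assumes M: "invertible M"
    "\<And>v j. v \<in> toric_cone A \<Longrightarrow> free_class A j \<Longrightarrow> csum A (M *v v) j = 0"
    "\<And>y \<tau> h. \<tau> \<noteq> 0 \<Longrightarrow> (\<And>w. w \<in> ker_perp A \<Longrightarrow> (\<Sum>i\<in>UNIV. h $ i * (tor A y \<tau> $ i * w $ i)) = 0)
       \<Longrightarrow> \<exists>v\<in>toric_cone A. h = M *v v"
    and l: "l \<in> int_kernel A" "\<And>j. \<not> free_class A j \<Longrightarrow> csum A l j \<noteq> 0"
    and P: "polyfun P" "\<And>h. h \<in> dual_family A l \<Longrightarrow> P h = 0"
    and v: "v \<in> toric_cone A"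
  shows "P (M *v v) = 0"
proof (rule ccontr)
  assume nz: "P (M *v v) \<noteq> 0"
  obtain R :: "'m set" where R: "fam_indep (\<lambda>k i. of_int (A $ k $ i) :: 'k) R" "row_generating A R"
    by (rule row_basis)
  obtain J where J: "fam_indep (\<lambda>i k. of_int (A $ k $ i) :: 'k) J" "card R \<le> card J"
    using column_basis[OF R(1)] by blast
  have "card {j\<in>J. free_class A j} \<le> card {i. class_rep A i \<noteq> i}"
    by (rule card_free_le[OF M(1,2) J(1)])
  then obtain \<iota> where \<iota>: "\<iota> ` {j\<in>J. free_class A j} \<subseteq> {i. class_rep A i \<noteq> i}" "inj_on \<iota> {j\<in>J. free_class A j}"
    using card_le_inj[of "{j\<in>J. free_class A j}" "{i. class_rep A i \<noteq> i}"] by auto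
  define G where "G x w = (case x of None \<Rightarrow> P (M *v w)
     | Some j \<Rightarrow> if free_class A j then (M *v w) $ \<iota> j else csum A (M *v w) j)" for x w
  let ?S = "{w \<in> toric_cone A. M *v w \<in> dual_family A l}"
  have poly: "polyfun (G x)" for x
  proof (cases x)
    case None
    then show ?thesis unfolding G_def by (simp add: polyfun_matrix_vector[OF P(1)])
  next
    case (Some j)
    then show ?thesis unfolding G_def
      by (cases "free_class A j") (simp_all add: polyfun_matrix_vector[OF polyfun_coord] polyfun_matrix_vector[OF polyfun_csum])
  qed
  have ind: "alg_indep_on (Some ` J) G ?S"
  proof (rule alg_indep_dual_family[OF l(2) J(1) \<iota>(2,1)])
    fix h :: "'k ^ 'n" assume h: "h \<in> dual_family A l"
    then obtain y \<tau> where "\<tau> \<noteq> 0" "\<And>w. w \<in> ker_perp A \<Longrightarrow> (\<Sum>i\<in>UNIV. h $ i * (tor A y \<tau> $ i * w $ i)) = 0"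
      using dual_family_annihilates[OF l(1) h] by blast
    then obtain w where "w \<in> toric_cone A" "h = M *v w" using M(3) by blast
    then show "\<exists>v\<in>?S. M *v v = h" using h by auto
  qed (simp_all add: G_def)
  have can: "cancels (toric_cone A) (G None)"
    by (rule cancels_toric_cone[OF poly]) (use nz v in \<open>auto simp: G_def\<close>)
  have "alg_indep_on (insert None (Some ` J)) G (toric_cone A)"
    by (rule alg_indep_on_insert[OF _ _ _ poly ind _ can]) (use P(2) in \<open>auto simp: G_def\<close>)
  moreover have "card R < card (insert None (Some ` J))"
    using J(2) by (subst card_insert_disjoint) (auto simp: card_image)
  ultimately show False
    using not_alg_indep_toric_cone[OF R(2), of "insert None (Some ` J)" G] poly by simp
qed

section \<open>Class sums over parallel classes of the Gale dual\<close>

text \<open>A binomial equation of the torus, transported to class sums. It is written without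
  division because the class sums of \<open>h\<close> may vanish, which is the case of interest
  later.\<close>

lemma class_sum_identity:
  fixes A :: "int ^ 'n::finite ^ 'm::finite"
  assumes bal: "balanced A" and sd: "self_dual (toric_variety A :: ('k::field_char_0 ^ 'n) set set)"
    and l: "l \<in> int_kernel A" "\<And>j. \<not> free_class A j \<Longrightarrow> csum A l j \<noteq> 0"
    and h: "h \<in> int_kernel A" and u: "u \<in> int_kernel A"
  defines "N \<equiv> {i. \<not> free_class A i}"
  shows "(\<Prod>i\<in>N. csum A h i ^ nat (u $ i)) * (\<Prod>i\<in>N. csum A l i ^ nat (- (u $ i))) =
         (\<Prod>i\<in>N. csum A h i ^ nat (- (u $ i))) * (\<Prod>i\<in>N. csum A l i ^ nat (u $ i))"
proof -
  obtain M :: "'k ^ 'n ^ 'n" where M: "invertible M"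
    "\<And>v j. v \<in> toric_cone A \<Longrightarrow> free_class A j \<Longrightarrow> csum A (M *v v) j = 0"
    "\<And>y \<tau> h. \<tau> \<noteq> 0 \<Longrightarrow> (\<And>w. w \<in> ker_perp A \<Longrightarrow> (\<Sum>i\<in>UNIV. h $ i * (tor A y \<tau> $ i * w $ i)) = 0)
       \<Longrightarrow> \<exists>v\<in>toric_cone A. h = M *v v"
    using self_dual_matrix[OF bal sd] by blast
  let ?l = "\<lambda>i. of_int (csum A l i) :: 'k"
  define P :: "'k ^ 'n \<Rightarrow> 'k" where "P x =
    (\<Prod>i\<in>N. csum A x i ^ nat (u $ i)) * (\<Prod>i\<in>N. ?l i ^ nat (- (u $ i))) -
    (\<Prod>i\<in>N. csum A x i ^ nat (- (u $ i))) * (\<Prod>i\<in>N. ?l i ^ nat (u $ i))" for x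
  have poly: "polyfun P"
    unfolding P_def by (intro polyfun_diff polyfun_mult polyfun_const polyfun_prod polyfun_power polyfun_csum)
  have van: "P x = 0" if x: "x \<in> dual_family A l" for x
  proof -
    obtain y \<tau> \<nu> where x: "\<tau> \<noteq> 0" "\<And>j. csum A \<nu> j = 0" "x = (\<chi> i. tor A y \<tau> $ i * of_int (l $ i)) + \<nu>"
      using x unfolding dual_family_def by blast
    define t where "t = tor A y \<tau>"
    have cs: "csum A x i = t $ i * ?l i" for i
    proof -
      have "csum A x i = (\<Sum>j\<in>cls A i. t $ j * of_int (l $ j))"
        by (simp add: x(3) csum_add x(2) t_def) (simp add: csum_def)
      also have "\<dots> = t $ i * ?l i"
        unfolding csum_def of_int_sum sum_distrib_left
        by (intro sum.cong refl arg_cong2[of _ _ _ _ "(*)"]) (simp_all add: t_def tor_cls)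
      finally show ?thesis .
    qed
    \<comment> \<open>Kernel vectors have class sum zero on free classes, so erasing these entries
      changes no class sum and stays in the kernel.\<close>
    define u' :: "int ^ 'n" where "u' = (\<chi> i. if i \<in> N then u $ i else 0)"
    have "csum A (u - u') j = 0" for j
    proof (cases "free_class A j")
      case True
      then have "csum A (u - u') j = csum A u j"
        unfolding csum_def by (intro sum.cong) (auto simp: u'_def N_def free_class_cls)
      then show ?thesis using True u by (simp add: free_class_def)
    next
      case False
      then show ?thesis
        unfolding csum_def by (intro sum.neutral) (auto simp: u'_def N_def free_class_cls)
    qed
    then have "u - u' \<in> int_kernel A" by (rule int_kernel_if_csum_zero)
    then have "u' \<in> int_kernel A" using int_kernel_diff[OF u] by fastforce
    then have "mon t (pos_exp u') = mon t (neg_exp u')"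
      using tor_in_cone[OF x(1), of A y] by (simp add: toric_cone_def t_def)
    moreover have "mon t (pos_exp u') = (\<Prod>i\<in>N. t $ i ^ nat (u $ i))"
      unfolding mon_def by (intro prod.mono_neutral_cong_right) (auto simp: u'_def)
    moreover have "mon t (neg_exp u') = (\<Prod>i\<in>N. t $ i ^ nat (- (u $ i)))"
      unfolding mon_def by (intro prod.mono_neutral_cong_right) (auto simp: u'_def)
    ultimately show ?thesis
      by (simp add: P_def cs power_mult_distrib prod.distrib mult_ac)
  qed
  \<comment> \<open>A kernel vector is conormal at the all-ones point, which is
    \<open>tor A 0 1\<close>.\<close>
  have "\<exists>v\<in>toric_cone A. (\<chi> i. of_int (h $ i)) = M *v v"
  proof (rule M(3)[of 1])
    fix w :: "'k ^ 'n" assume "w \<in> ker_perp A"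
    then show "(\<Sum>i\<in>UNIV. (\<chi> i. of_int (h $ i)) $ i * (tor A 0 1 $ i * w $ i)) = 0"
      using h by (simp add: ker_perp_def tor_def)
  qed simp
  then obtain v where v: "v \<in> toric_cone A" "(\<chi> i. of_int (h $ i)) = M *v v" by blast
  have "P (\<chi> i. of_int (h $ i)) = 0"
    unfolding v(2) by (rule vanishing_on_dual_family[OF M l poly van v(1)])
  then have "of_int ((\<Prod>i\<in>N. csum A h i ^ nat (u $ i)) * (\<Prod>i\<in>N. csum A l i ^ nat (- (u $ i)))) =
      (of_int ((\<Prod>i\<in>N. csum A h i ^ nat (- (u $ i))) * (\<Prod>i\<in>N. csum A l i ^ nat (u $ i))) :: 'k)"
    unfolding P_def csum_of_int right_minus_eq by (simp only: of_int_mult of_int_prod of_int_power)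
  then show ?thesis by (simp only: of_int_eq_iff)
qed

text \<open>The indices whose class sum, as a linear form on the kernel, is a nonzero multiple of
  that at a nonfree \<open>j\<close>; comparing kernels avoids naming the factor.\<close>

definition bouquet :: "int ^ 'n::finite ^ 'm::finite \<Rightarrow> 'n \<Rightarrow> 'n set" where
  "bouquet A j = {i. \<not> free_class A i \<and> (\<forall>u\<in>int_kernel A. csum A u j = 0 \<longrightarrow> csum A u i = 0)}"

text \<open>
  Along the line \<open>s \<mapsto> h + s l\<close>, with \<open>h\<close> generic in the kernel of the class sum at \<open>j\<close>, exactly
  the class sums of the bouquet of \<open>j\<close> vanish at \<open>s = 0\<close>, so the orders of vanishing of the two
  sides of the identity are the sums of the entries of \<open>u\<close> of each sign over the bouquet.
\<close>

lemma bouquet_sum_le: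
  fixes A :: "int ^ 'n::finite ^ 'm::finite"
  assumes bal: "balanced A" and sd: "self_dual (toric_variety A :: ('k::field_char_0 ^ 'n) set set)"
    and j: "\<not> free_class A j" and u: "u \<in> int_kernel A"
  shows "(\<Sum>i\<in>bouquet A j. nat (- (u $ i))) \<le> (\<Sum>i\<in>bouquet A j. nat (u $ i))"
proof (rule ccontr)
  let ?B = "bouquet A j"
  define a where "a = (\<Sum>i\<in>?B. nat (u $ i))"
  define b where "b = (\<Sum>i\<in>?B. nat (- (u $ i)))"
  assume "\<not> ?thesis"
  then have ab: "a < b" by (simp add: a_def b_def)
  define N where "N = {i. \<not> free_class A i}"
  have B: "?B \<subseteq> N" by (auto simp: bouquet_def N_def)
  have lin: "csum A (c *s x + y) i = c * csum A x i + csum A y i" for c i and x y :: "int ^ 'n"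
    by (simp only: csum_add csum_smult)
  have "\<exists>x\<in>int_kernel A. \<forall>i\<in>N. (\<lambda>i x. csum A x i) i x \<noteq> 0"
    by (rule generic_element) (auto simp: int_kernel_zero int_kernel_lincomb lin N_def free_class_def)
  then obtain l where l: "l \<in> int_kernel A" "\<And>i. \<not> free_class A i \<Longrightarrow> csum A l i \<noteq> 0" by (auto simp: N_def)
  have "\<exists>x\<in>{x\<in>int_kernel A. csum A x j = 0}. \<forall>i\<in>N - ?B. (\<lambda>i x. csum A x i) i x \<noteq> 0"
    by (rule generic_element)
       (auto simp: int_kernel_zero int_kernel_lincomb lin N_def bouquet_def csum_def[of A 0])
  then obtain h where h: "h \<in> int_kernel A" "csum A h j = 0" "\<And>i. i \<in> N - ?B \<Longrightarrow> csum A h i \<noteq> 0" by auto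
  have hB: "csum A h i = 0" if "i \<in> ?B" for i using that h(1,2) by (auto simp: bouquet_def)
  \<comment> \<open>Over the bouquet each factor on the line is \<open>s\<close> times a class sum
    of \<open>l\<close>; the other factors form \<open>Q\<close>, a polynomial in \<open>s\<close>
    with nonzero constant term. The exponents \<open>e\<close> will be the entries of
    \<open>u\<close> or of \<open>- u\<close>.\<close>
  define L where "L e = (\<Prod>i\<in>?B. csum A l i ^ nat (e i))" for e
  define Q where "Q e = (\<Prod>i\<in>N - ?B. [:csum A h i, csum A l i:] ^ nat (e i))" for e
  define c where "c e = (\<Prod>i\<in>N. csum A l i ^ nat (e i))" for e
  have c: "c e \<noteq> 0" and L: "L e \<noteq> 0" for e using l(2) B by (auto simp: c_def L_def N_def)
  have Q0: "coeff (Q e) 0 \<noteq> 0" for e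
  proof -
    have "poly (Q e) 0 \<noteq> 0" using h(3) by (auto simp: Q_def poly_prod)
    then show ?thesis by (simp add: poly_0_coeff_0)
  qed
  have split: "(\<Prod>i\<in>N. csum A (s *s l + h) i ^ nat (e i)) = s ^ (\<Sum>i\<in>?B. nat (e i)) * (L e * poly (Q e) s)"
    for s and e :: "'n \<Rightarrow> int"
  proof -
    have "(\<Prod>i\<in>N. csum A (s *s l + h) i ^ nat (e i)) =
       (\<Prod>i\<in>N - ?B. csum A (s *s l + h) i ^ nat (e i)) * (\<Prod>i\<in>?B. csum A (s *s l + h) i ^ nat (e i))"
      by (rule prod.subset_diff[OF B]) simp
    also have "(\<Prod>i\<in>N - ?B. csum A (s *s l + h) i ^ nat (e i)) = poly (Q e) s"
      unfolding lin by (simp add: Q_def poly_prod add.commute)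
    also have "(\<Prod>i\<in>?B. csum A (s *s l + h) i ^ nat (e i)) = (\<Prod>i\<in>?B. s ^ nat (e i) * csum A l i ^ nat (e i))"
      by (intro prod.cong refl) (simp add: lin hB power_mult_distrib)
    also have "\<dots> = s ^ (\<Sum>i\<in>?B. nat (e i)) * L e" by (simp add: prod.distrib L_def power_sum)
    finally show ?thesis by (simp add: mult_ac)
  qed
  let ?p = "\<lambda>i. u $ i" and ?n = "\<lambda>i. - (u $ i)"
  have "poly (monom (L ?p * c ?n) a * Q ?p) s = poly (monom (L ?n * c ?p) b * Q ?n) s" for s
  proof -
    have "s *s l + h \<in> int_kernel A" using l(1) h(1) by (rule int_kernel_lincomb)
    from class_sum_identity[OF bal sd l this u, folded N_def]
    show ?thesis unfolding split c_def[symmetric] a_def b_def by (simp add: poly_monom mult_ac)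
  qed
  then have "monom (L ?p * c ?n) a * Q ?p = monom (L ?n * c ?p) b * Q ?n" by (intro poly_eq_poly_eq_iff[THEN iffD1] ext)
  \<comment> \<open>The right-hand side is divisible by the \<open>b\<close>-th power of the
    variable and \<open>a < b\<close>, so its coefficient at \<open>a\<close> is zero.\<close>
  then have "coeff (monom (L ?p * c ?n) a * Q ?p) a = coeff (monom (L ?n * c ?p) b * Q ?n) a" by simp
  then have "L ?p * c ?n * coeff (Q ?p) 0 = 0" using ab by (simp add: coeff_monom_mult)
  then show False using L[of ?p] c[of ?n] Q0[of ?p] by simp
qed

lemma bouquet_sum_zero:
  fixes A :: "int ^ 'n::finite ^ 'm::finite"
  assumes "balanced A" "self_dual (toric_variety A :: ('k::field_char_0 ^ 'n) set set)"
    and "\<not> free_class A j" "u \<in> int_kernel A"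
  shows "(\<Sum>i\<in>bouquet A j. u $ i) = 0"
proof -
  have "(\<Sum>i\<in>bouquet A j. nat (u $ i)) = (\<Sum>i\<in>bouquet A j. nat (- (u $ i)))"
    using bouquet_sum_le[OF assms] bouquet_sum_le[OF assms(1,2,3) int_kernel_uminus[OF assms(4)]] by simp
  then have "int (\<Sum>i\<in>bouquet A j. nat (u $ i)) - int (\<Sum>i\<in>bouquet A j. nat (- (u $ i))) = 0" by simp
  then have "(\<Sum>i\<in>bouquet A j. int (nat (u $ i)) - int (nat (- (u $ i)))) = 0" by (simp add: sum_subtractf)
  moreover have "int (nat x) - int (nat (- x)) = x" for x :: int by simp
  ultimately show ?thesis by simp
qed

section \<open>Graver bases\<close>

definition conformal :: "int ^ 'n::finite \<Rightarrow> int ^ 'n \<Rightarrow> bool" where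
  "conformal v u \<longleftrightarrow> (\<forall>i. nat (v $ i) \<le> nat (u $ i) \<and> nat (- (v $ i)) \<le> nat (- (u $ i)))"

lemma conformal_split:
  assumes "conformal v u"
  shows "pos_exp u = pos_exp v + pos_exp (u - v)" "neg_exp u = neg_exp v + neg_exp (u - v)"
proof -
  have *: "nat (v $ i) \<le> nat (u $ i) \<and> nat (- (v $ i)) \<le> nat (- (u $ i))" for i
    using assms by (simp add: conformal_def)
  show "pos_exp u = pos_exp v + pos_exp (u - v)"
  proof (rule poly_mapping_eqI)
    fix i show "lookup (pos_exp u) i = lookup (pos_exp v + pos_exp (u - v)) i"
      unfolding lookup_add lookup_pos_exp vector_minus_component using *[of i] by linarith
  qed
  show "neg_exp u = neg_exp v + neg_exp (u - v)"
  proof (rule poly_mapping_eqI)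
    fix i show "lookup (neg_exp u) i = lookup (neg_exp v + neg_exp (u - v)) i"
      unfolding lookup_add lookup_neg_exp vector_minus_component using *[of i] by linarith
  qed
qed

lemma conformal_if_split:
  assumes "pos_exp u = pos_exp v + pos_exp w" "neg_exp u = neg_exp v + neg_exp w"
  shows "conformal v u"
  unfolding conformal_def
proof
  fix i
  have "nat (u $ i) = nat (v $ i) + nat (w $ i)"
    using arg_cong[OF assms(1), of "\<lambda>m. lookup m i"] by (simp add: lookup_add)
  moreover have "nat (- (u $ i)) = nat (- (v $ i)) + nat (- (w $ i))"
    using arg_cong[OF assms(2), of "\<lambda>m. lookup m i"] by (simp add: lookup_add)
  ultimately show "nat (v $ i) \<le> nat (u $ i) \<and> nat (- (v $ i)) \<le> nat (- (u $ i))" by simp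
qed

text \<open>One summand of a decomposition determines the other, so primitivity is minimality for
  \<open>conformal\<close>.\<close>

lemma graver_basis_iff:
  "u \<in> graver_basis A \<longleftrightarrow> u \<in> int_kernel A \<and> u \<noteq> 0 \<and>
     (\<forall>v\<in>int_kernel A. conformal v u \<longrightarrow> v = 0 \<or> v = u)"
proof
  assume u: "u \<in> graver_basis A"
  then have uk: "u \<in> int_kernel A" "u \<noteq> 0" by (auto simp: graver_basis_def)
  have "v = 0 \<or> v = u" if v: "v \<in> int_kernel A" "conformal v u" for v
  proof (rule ccontr)
    assume ne: "\<not> (v = 0 \<or> v = u)"
    have "u - v \<in> int_kernel A" using uk v by (intro int_kernel_diff)
    moreover have "v \<noteq> 0" "u - v \<noteq> 0" "u = v + (u - v)" using ne by auto
    ultimately show False using u v(1) conformal_split[OF v(2)] unfolding graver_basis_def by blast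
  qed
  then show "u \<in> int_kernel A \<and> u \<noteq> 0 \<and> (\<forall>v\<in>int_kernel A. conformal v u \<longrightarrow> v = 0 \<or> v = u)"
    using uk by blast
next
  assume r: "u \<in> int_kernel A \<and> u \<noteq> 0 \<and> (\<forall>v\<in>int_kernel A. conformal v u \<longrightarrow> v = 0 \<or> v = u)"
  have False if vw: "v \<in> int_kernel A" "v \<noteq> 0" "w \<noteq> 0" "u = v + w"
    "pos_exp u = pos_exp v + pos_exp w" "neg_exp u = neg_exp v + neg_exp w" for v w
  proof -
    have "v = 0 \<or> v = u" using r vw(1) conformal_if_split[OF vw(5,6)] by blast
    then show False using vw(2,3,4) by auto
  qed
  then show "u \<in> graver_basis A" using r unfolding graver_basis_def by blast
qed

text \<open>A decreasing sequence of naturals is constant from the index of its minimum on.\<close>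

lemma increasing_subsequence:
  fixes s :: "nat \<Rightarrow> nat"
  obtains g :: "nat \<Rightarrow> nat" where "strict_mono g" "mono (\<lambda>k. s (g k))"
proof -
  obtain g where g: "strict_mono g" "monoseq (\<lambda>n. s (g n))" using seq_monosub by blast
  show ?thesis
  proof (cases "mono (\<lambda>n. s (g n))")
    case True
    then show ?thesis using g that by blast
  next
    case False
    then have dec: "s (g n) \<le> s (g m)" if "m \<le> n" for m n
      using g(2) that unfolding monoseq_def mono_def by blast
    obtain K where K: "\<And>n. s (g K) \<le> s (g n)"
      using ex_has_least_nat[of "\<lambda>_. True" 0 "\<lambda>n. s (g n)"] by blast
    have "s (g (n + K)) = s (g K)" for n using K[of "n + K"] dec[of K "n + K"] by simp
    then have "mono (\<lambda>n. s (g (n + K)))" by (simp add: mono_def)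
    moreover have "strict_mono (\<lambda>n. g (n + K))" using g(1) by (simp add: strict_mono_def)
    ultimately show ?thesis using that by blast
  qed
qed

text \<open>Dickson's lemma, refining the sequence one coordinate at a time.\<close>

lemma dickson_subsequence:
  fixes f :: "nat \<Rightarrow> 'i \<Rightarrow> nat"
  assumes "finite I"
  shows "\<exists>r :: nat \<Rightarrow> nat. strict_mono r \<and> (\<forall>i\<in>I. mono (\<lambda>k. f (r k) i))"
  using assms
proof (induction I rule: finite_induct)
  case empty
  have "strict_mono (\<lambda>k::nat. k)" by (simp add: strict_mono_def)
  then show ?case by (intro exI[of _ "\<lambda>k. k"]) simp
next
  case (insert i I)
  then obtain r :: "nat \<Rightarrow> nat" where r: "strict_mono r" "\<And>j. j \<in> I \<Longrightarrow> mono (\<lambda>k. f (r k) j)" by blast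
  obtain g :: "nat \<Rightarrow> nat" where g: "strict_mono g" "mono (\<lambda>k. f (r (g k)) i)"
    using increasing_subsequence[of "\<lambda>k. f (r k) i"] by blast
  have "strict_mono (\<lambda>k. r (g k))" using r(1) g(1) by (simp add: strict_mono_def)
  moreover have "mono (\<lambda>k. f (r (g k)) j)" if "j \<in> insert i I" for j
  proof (cases "j = i")
    case False
    then have "mono (\<lambda>k. f (r k) j)" using that r by blast
    then show ?thesis using strict_mono_mono[OF g(1)] by (simp add: mono_def)
  qed (use g in simp)
  ultimately show ?case by (intro exI[of _ "\<lambda>k. r (g k)"] conjI ballI)
qed

text \<open>Distinct Graver elements are incomparable for \<open>conformal\<close>, whereas
  Dickson's lemma, applied to positive and negative parts together, finds a comparable pair in any
  infinite family.\<close>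

lemma finite_graver_basis:
  fixes A :: "int ^ 'n::finite ^ 'm::finite"
  shows "finite (graver_basis A)"
proof (rule ccontr)
  assume "infinite (graver_basis A)"
  then obtain f :: "nat \<Rightarrow> int ^ 'n" where f: "inj f" "range f \<subseteq> graver_basis A"
    using infinite_countable_subset by blast
  define F where "F k = (\<lambda>(i, b). if b then nat (f k $ i) else nat (- (f k $ i)))" for k
  obtain r :: "nat \<Rightarrow> nat" where r: "strict_mono r" "\<And>x. mono (\<lambda>k. F (r k) x)"
    using dickson_subsequence[of "UNIV :: ('n \<times> bool) set" F] by auto
  let ?u = "f (r 0)" and ?w = "f (r 1)"
  have "F (r 0) x \<le> F (r 1) x" for x using r(2)[of x] by (simp add: mono_def)
  then have "F (r 0) (i, True) \<le> F (r 1) (i, True)" "F (r 0) (i, False) \<le> F (r 1) (i, False)" for i by blast+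
  then have "conformal ?u ?w" by (simp add: conformal_def F_def)
  moreover have "?u \<in> graver_basis A" "?w \<in> graver_basis A" using f(2) by auto
  ultimately have "?u = ?w" by (auto simp: graver_basis_iff)
  moreover have "r 0 \<noteq> r 1" using strict_monoD[OF r(1), of 0 1] by simp
  ultimately show False using f(1) by (auto dest: injD)
qed

section \<open>Minimal generation of toric ideals\<close>

abbreviation bdeg :: "int ^ 'n::finite \<Rightarrow> nat" where "bdeg u \<equiv> tdeg (pos_exp u)"

lemma ideal_gen_mono: "B \<subseteq> C \<Longrightarrow> ideal_gen B \<subseteq> ideal_gen C"
  unfolding ideal_gen_def by (rule ideal.span_mono)

lemma ideal_gen_base: "b \<in> B \<Longrightarrow> b \<in> ideal_gen B"
  unfolding ideal_gen_def by (rule ideal.span_base)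

lemma ideal_gen_add: "f \<in> ideal_gen B \<Longrightarrow> g \<in> ideal_gen B \<Longrightarrow> f + g \<in> ideal_gen B"
  unfolding ideal_gen_def by (rule ideal.span_add)

lemma ideal_gen_diff: "f \<in> ideal_gen B \<Longrightarrow> g \<in> ideal_gen B \<Longrightarrow> f - g \<in> ideal_gen B"
  unfolding ideal_gen_def by (rule ideal.span_diff)

lemma ideal_gen_mult: "f \<in> ideal_gen B \<Longrightarrow> h * f \<in> ideal_gen B"
  unfolding ideal_gen_def by (rule ideal.span_scale)

lemma ideal_gen_zero: "0 \<in> ideal_gen B"
  unfolding ideal_gen_def by (rule ideal.span_zero)

lemma ideal_gen_sum: "(\<And>x. x \<in> S \<Longrightarrow> f x \<in> ideal_gen B) \<Longrightarrow> (\<Sum>x\<in>S. f x) \<in> ideal_gen B"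
  unfolding ideal_gen_def by (rule ideal.span_sum)

lemma ideal_gen_minimal: "B \<subseteq> ideal_gen C \<Longrightarrow> ideal_gen B \<subseteq> ideal_gen C"
  unfolding ideal_gen_def by (rule ideal.span_minimal) (simp_all add: ideal.subspace_span)

lemma ideal_gen_eq_toric_ideal:
  fixes A :: "int ^ 'n::finite ^ 'm::finite"
  assumes "S \<subseteq> int_kernel A"
    and "binomial_of ` int_kernel A \<subseteq> (ideal_gen (binomial_of ` S) :: ('n, 'k::comm_ring_1) mpolynomial set)"
  shows "ideal_gen (binomial_of ` S) = (toric_ideal A :: ('n, 'k) mpolynomial set)"
  unfolding toric_ideal_def
  using ideal_gen_minimal[OF assms(2)] ideal_gen_mono[OF image_mono[OF assms(1), of binomial_of]]
  by (intro equalityI)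

lemma binomial_of_zero [simp]: "binomial_of 0 = 0"
  by (simp add: binomial_of_def pos_exp_eq_neg_exp[THEN iffD2])

lemma binomial_of_split:
  assumes "pos_exp u = pos_exp v + pos_exp w" "neg_exp u = neg_exp v + neg_exp w"
  shows "binomial_of u = single (pos_exp w) 1 * binomial_of v +
    single (neg_exp v) 1 * binomial_of w"
  by (simp add: binomial_of_def assms right_diff_distrib mult_single add.commute)

lemma binomial_in_graver_ideal:
  fixes A :: "int ^ 'n::finite ^ 'm::finite"
  assumes "u \<in> int_kernel A"
  shows "binomial_of u \<in> (ideal_gen (binomial_of ` graver_basis A) :: ('n, 'k::comm_ring_1) mpolynomial set)"
  using assms
proof (induction "tdeg (pos_exp u) + tdeg (neg_exp u)" arbitrary: u rule: less_induct)
  case less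
  consider "u = 0" | "u \<in> graver_basis A" | "u \<noteq> 0" "u \<notin> graver_basis A" by blast
  then show ?case
  proof cases
    case 1
    then show ?thesis by (simp add: ideal_gen_zero)
  next
    case 2
    then show ?thesis by (intro ideal_gen_base) simp
  next
    case 3
    then obtain v where v: "v \<in> int_kernel A" "conformal v u" "v \<noteq> 0" "v \<noteq> u"
      using less.prems by (auto simp: graver_basis_iff)
    define w where "w = u - v"
    have w: "w \<in> int_kernel A" "w \<noteq> 0" using v less.prems by (auto simp: w_def int_kernel_diff)
    note split = conformal_split[OF v(2), folded w_def]
    have pos: "tdeg (pos_exp x) + tdeg (neg_exp x) > 0" if "x \<noteq> 0" for x :: "int ^ 'n"
    proof (rule ccontr)
      assume "\<not> ?thesis"
      then have "pos_exp x = 0" "neg_exp x = 0" by simp_all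
      then show False using that pos_exp_eq_neg_exp[of x] by simp
    qed
    have "tdeg (pos_exp u) + tdeg (neg_exp u) =
        (tdeg (pos_exp v) + tdeg (neg_exp v)) + (tdeg (pos_exp w) + tdeg (neg_exp w))"
      by (simp add: split tdeg_add)
    then have "binomial_of v \<in> (ideal_gen (binomial_of ` graver_basis A) :: ('n, 'k) mpolynomial set)"
      "binomial_of w \<in> (ideal_gen (binomial_of ` graver_basis A) :: ('n, 'k) mpolynomial set)"
      using pos[OF v(3)] pos[OF w(2)] v(1) w(1) by (simp_all add: less.hyps)
    then show ?thesis unfolding binomial_of_split[OF split] by (intro ideal_gen_add ideal_gen_mult)
  qed
qed

lemma graver_basis_subset_int_kernel: "graver_basis A \<subseteq> int_kernel A"
  by (auto simp: graver_basis_def)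

lemma graver_basis_generates: "ideal_gen (binomial_of ` graver_basis A) = toric_ideal A"
  by (rule ideal_gen_eq_toric_ideal[OF graver_basis_subset_int_kernel]) (auto intro: binomial_in_graver_ideal)

section \<open>Graded pieces of ideals generated by binomials\<close>

lemma hom_part_zero [simp]: "hom_part e 0 = 0"
  by (simp add: hom_part_def)

lemma hom_part_sum: "hom_part e (\<Sum>x\<in>S. f x) = (\<Sum>x\<in>S. hom_part e (f x))"
  by (induction S rule: infinite_finite_induct) (simp_all add: hom_part_add)

lemma hom_part_mult_homdeg:
  assumes b: "homdeg d b"
  shows "hom_part e (h * b) = (if d \<le> e then hom_part (e - d) h * b else 0)"
proof -
  define N where "N = Max (insert e (tdeg ` keys h))"
  have N: "tdeg m \<le> N" if "m \<in> keys h" for m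
    unfolding N_def using that by (intro Max_ge) auto
  have eN: "e \<le> N" unfolding N_def by (intro Max_ge) auto
  have "h * b = (\<Sum>k\<le>N. hom_part k h * b)"
    by (subst sum_hom_parts[OF N]) (simp_all add: sum_distrib_right)
  then have "hom_part e (h * b) = (\<Sum>k\<le>N. hom_part e (hom_part k h * b))" by (simp only: hom_part_sum)
  also have "\<dots> = (\<Sum>k\<le>N. if k + d = e then hom_part k h * b else 0)"
    by (intro sum.cong refl) (rule hom_part_homdeg[OF homdeg_mult[OF homdeg_hom_part b]])
  also have "\<dots> = (\<Sum>k\<le>N. if k = e - d then (if d \<le> e then hom_part k h * b else 0) else 0)"
    by (intro sum.cong refl) auto
  also have "\<dots> = (if d \<le> e then hom_part (e - d) h * b else 0)"
    using eN by (subst sum.delta) auto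
  finally show ?thesis .
qed

lemma hom_part_0: "hom_part 0 h = single 0 (lookup h 0)"
  by (rule poly_mapping_eqI) (auto simp: lookup_hom_part lookup_single when_def)

text \<open>The graded Nakayama mechanism: in degree \<open>e\<close>, generators of degree
  \<open>e\<close> occur with constant coefficients, and everything else comes from lower
  generators.\<close>

lemma hom_part_in_ideal:
  fixes M :: "(int ^ 'n::finite) set" and f :: "('n, 'k::field) mpolynomial"
  assumes bal: "balanced A" and M: "M \<subseteq> int_kernel A" "finite M" and f: "f \<in> ideal_gen (binomial_of ` M)"
  shows "\<exists>c j. j \<in> ideal_gen (binomial_of ` {g\<in>M. bdeg g < e}) \<and>
    hom_part e f = (\<Sum>g\<in>{g\<in>M. bdeg g = e}. single 0 (c g) * binomial_of g) + j"
  using f unfolding ideal_gen_def[of "binomial_of ` M"]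
proof (induction rule: ideal.span_induct_alt)
  case base
  show ?case by (intro exI[of _ "\<lambda>_. 0"] exI[of _ 0]) (simp add: ideal_gen_zero)
next
  case (step h b f)
  then obtain c j where cj: "j \<in> ideal_gen (binomial_of ` {g\<in>M. bdeg g < e})"
    "hom_part e f = (\<Sum>g\<in>{g\<in>M. bdeg g = e}. single 0 (c g) * binomial_of g) + j" by blast
  obtain m where m: "m \<in> M" "b = binomial_of m" using step by blast
  then have b: "homdeg (bdeg m) b" using homdeg_binomial[OF bal] M by blast
  have hp: "hom_part e (h * b + f) = hom_part e (h * b) + hom_part e f" by (rule hom_part_add)
  consider "bdeg m < e" | "bdeg m = e" | "bdeg m > e" by linarith
  then show ?case
  proof cases
    case 1
    then have "hom_part e (h * b) \<in> ideal_gen (binomial_of ` {g\<in>M. bdeg g < e})"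
      unfolding hom_part_mult_homdeg[OF b] using m
      by (simp del: mem_Collect_eq) (intro ideal_gen_mult ideal_gen_base imageI, simp)
    then have "hom_part e (h * b) + j \<in> ideal_gen (binomial_of ` {g\<in>M. bdeg g < e})"
      using cj(1) by (rule ideal_gen_add)
    then show ?thesis
      unfolding hp cj(2) by (intro exI[of _ c] exI[of _ "hom_part e (h * b) + j"]) (simp add: add_ac)
  next
    case 2
    \<comment> \<open>Only the constant term of the multiplier \<open>h\<close> contributes in the
      degree of \<open>m\<close>.\<close>
    define c' where "c' = c(m := lookup h 0 + c m)"
    let ?E = "{g\<in>M. bdeg g = e}"
    have mE: "m \<in> ?E" "finite ?E" using m 2 M by auto
    have "(\<Sum>g\<in>?E. single 0 (c' g) * binomial_of g) =
        single 0 (c' m) * binomial_of m + (\<Sum>g\<in>?E - {m}. single 0 (c' g) * binomial_of g)"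
      by (rule sum.remove[OF mE(2,1)])
    also have "(\<Sum>g\<in>?E - {m}. single 0 (c' g) * binomial_of g) =
        (\<Sum>g\<in>?E - {m}. single 0 (c g) * (binomial_of g :: ('n, 'k) mpolynomial))"
      by (intro sum.cong refl) (simp add: c'_def)
    also have "single 0 (c' m) * binomial_of m =
        hom_part e (h * b) + single 0 (c m) * binomial_of m"
      unfolding hom_part_mult_homdeg[OF b] c'_def
      by (simp add: 2 hom_part_0 m(2) single_add distrib_right)
    finally have "(\<Sum>g\<in>?E. single 0 (c' g) * binomial_of g) =
        hom_part e (h * b) + (\<Sum>g\<in>?E. single 0 (c g) * binomial_of g)"
      by (simp only: sum.remove[OF mE(2,1)] add.assoc)
    then show ?thesis unfolding hp cj(2) using cj(1) by (intro exI[of _ c'] exI[of _ j]) (simp add: add_ac)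
  next
    case 3
    then show ?thesis unfolding hp cj(2) using cj(1)
      by (intro exI[of _ c] exI[of _ j]) (simp add: hom_part_mult_homdeg[OF b])
  qed
qed

lemma homdeg_in_ideal_truncate:
  fixes M :: "(int ^ 'n::finite) set" and f :: "('n, 'k::field) mpolynomial"
  assumes "balanced A" "M \<subseteq> int_kernel A" "finite M" "f \<in> ideal_gen (binomial_of ` M)" "homdeg e f"
  shows "f \<in> ideal_gen (binomial_of ` {g\<in>M. bdeg g \<le> e})"
proof -
  obtain c j where cj: "j \<in> ideal_gen (binomial_of ` {g\<in>M. bdeg g < e})"
    "hom_part e f = (\<Sum>g\<in>{g\<in>M. bdeg g = e}. single 0 (c g) * binomial_of g) + j"
    using hom_part_in_ideal[OF assms(1-4)] by blast
  have "ideal_gen (binomial_of ` {g\<in>M. bdeg g < e}) \<subseteq>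
      (ideal_gen (binomial_of ` {g\<in>M. bdeg g \<le> e}) :: ('n, 'k) mpolynomial set)"
    by (intro ideal_gen_mono image_mono) auto
  then have "hom_part e f \<in> ideal_gen (binomial_of ` {g\<in>M. bdeg g \<le> e})"
    unfolding cj(2) using cj(1)
    by (intro ideal_gen_add[OF ideal_gen_sum[OF ideal_gen_mult[OF ideal_gen_base]]]) auto
  then show ?thesis using hom_part_homdeg[OF assms(5), of e] by simp
qed

text \<open>A proper conformal decomposition of \<open>u\<close> has summands of smaller degree, by
  balance. Their binomials are generated without \<open>u\<close>, which makes \<open>u\<close>
  redundant.\<close>

lemma minimal_markov_basis_subset_graver_basis:
  fixes A :: "int ^ 'n::finite ^ 'm::finite"
  assumes bal: "balanced A" and M: "minimal_markov_basis TYPE('k::field) A M"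
  shows "M \<subseteq> graver_basis A"
proof
  fix u assume u: "u \<in> M"
  let ?I = "toric_ideal A :: ('n, 'k) mpolynomial set"
  have M: "finite M" "M \<subseteq> int_kernel A" "ideal_gen (binomial_of ` M) = ?I"
    "\<And>N. N \<subset> M \<Longrightarrow> ideal_gen (binomial_of ` N) \<noteq> ?I"
    using M by (auto simp: minimal_markov_basis_def)
  have uk: "u \<in> int_kernel A" using u M by blast
  have irr: "binomial_of u \<notin> (ideal_gen (binomial_of ` (M - {u})) :: ('n, 'k) mpolynomial set)"
  proof
    assume "binomial_of u \<in> (ideal_gen (binomial_of ` (M - {u})) :: ('n, 'k) mpolynomial set)"
    then have "binomial_of ` M \<subseteq> (ideal_gen (binomial_of ` (M - {u})) :: ('n, 'k) mpolynomial set)"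
      using ideal_gen_base[of _ "binomial_of ` (M - {u})"] by blast
    then have "?I \<subseteq> ideal_gen (binomial_of ` (M - {u}))"
      unfolding M(3)[symmetric] by (rule ideal_gen_minimal)
    moreover have "ideal_gen (binomial_of ` (M - {u})) \<subseteq> ?I"
      unfolding M(3)[symmetric] by (intro ideal_gen_mono image_mono) auto
    ultimately show False using M(4)[of "M - {u}"] u by blast
  qed
  have lower: "binomial_of v \<in> (ideal_gen (binomial_of ` (M - {u})) :: ('n, 'k) mpolynomial set)"
    if v: "v \<in> int_kernel A" "bdeg v < bdeg u" for v
  proof -
    have "binomial_of v \<in> (ideal_gen (binomial_of ` M) :: ('n, 'k) mpolynomial set)"
      unfolding M(3) by (rule binomial_in_toric_ideal[OF v(1)])
    then have "binomial_of v \<in> (ideal_gen (binomial_of ` {g\<in>M. bdeg g \<le> bdeg v}) :: ('n, 'k) mpolynomial set)"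
      by (rule homdeg_in_ideal_truncate[OF bal M(2,1)]) (rule homdeg_binomial[OF bal v(1)])
    moreover have "{g\<in>M. bdeg g \<le> bdeg v} \<subseteq> M - {u}" using v(2) by auto
    ultimately show ?thesis using ideal_gen_mono[OF image_mono] by blast
  qed
  show "u \<in> graver_basis A"
  proof (rule ccontr)
    assume ng: "u \<notin> graver_basis A"
    have "u \<noteq> 0" using irr ideal_gen_zero[of "binomial_of ` (M - {u})"] by (metis binomial_of_zero)
    then obtain v where v: "v \<in> int_kernel A" "conformal v u" "v \<noteq> 0" "v \<noteq> u"
      using ng uk by (auto simp: graver_basis_iff)
    define w where "w = u - v"
    have w: "w \<in> int_kernel A" "w \<noteq> 0" using v uk by (auto simp: w_def int_kernel_diff)
    note split = conformal_split[OF v(2), folded w_def]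
    have pos: "bdeg x > 0" if "x \<in> int_kernel A" "x \<noteq> 0" for x
    proof (rule ccontr)
      assume "\<not> bdeg x > 0"
      then have "pos_exp x = 0" "neg_exp x = 0" using tdeg_pos_neg[OF bal that(1)] by auto
      then show False using that(2) pos_exp_eq_neg_exp[of x] by simp
    qed
    have "bdeg u = bdeg v + bdeg w" by (simp add: split tdeg_add)
    then have "bdeg v < bdeg u" "bdeg w < bdeg u" using pos[OF v(1,3)] pos[OF w] by auto
    then have "binomial_of u \<in> (ideal_gen (binomial_of ` (M - {u})) :: ('n, 'k) mpolynomial set)"
      unfolding binomial_of_split[OF split] using v w by (intro ideal_gen_add ideal_gen_mult lower)
    then show False using irr by blast
  qed
qed

text \<open>
  \<open>C\<close> is a union of connected components of the fibre of \<open>u\<close>, where two monomials of a fibre are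
  adjacent if they have a common variable.
\<close>

definition separates :: "int ^ 'n::finite ^ 'm::finite \<Rightarrow> int ^ 'n \<Rightarrow> ('n \<Rightarrow>\<^sub>0 nat) set \<Rightarrow> bool" where
  "separates A u C \<longleftrightarrow> pos_exp u \<in> C \<and> neg_exp u \<notin> C \<and> (\<forall>p\<in>C. tdeg p = bdeg u) \<and>
     (\<forall>p\<in>C. \<forall>q. adeg A p = adeg A q \<and>
        (\<exists>i. lookup p i > 0 \<and> lookup q i > 0) \<longrightarrow> q \<in> C)"

text \<open>The functional \<open>\<phi>\<close>, summing coefficients over \<open>C\<close>, kills
  monomial multiples of lower binomials but takes the value 1 on the binomial of
  \<open>u\<close>.\<close>

lemma binomial_not_in_lower_ideal:
  fixes A :: "int ^ 'n::finite ^ 'm::finite"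
  assumes bal: "balanced A" and C: "separates A u C"
  shows "binomial_of u \<notin> (ideal_gen (binomial_of ` {g\<in>int_kernel A. bdeg g < bdeg u}) :: ('n, 'k::field) mpolynomial set)"
proof
  assume u: "binomial_of u \<in> (ideal_gen (binomial_of ` {g\<in>int_kernel A. bdeg g < bdeg u}) :: ('n, 'k) mpolynomial set)"
  define \<phi> where "\<phi> f = (\<Sum>m\<in>keys f. if m \<in> C then lookup f m else 0)"
    for f :: "('n, 'k) mpolynomial"
  have sup: "\<phi> f = (\<Sum>m\<in>S. if m \<in> C then lookup f m else 0)"
    if "finite S" "keys f \<subseteq> S" for f S
    unfolding \<phi>_def using that by (intro sum.mono_neutral_left) (auto simp: in_keys_iff)
  have add: "\<phi> (f + g) = \<phi> f + \<phi> g" for f g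
  proof -
    let ?S = "keys f \<union> keys g"
    have "\<phi> (f + g) = (\<Sum>m\<in>?S. if m \<in> C then lookup (f + g) m else 0)"
      by (rule sup) (simp_all add: keys_add)
    also have "\<dots> = (\<Sum>m\<in>?S. (if m \<in> C then lookup f m else 0) +
        (if m \<in> C then lookup g m else 0))"
      by (intro sum.cong refl) (simp add: lookup_add)
    also have "\<dots> = \<phi> f + \<phi> g" by (simp add: sum.distrib sup[of ?S f] sup[of ?S g])
    finally show ?thesis .
  qed
  have single: "\<phi> (single m c) = (if m \<in> C then c else 0)" for m c
    by (subst sup[of "{m}"]) auto
  have zero: "\<phi> 0 = 0" by (simp add: \<phi>_def)
  have diff: "\<phi> (f - g) = \<phi> f - \<phi> g" for f g using add[of "f - g" g] by simp
  have sum: "\<phi> (\<Sum>x\<in>S. f x) = (\<Sum>x\<in>S. \<phi> (f x))" for f and S :: "('n \<Rightarrow>\<^sub>0 nat) set"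
    by (induction S rule: infinite_finite_induct) (simp_all add: add zero)
  have mult: "\<phi> (h * binomial_of w) = 0" if w: "w \<in> int_kernel A" "bdeg w < bdeg u" for h w
  proof -
    \<comment> \<open>A multiplier \<open>n \<noteq> 0\<close> is a common variable of both
      monomials, so they lie on the same side of \<open>C\<close>; for \<open>n = 0\<close> both
      have too small a degree to be in \<open>C\<close>.\<close>
    have iff: "n + pos_exp w \<in> C \<longleftrightarrow> n + neg_exp w \<in> C" for n
    proof (cases "n = 0")
      case True
      have "tdeg p = bdeg u" if "p \<in> C" for p using C that unfolding separates_def by blast
      then have "pos_exp w \<notin> C" "neg_exp w \<notin> C" using w(2) tdeg_pos_neg[OF bal w(1)] by (metis less_irrefl)+
      then show ?thesis using True by simp
    next
      case False
      then obtain i where "lookup n i > 0"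
        by (metis gr0I lookup_zero poly_mapping_eqI)
      then have i: "lookup (n + pos_exp w) i > 0" "lookup (n + neg_exp w) i > 0"
        by (simp_all add: lookup_add)
      have "adeg A (n + pos_exp w) = adeg A (n + neg_exp w)" by (simp add: adeg_add adeg_pos_neg[OF w(1)])
      moreover have "q \<in> C" if "p \<in> C" "adeg A p = adeg A q" "lookup p i > 0" "lookup q i > 0" for p q
        using C that unfolding separates_def by blast
      ultimately show ?thesis using i by metis
    qed
    have "h * binomial_of w = (\<Sum>n\<in>keys h. single n (lookup h n)) * binomial_of w"
      by (simp only: sum_single_keys)
    also have "\<dots> = (\<Sum>n\<in>keys h. single (n + pos_exp w) (lookup h n) -
        single (n + neg_exp w) (lookup h n))"
      by (simp add: binomial_of_def sum_distrib_right right_diff_distrib mult_single sum_subtractf)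
    finally have "\<phi> (h * binomial_of w) = (\<Sum>n\<in>keys h.
        \<phi> (single (n + pos_exp w) (lookup h n)) -
        \<phi> (single (n + neg_exp w) (lookup h n)))"
      by (simp only: sum diff)
    also have "\<dots> = 0" unfolding single iff by (intro sum.neutral ballI) (rule diff_self)
    finally show ?thesis .
  qed
  have "\<phi> (binomial_of u) = 0"
    using u unfolding ideal_gen_def
  proof (induction rule: ideal.span_induct_alt)
    case (step h b f)
    then show ?case using mult by (auto simp: add)
  qed (rule zero)
  moreover have "\<phi> (binomial_of u) = 1"
  proof -
    have "pos_exp u \<in> C" "neg_exp u \<notin> C" using C unfolding separates_def by blast+
    then show ?thesis unfolding binomial_of_def diff single by simp
  qed
  ultimately show False by simp
qed

text \<open>
  Exchange: a smallest generating subset of the Graver basis among those containing \<open>u\<close> is minimal,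
  since otherwise \<open>u\<close> could replace a generator of the same degree.
\<close>

lemma separated_in_minimal_markov_basis:
  fixes A :: "int ^ 'n::finite ^ 'm::finite"
  assumes bal: "balanced A" and C: "separates A u C" and u: "u \<in> graver_basis A"
  shows "\<exists>M. minimal_markov_basis TYPE('k::field) A M \<and> u \<in> M"
proof -
  let ?I = "toric_ideal A :: ('n, 'k) mpolynomial set"
  define T where "T S \<longleftrightarrow> S \<subseteq> graver_basis A \<and> u \<in> S \<and> ideal_gen (binomial_of ` S) = ?I" for S
  have "T (graver_basis A)" using u graver_basis_generates by (auto simp: T_def)
  then obtain S where S: "T S" "\<And>S'. T S' \<Longrightarrow> card S \<le> card S'"
    using ex_has_least_nat[of T "graver_basis A" card] by blast
  have S': "S \<subseteq> graver_basis A" "u \<in> S" "ideal_gen (binomial_of ` S) = ?I" "finite S" "S \<subseteq> int_kernel A"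
    using S(1) finite_graver_basis[of A] graver_basis_subset_int_kernel[of A] by (auto simp: T_def intro: finite_subset)
  have uk: "u \<in> int_kernel A" using S' by blast
  have gen: "T S'" if "S' \<subseteq> S" "u \<in> S'" "binomial_of ` S \<subseteq> (ideal_gen (binomial_of ` S') :: ('n, 'k) mpolynomial set)" for S'
  proof -
    have "?I \<subseteq> ideal_gen (binomial_of ` S')" unfolding S'(3)[symmetric] by (rule ideal_gen_minimal[OF that(3)])
    moreover have "ideal_gen (binomial_of ` S') \<subseteq> ?I"
      unfolding S'(3)[symmetric] by (rule ideal_gen_mono[OF image_mono[OF that(1)]])
    ultimately show ?thesis using that S'(1) by (auto simp: T_def)
  qed
  have "ideal_gen (binomial_of ` N) \<noteq> ?I" if N: "N \<subset> S" for N
  proof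
    assume gN: "ideal_gen (binomial_of ` N) = ?I"
    have finN: "finite N" "N \<subseteq> int_kernel A" using N S'(5) finite_subset[OF _ S'(4), of N] by auto
    show False
    proof (cases "u \<in> N")
      case True
      then have "T N" using N S'(1) gN by (auto simp: T_def)
      then show False using S(2)[of N] psubset_card_mono[OF S'(4) N] by simp
    next
      case False
      let ?e = "bdeg u"
      have "binomial_of u \<in> (ideal_gen (binomial_of ` N) :: ('n, 'k) mpolynomial set)"
        unfolding gN by (rule binomial_in_toric_ideal[OF uk])
      then obtain c j where cj: "j \<in> ideal_gen (binomial_of ` {g\<in>N. bdeg g < ?e})"
        "hom_part ?e (binomial_of u) = (\<Sum>g\<in>{g\<in>N. bdeg g = ?e}. single 0 (c g :: 'k) * binomial_of g) + j"
        using hom_part_in_ideal[OF bal finN(2,1)] by blast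
      have "hom_part ?e (binomial_of u :: ('n, 'k) mpolynomial) = binomial_of u"
        using hom_part_homdeg[OF homdeg_binomial[OF bal uk], of ?e] by simp
      then have eq: "binomial_of u = (\<Sum>g\<in>{g\<in>N. bdeg g = ?e}. single 0 (c g) * binomial_of g) + j"
        using cj(2) by simp
      \<comment> \<open>A constant nonzero coefficient at some \<open>g\<close> of the degree of
        \<open>u\<close> allows solving for the binomial of \<open>g\<close>, so that
        \<open>u\<close> replaces it.\<close>
      have "\<exists>g\<in>N. bdeg g = ?e \<and> c g \<noteq> 0"
      proof (rule ccontr)
        assume "\<not> ?thesis"
        then have "binomial_of u = j" using eq by simp
        moreover have "ideal_gen (binomial_of ` {g\<in>N. bdeg g < ?e}) \<subseteq>
            (ideal_gen (binomial_of ` {g\<in>int_kernel A. bdeg g < ?e}) :: ('n, 'k) mpolynomial set)"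
          using finN(2) by (intro ideal_gen_mono image_mono) auto
        ultimately have "binomial_of u \<in> (ideal_gen (binomial_of ` {g\<in>int_kernel A. bdeg g < ?e}) :: ('n, 'k) mpolynomial set)"
          using cj(1) by auto
        then show False using binomial_not_in_lower_ideal[OF bal C] by blast
      qed
      then obtain g where g: "g \<in> N" "bdeg g = ?e" "c g \<noteq> 0" by blast
      let ?J = "ideal_gen (binomial_of ` (S - {g})) :: ('n, 'k) mpolynomial set"
      have gu: "g \<noteq> u" "g \<in> S" using g False N by auto
      let ?R = "\<Sum>g\<in>{g\<in>N. bdeg g = ?e} - {g}. single 0 (c g) * binomial_of g :: ('n, 'k) mpolynomial"
      have "binomial_of u = (single 0 (c g) * binomial_of g + ?R) + j"
        unfolding eq using g finN(1) by (subst sum.remove[of "{g\<in>N. bdeg g = ?e}" g]) auto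
      then have cg: "single 0 (c g) * binomial_of g = binomial_of u - (?R + j)"
        by (simp add: algebra_simps)
      have "j \<in> ?J"
      proof -
        have "{g\<in>N. bdeg g < ?e} \<subseteq> S - {g}" using N g by auto
        then show ?thesis using cj(1) ideal_gen_mono[OF image_mono] by blast
      qed
      moreover have "?R \<in> ?J"
        using N by (intro ideal_gen_sum ideal_gen_mult ideal_gen_base) auto
      moreover have "binomial_of u \<in> ?J" using gu S'(2) by (intro ideal_gen_base) auto
      ultimately have "single 0 (c g) * binomial_of g \<in> ?J"
        unfolding cg by (intro ideal_gen_diff ideal_gen_add)
      then have "single 0 (inverse (c g)) * (single 0 (c g) * binomial_of g) \<in> ?J"
        by (rule ideal_gen_mult)
      moreover have "single 0 (inverse (c g)) * (single 0 (c g) * binomial_of g) =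
          (binomial_of g :: ('n, 'k) mpolynomial)"
        unfolding mult.assoc[symmetric] mult_single using g(3) by simp
      ultimately have "binomial_of g \<in> ?J" by simp
      then have "binomial_of ` S \<subseteq> ?J" using ideal_gen_base[of _ "binomial_of ` (S - {g})"] by blast
      then have "T (S - {g})" using gu S'(2) by (intro gen) auto
      then have "card S \<le> card (S - {g})" by (rule S(2))
      then show False using card_Diff1_less[OF S'(4) gu(2)] by simp
    qed
  qed
  then have "minimal_markov_basis TYPE('k) A S"
    using S' by (simp add: minimal_markov_basis_def)
  then show ?thesis using S'(2) by blast
qed

section \<open>Separating the monomials of a Graver element\<close>

lemma class_sums_nonpos_zero:
  fixes x :: "int ^ 'n::finite"
  assumes B: "\<And>i. i \<in> B \<Longrightarrow> cls A i \<subseteq> B" and sum: "(\<Sum>i\<in>B. x $ i) = 0"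
    and le: "\<And>i. i \<in> B \<Longrightarrow> csum A x i \<le> 0" and j: "j \<in> B"
  shows "csum A x j = 0"
proof -
  let ?s = "\<lambda>b. \<Sum>i\<in>{i\<in>B. column i A = b}. x $ i"
  have cs: "?s (column i A) = csum A x i" if "i \<in> B" for i
    unfolding csum_def using B[OF that] by (intro sum.cong) (auto simp: cls_def)
  have "(\<Sum>b\<in>(\<lambda>i. column i A) ` B. - ?s b) = 0"
    unfolding sum_negf by (subst sum.group) (use sum in auto)
  moreover have "\<forall>b\<in>(\<lambda>i. column i A) ` B. - ?s b \<ge> 0" using cs le by auto
  ultimately have "\<forall>b\<in>(\<lambda>i. column i A) ` B. - ?s b = 0"
    by (subst (asm) sum_nonneg_eq_0_iff) auto
  then show ?thesis using cs[OF j] j by auto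
qed

lemma bounded_summands:
  fixes f :: "'a \<Rightarrow> nat"
  assumes "finite S" "s \<le> (\<Sum>i\<in>S. f i)"
  shows "\<exists>g. (\<forall>i. g i \<le> f i) \<and> (\<Sum>i\<in>S. g i) = s"
  using assms
proof (induction S arbitrary: s rule: finite_induct)
  case empty
  then show ?case by (intro exI[of _ "\<lambda>_. 0"]) simp
next
  case (insert x S)
  have "s - min s (f x) \<le> (\<Sum>i\<in>S. f i)" using insert by simp
  then obtain g where g: "\<forall>i. g i \<le> f i" "(\<Sum>i\<in>S. g i) = s - min s (f x)" using insert.IH by blast
  have "(\<Sum>i\<in>S. (g(x := min s (f x))) i) = (\<Sum>i\<in>S. g i)" using insert.hyps by (intro sum.cong) auto
  then show ?case using g insert.hyps by (intro exI[of _ "g(x := min s (f x))"]) simp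
qed

text \<open>As \<open>u\<close> has one sign on each class, the prescribed class sum can be
  distributed over the class without exceeding the absolute entries of \<open>u\<close>.\<close>

lemma conformal_lift:
  fixes A :: "int ^ 'n::finite ^ 'm::finite" and u D :: "int ^ 'n"
  assumes sign: "\<And>i j. i \<in> cls A j \<Longrightarrow> \<not> (u $ i > 0 \<and> u $ j < 0)"
    and between: "\<And>j. 0 \<le> csum A D j \<and> csum A D j \<le> csum A u j \<or> csum A u j \<le> csum A D j \<and> csum A D j \<le> 0"
  obtains v where "conformal v u" "\<And>j. csum A v j = csum A D j"
proof -
  have abs_sum: "\<bar>csum A u j\<bar> = (\<Sum>i\<in>cls A j. \<bar>u $ i\<bar>)" for j
  proof (cases "\<exists>i\<in>cls A j. u $ i > 0")
    case True
    then obtain i where i: "i \<in> cls A j" "u $ i > 0" by blast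
    have nn: "u $ k \<ge> 0" if "k \<in> cls A j" for k
      using sign[of i k] i that by (auto simp: cls_def)
    then show ?thesis by (simp add: csum_def sum_nonneg)
  next
    case False
    then have np: "u $ k \<le> 0" if "k \<in> cls A j" for k using that by force
    then have "csum A u j \<le> 0" by (simp add: csum_def sum_nonpos)
    then have "\<bar>csum A u j\<bar> = (\<Sum>i\<in>cls A j. - (u $ i))" by (simp add: csum_def sum_negf)
    also have "\<dots> = (\<Sum>i\<in>cls A j. \<bar>u $ i\<bar>)" using np by (intro sum.cong) auto
    finally show ?thesis .
  qed
  have "\<exists>g. (\<forall>i. g i \<le> nat \<bar>u $ i\<bar>) \<and> (\<Sum>i\<in>cls A j. g i) = nat \<bar>csum A D j\<bar>" for j
  proof (rule bounded_summands)
    have "int (\<Sum>i\<in>cls A j. nat \<bar>u $ i\<bar>) = \<bar>csum A u j\<bar>" by (simp add: abs_sum)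
    moreover have "\<bar>csum A D j\<bar> \<le> \<bar>csum A u j\<bar>" using between[of j] by linarith
    ultimately show "nat \<bar>csum A D j\<bar> \<le> (\<Sum>i\<in>cls A j. nat \<bar>u $ i\<bar>)" by linarith
  qed simp
  then obtain g where g: "\<And>i j. g j i \<le> nat \<bar>u $ i\<bar>" "\<And>j. (\<Sum>i\<in>cls A j. g j i) = nat \<bar>csum A D j\<bar>" by metis
  define v :: "int ^ 'n" where
    "v = (\<chi> i. if u $ i \<ge> 0 then int (g (class_rep A i) i) else - int (g (class_rep A i) i))"
  have "conformal v u"
    unfolding conformal_def
  proof
    fix i show "nat (v $ i) \<le> nat (u $ i) \<and> nat (- (v $ i)) \<le> nat (- (u $ i))"
      using g(1)[of "class_rep A i" i] by (cases "u $ i \<ge> 0") (auto simp: v_def)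
  qed
  moreover have "csum A v j = csum A D j" for j
  proof -
    let ?r = "class_rep A j"
    have r: "cls A ?r = cls A j" "csum A D ?r = csum A D j" using class_rep_cls[of A j] cls_cong csum_cls by blast+
    have gs: "(\<Sum>i\<in>cls A j. int (g ?r i)) = \<bar>csum A D j\<bar>"
      using arg_cong[OF g(2)[of ?r], of int] by (simp add: r)
    show ?thesis
    proof (cases "csum A u j \<ge> 0")
      case True
      have "u $ i \<ge> 0" if "i \<in> cls A j" for i
      proof (rule ccontr)
        assume n: "\<not> u $ i \<ge> 0"
        then have "u $ k \<le> 0" if "k \<in> cls A j" for k
          using sign[of k i] that n \<open>i \<in> cls A j\<close> by (force simp: cls_def)
        then have "(\<Sum>k\<in>cls A j - {i}. u $ k) \<le> 0" by (intro sum_nonpos) auto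
        moreover have "csum A u j = u $ i + (\<Sum>k\<in>cls A j - {i}. u $ k)"
          unfolding csum_def by (rule sum.remove) (use that in simp_all)
        ultimately have "csum A u j < 0" using n by simp
        then show False using True by simp
      qed
      then have "csum A v j = (\<Sum>i\<in>cls A j. int (g ?r i))"
        unfolding csum_def v_def by (intro sum.cong refl) (simp add: class_rep_cong)
      then show ?thesis using gs between[of j] True by linarith
    next
      case False
      have np: "u $ i \<le> 0" if "i \<in> cls A j" for i
      proof (rule ccontr)
        assume n: "\<not> u $ i \<le> 0"
        then have "u $ k \<ge> 0" if "k \<in> cls A j" for k
          using sign[of i k] that \<open>i \<in> cls A j\<close> by (force simp: cls_def)
        then have "csum A u j \<ge> 0" unfolding csum_def by (rule sum_nonneg)
        then show False using False by simp
      qed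
      have "csum A v j = (\<Sum>i\<in>cls A j. - int (g ?r i))"
        unfolding csum_def v_def
      proof (intro sum.cong refl)
        fix i assume i: "i \<in> cls A j"
        show "(\<chi> i. if u $ i \<ge> 0 then int (g (class_rep A i) i) else - int (g (class_rep A i) i)) $ i = - int (g ?r i)"
          using np[OF i] g(1)[of ?r i] by (cases "u $ i = 0") (simp_all add: class_rep_cong[OF i])
      qed
      then have "csum A v j = - \<bar>csum A D j\<bar>" using gs by (simp add: sum_negf)
      then show ?thesis using between[of j] False by linarith
    qed
  qed
  ultimately show ?thesis by (rule that)
qed

lemma adeg_eq_imp_tdeg_eq:
  assumes "balanced A" "adeg A p = adeg A q"
  shows "tdeg p = tdeg q"
proof -
  obtain u r where "u \<in> int_kernel A" "p = r + pos_exp u" "q = r + neg_exp u"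
    using adeg_eq_imp[OF assms(2)] by blast
  then show ?thesis using tdeg_pos_neg[OF assms(1)] by (simp add: tdeg_add)
qed

text \<open>The difference of two unit vectors is then a conformal kernel vector, so it equals
  \<open>u\<close>. The fibre has degree one, and distinct variables share nothing.\<close>

lemma separates_same_class:
  fixes A :: "int ^ 'n::finite ^ 'm::finite"
  assumes bal: "balanced A" and u: "u \<in> graver_basis A" and ij: "i \<in> cls A j" "u $ i > 0" "u $ j < 0"
  shows "separates A u {pos_exp u}"
proof -
  have ne: "i \<noteq> j" using ij by auto
  define v :: "int ^ 'n" where "v = axis i 1 - axis j 1"
  have vi: "v $ k = (if k = i then 1 else if k = j then - 1 else 0)" for k
    using ne by (simp add: v_def axis_def)
  have "csum A v k = 0" for k
    using ij(1) by (auto simp: csum_def v_def axis_def sum_subtractf cls_def)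
  then have "v \<in> int_kernel A" by (rule int_kernel_if_csum_zero)
  moreover have "conformal v u" using ij by (auto simp: conformal_def vi)
  moreover have "v \<noteq> 0" using vi[of i] by auto
  ultimately have uv: "u = v" using u by (auto simp: graver_basis_iff)
  have pos: "pos_exp u = single i 1"
    by (rule poly_mapping_eqI) (auto simp: uv vi lookup_single when_def)
  have "q = pos_exp u" if q: "adeg A (pos_exp u) = adeg A q" "lookup (pos_exp u) k > 0" "lookup q k > 0" for q k
  proof -
    have k: "k = i" using q(2) by (auto simp: pos lookup_single when_def split: if_splits)
    have "tdeg q = tdeg (single i 1)" using adeg_eq_imp_tdeg_eq[OF bal q(1)] by (simp add: pos)
    moreover have split: "(q - single i 1) + single i 1 = q"
      using q(3) k by (intro minus_single_add) simp
    moreover have "tdeg q = tdeg (q - single i 1) + tdeg (single i 1)"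
      by (subst split[symmetric]) (rule tdeg_add)
    ultimately have "q - single i 1 = 0" by simp
    then show ?thesis using split by (simp add: pos)
  qed
  moreover have "neg_exp u \<noteq> pos_exp u" using pos_exp_eq_neg_exp[of u] ij by auto
  ultimately show ?thesis unfolding separates_def by blast
qed

definition class_deg :: "int ^ 'n::finite ^ 'm::finite \<Rightarrow> ('n \<Rightarrow>\<^sub>0 nat) \<Rightarrow> 'n \<Rightarrow> nat" where
  "class_deg A m j = (\<Sum>i\<in>cls A j. lookup m i)"

text \<open>
  The class degrees of \<open>u\<^sup>+\<close> cut out a component: as the entries of a kernel vector sum to zero over
  every bouquet, a move from such a monomial that leaves these class degrees has to be conformal to
  \<open>u\<close> on class sums, hence equal to \<open>u\<close> there, and then no variable is common to both ends.
\<close>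

lemma separates_class_degrees:
  fixes A :: "int ^ 'n::finite ^ 'm::finite"
  assumes bal: "balanced A" and u: "u \<in> graver_basis A"
    and sign: "\<And>i j. i \<in> cls A j \<Longrightarrow> \<not> (u $ i > 0 \<and> u $ j < 0)"
    and bouquet: "\<And>j x. \<not> free_class A j \<Longrightarrow> x \<in> int_kernel A \<Longrightarrow> (\<Sum>i\<in>bouquet A j. x $ i) = 0"
  shows "separates A u {p. \<forall>j. class_deg A p j = class_deg A (pos_exp u) j}"
proof -
  have uk: "u \<in> int_kernel A" "u \<noteq> 0" using u by (auto simp: graver_basis_iff)
  have cd_diff: "csum A (\<chi> i. int (lookup p i) - int (lookup q i)) j =
      int (class_deg A p j) - int (class_deg A q j)" for p q j
    by (simp add: csum_def class_deg_def sum_subtractf)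
  have cd_u: "csum A u j = int (class_deg A (pos_exp u) j) - int (class_deg A (neg_exp u) j)" for j
  proof -
    have "csum A u j = (\<Sum>i\<in>cls A j. int (nat (u $ i)) - int (nat (- (u $ i))))"
      unfolding csum_def by (intro sum.cong) auto
    then show ?thesis by (simp add: class_deg_def sum_subtractf)
  qed
  have not_both: "class_deg A (pos_exp u) j = 0 \<or> class_deg A (neg_exp u) j = 0" for j
  proof (rule ccontr)
    assume "\<not> ?thesis"
    then obtain i k where "i \<in> cls A j" "u $ i > 0" "k \<in> cls A j" "u $ k < 0"
      by (auto simp: class_deg_def)
    then show False using sign[of i k] by (auto simp: cls_def)
  qed
  have cls_bouquet: "cls A i \<subseteq> bouquet A j" if "i \<in> bouquet A j" for i j
    using that by (auto simp: bouquet_def free_class_cls csum_cls)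
  have self: "j \<in> bouquet A j" if "\<not> free_class A j" for j using that by (simp add: bouquet_def)
  have closed: "class_deg A q j = class_deg A (pos_exp u) j"
    if p: "\<forall>j. class_deg A p j = class_deg A (pos_exp u) j" and pq: "adeg A p = adeg A q"
      and k: "lookup p k > 0" "lookup q k > 0" for p q k j
  proof -
    define D :: "int ^ 'n" where "D = (\<chi> i. int (lookup p i) - int (lookup q i))"
    have D: "D \<in> int_kernel A"
      using pq by (simp add: D_def adeg_eq_iff)
    have cD: "csum A D j = int (class_deg A (pos_exp u) j) - int (class_deg A q j)" for j
      unfolding D_def cd_diff using p by simp
    \<comment> \<open>Class degrees of \<open>q\<close> are nonnegative, and those of
      \<open>p\<close> are those of the positive part of \<open>u\<close>, which vanish wherever
      \<open>csum A u j < 0\<close>.\<close>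
    have up: "csum A D j \<le> max (csum A u j) 0" for j using not_both[of j] by (auto simp: cD cd_u)
    have between: "0 \<le> csum A D j \<and> csum A D j \<le> csum A u j \<or> csum A u j \<le> csum A D j \<and> csum A D j \<le> 0" for j
    proof (cases "free_class A j")
      case True
      then show ?thesis using D uk by (simp add: free_class_def)
    next
      case nf: False
      let ?B = "bouquet A j"
      show ?thesis
      proof (cases "csum A u j = 0")
        case True
        have "csum A D i \<le> 0" if "i \<in> ?B" for i
          using that True uk(1) up[of i] by (auto simp: bouquet_def)
        then have "csum A D j = 0"
          using class_sums_nonpos_zero[OF cls_bouquet bouquet[OF nf D] _ self[OF nf]] by blast
        then show ?thesis using True by simp
      next
        case nz: False
        \<comment> \<open>\<open>w\<close> is the combination of \<open>D\<close> and
          \<open>u\<close> with zero class sum at \<open>j\<close>; by definition of the bouquet its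
          class sum at \<open>i\<close> vanishes too.\<close>
        have ratio: "csum A D i * csum A u j = csum A D j * csum A u i" if i: "i \<in> ?B" for i
        proof -
          define w where "w = csum A u j *s D + (- csum A D j *s u + 0)"
          have "w \<in> int_kernel A" unfolding w_def using D uk(1) by (intro int_kernel_lincomb int_kernel_zero)
          moreover have cw: "csum A w i = csum A u j * csum A D i - csum A D j * csum A u i" for i
            by (simp add: w_def csum_add csum_smult csum_diff)
          moreover have "csum A w j = 0" by (simp add: cw)
          ultimately have "csum A w i = 0" using i by (auto simp: bouquet_def)
          then show ?thesis by (simp add: cw mult.commute)
        qed
        \<comment> \<open>The sums over the bouquet vanish while the class sum at \<open>j\<close>
          does not, so both signs occur. As \<open>D\<close> is proportional to \<open>u\<close>
          there, \<open>up\<close> at \<open>im\<close> bounds the ratio below by 0 and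
          \<open>up\<close> at \<open>ip\<close> bounds it above by 1.\<close>
        have "\<exists>i\<in>?B. csum A u i > 0"
        proof (rule ccontr)
          assume "\<not> ?thesis"
          then have "csum A u i \<le> 0" if "i \<in> ?B" for i using that by force
          then show False
            using class_sums_nonpos_zero[OF cls_bouquet bouquet[OF nf uk(1)] _ self[OF nf]] nz by blast
        qed
        then obtain ip where ip: "ip \<in> ?B" "csum A u ip > 0" by blast
        have neg: "csum A (- x) i = - csum A x i" for x :: "int ^ 'n" and i by (simp add: csum_def sum_negf)
        have "\<exists>i\<in>?B. csum A u i < 0"
        proof (rule ccontr)
          assume "\<not> ?thesis"
          then have "csum A (- u) i \<le> 0" if "i \<in> ?B" for i using that by (force simp: neg)
          then have "csum A (- u) j = 0"
            using class_sums_nonpos_zero[OF cls_bouquet bouquet[OF nf int_kernel_uminus[OF uk(1)]] _ self[OF nf]] by blast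
          then show False using nz by (simp add: neg)
        qed
        then obtain im where im: "im \<in> ?B" "csum A u im < 0" by blast
        show ?thesis
        proof (cases "csum A u j > 0")
          case True
          have "csum A D im \<le> 0" using up[of im] im by simp
          then have "csum A D j * csum A u im \<le> 0"
            using ratio[OF im(1)] True by (metis less_imp_le mult_nonpos_nonneg)
          then have "csum A D j \<ge> 0" using im(2) by (simp add: mult_le_0_iff)
          then show ?thesis using up[of j] True by simp
        next
          case False
          then have neg: "csum A u j < 0" using nz by simp
          have "csum A D ip \<le> csum A u ip" using up[of ip] ip by simp
          then have "csum A u ip * csum A u j \<le> csum A D ip * csum A u j"
            using neg by (intro mult_right_mono_neg) auto
          then have "csum A u j * csum A u ip \<le> csum A D j * csum A u ip" using ratio[OF ip(1)] by (simp add: mult.commute)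
          then have "csum A u j \<le> csum A D j" using ip(2) by simp
          then show ?thesis using up[of j] neg by simp
        qed
      qed
    qed
    obtain v where v: "conformal v u" "\<And>j. csum A v j = csum A D j"
      using conformal_lift[OF sign between] by blast
    have "csum A (v - D) j = 0" for j by (simp add: csum_diff v(2))
    then have "v - D \<in> int_kernel A" by (rule int_kernel_if_csum_zero)
    then have "1 *s (v - D) + D \<in> int_kernel A" using D by (rule int_kernel_lincomb)
    then have "v \<in> int_kernel A" by simp
    then have "v = 0 \<or> v = u" using u v(1) by (auto simp: graver_basis_iff)
    \<comment> \<open>Otherwise \<open>q\<close> would have the class degrees of the negative part
      of \<open>u\<close>, which has none in the class of the common variable
      \<open>k\<close>.\<close>
    moreover have "v \<noteq> u"
    proof
      assume "v = u"
      then have "csum A D k = csum A u k" using v(2)[of k] by simp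
      then have "class_deg A q k = class_deg A (neg_exp u) k" using cD[of k] cd_u[of k] by simp
      moreover have "class_deg A x k > 0" if "lookup x k > 0" for x
        using that member_le_sum[of k "cls A k" "lookup x"] by (simp add: class_deg_def)
      ultimately show False using k p not_both[of k] by (metis less_irrefl)
    qed
    ultimately have "csum A D j = 0" using v(2)[of j] by (simp add: csum_def)
    then show ?thesis using cD[of j] by simp
  qed
  have "neg_exp u \<notin> {p. \<forall>j. class_deg A p j = class_deg A (pos_exp u) j}"
  proof
    assume "neg_exp u \<in> {p. \<forall>j. class_deg A p j = class_deg A (pos_exp u) j}"
    then have "class_deg A (pos_exp u) j = 0 \<and> class_deg A (neg_exp u) j = 0" for j using not_both[of j] by auto
    then have "\<forall>i\<in>cls A j. nat (u $ i) = 0 \<and> nat (- (u $ i)) = 0" for j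
      by (simp add: class_deg_def)
    then have "nat (u $ j) = 0 \<and> nat (- (u $ j)) = 0" for j using cls_self by blast
    then have "u $ j = 0" for j by (metis nat_0_iff neg_le_0_iff_le order_antisym)
    then have "u = 0" by (simp add: vec_eq_iff)
    then show False using uk by simp
  qed
  moreover have "tdeg p = bdeg u" if p: "\<forall>j. class_deg A p j = class_deg A (pos_exp u) j" for p
  proof -
    have "(\<chi> i. int (lookup p i) - int (lookup (pos_exp u) i)) \<in> int_kernel A"
      by (rule int_kernel_if_csum_zero) (simp only: cd_diff p diff_self)
    then have "(\<Sum>i\<in>UNIV. int (lookup p i) - int (lookup (pos_exp u) i)) = 0"
      using bal unfolding balanced_def by force
    then have "int (tdeg p) = int (bdeg u)" by (simp add: tdeg_def sum_subtractf)
    then show ?thesis by simp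
  qed
  ultimately show ?thesis unfolding separates_def using closed by blast
qed

theorem theorem4p6:
  fixes A :: "int ^ 'n::finite ^ 'm::finite"
  assumes "ones_in_row_span A"
    and "self_dual (toric_variety A :: ('k::{alg_closed_field, field_char_0} ^ 'n) set set)"
  shows "weakly_robust TYPE('k) A"
proof -
  have bal: "balanced A" by (rule balanced_if_ones_in_row_span[OF assms(1)])
  have "graver_basis A = universal_markov_basis TYPE('k) A"
  proof
    show "universal_markov_basis TYPE('k) A \<subseteq> graver_basis A"
      using minimal_markov_basis_subset_graver_basis[OF bal] by (auto simp: universal_markov_basis_def)
    show "graver_basis A \<subseteq> universal_markov_basis TYPE('k) A"
    proof
      fix u assume u: "u \<in> graver_basis A"
      have "\<exists>C. separates A u C"
      \<comment> \<open>The class-degree component requires that \<open>u\<close> does not take both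
        signs on one class.\<close>
      proof (cases "\<exists>i j. i \<in> cls A j \<and> u $ i > 0 \<and> u $ j < 0")
        case True
        then show ?thesis using separates_same_class[OF bal u] by blast
      next
        case False
        have "separates A u {p. \<forall>j. class_deg A p j = class_deg A (pos_exp u) j}"
          by (rule separates_class_degrees[OF bal u _ bouquet_sum_zero[OF bal assms(2)]]) (use False in blast)
        then show ?thesis by blast
      qed
      then show "u \<in> universal_markov_basis TYPE('k) A"
        using separated_in_minimal_markov_basis[OF bal _ u] by (auto simp: universal_markov_basis_def)
    qed
  qed
  then show ?thesis by (simp add: weakly_robust_def)
qed

end
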